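(* Let $d\ge 1$ and let $\Gamma$ be a finite graph with $d+2$ or more vertices. If $\Gamma$ does not have a minimal stress kernel in $\mathbb{E}^d$ (that is, if $k_{\min}(\Gamma,d)\neq d+1$), then any generic framework $\rho\in C^d(\Gamma)$ is not globally rigid in $\mathbb{E}^d$.
   Context: A graph $\Gamma$ has a finite vertex set $\mathcal V$ of size $v$ and an edge set $\mathcal E$ of size $e$ consisting of two-element subsets of $\mathcal V$. A framework $\rho$ of $\Gamma$ in Euclidean space $\mathbb{E}^d$ is a map $\mathcal V\to\mathbb{E}^d$; $C^d(\Gamma)\cong\mathbb{R}^{vd}$ is the space of all of them. The length-squared map $\ell:C^d(\Gamma)\to\mathbb{R}^e$ has component $|\rho(u)-\rho(w)|^2$ at the edge $\{u,w\}$. Two frameworks are congruent if they differ by an element of $\mathrm{Eucl}(d)$, the group of rigid motions (rotations, reflections, translations) of $\mathbb{E}^d$. $\rho\in C^d(\Gamma)$ is globally rigid if every $\sigma\in C^d(\Gamma)$ with $\ell(\sigma)=\ell(\rho)$ is congruent to $\rho$. $\rho$ is generic if its $vd$ coordinates satisfy no non-trivial polynomial equation with rational coefficients. An equilibrium stress matrix of $\rho$ is a real symmetric matrix $\Omega$ indexed by $\mathcal V\times\mathcal V$ with $\Omega(u,w)=0$ whenever $u\ne w$ and $\{u,w\}\notin\mathcal E$, with $\sum_{w}\Omega(u,w)=0$ for all $u$, and with $\sum_{w}\Omega(u,w)\rho(w)=0$ for all $u$. Let $k(\Omega)=\dim\ker\Omega$. Let $k_{\min}(\Gamma,d)$ be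 the minimum of $k(\Omega)$ as $\Omega$ ranges over all equilibrium stress matrices of all generic frameworks in $C^d(\Gamma)$. (One always has $k_{\min}(\Gamma,d)\ge d+1$ when $v\ge d+1$.) $\Gamma$ has a minimal stress kernel in $\mathbb{E}^d$ if $k_{\min}(\Gamma,d)=d+1$. *)

theory Defs
  imports "HOL-Analysis.Analysis" "HOL-Library.Poly_Mapping"
begin

text \<open>
  The vertex set of a graph is the finite type \<open>'v\<close>, so that \<open>v = CARD('v)\<close>, and the graph is given
  by its edge set. Euclidean d-space is \<open>real ^ 'd\<close> with \<open>d = CARD('d)\<close>, and the space of frameworks
  is \<open>real ^ 'd ^ 'v\<close>, a framework \<open>\<rho>\<close> placing the vertex \<open>u\<close> at \<open>\<rho> $ u\<close>.
\<close>

definition graph :: "'v set set \<Rightarrow> bool" where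
  "graph E \<longleftrightarrow> (\<forall>e\<in>E. card e = 2)"

text \<open>The description is unambiguous because \<open>{u, w} = {w, u}\<close> is the only coincidence between
  representations of a two-element set; see \<open>length_sq_edge\<close>.\<close>

definition length_sq :: "'v::finite set set \<Rightarrow> real ^ 'd ^ 'v \<Rightarrow> 'v set \<Rightarrow> real" where
  "length_sq E \<rho> = (\<lambda>e\<in>E. THE l. \<exists>u w. e = {u, w} \<and> l = (norm (\<rho> $ u - \<rho> $ w))\<^sup>2)"

lemma length_sq_edge:
  fixes \<rho> :: "real ^ 'd ^ 'v"
  assumes "{u, w} \<in> E"
  shows "length_sq E \<rho> {u, w} = (norm (\<rho> $ u - \<rho> $ w))\<^sup>2"
proof -
  have "(THE l. \<exists>u' w'. {u, w} = {u', w'} \<and> l = (norm (\<rho> $ u' - \<rho> $ w'))\<^sup>2)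
      = (norm (\<rho> $ u - \<rho> $ w))\<^sup>2"
    by (rule the_equality) (auto simp: doubleton_eq_iff norm_minus_commute)
  with assms show ?thesis by (simp add: length_sq_def)
qed

definition Eucl :: "(real ^ 'd \<Rightarrow> real ^ 'd) set" where
  "Eucl = {T. \<exists>g a. orthogonal_transformation g \<and> T = (\<lambda>x. g x + a)}"

definition congruent_frameworks :: "real ^ 'd ^ 'v \<Rightarrow> real ^ 'd ^ 'v \<Rightarrow> bool" where
  "congruent_frameworks \<rho> \<sigma> \<longleftrightarrow> (\<exists>T\<in>Eucl. \<forall>u. \<sigma> $ u = T (\<rho> $ u))"

definition globally_rigid :: "'v::finite set set \<Rightarrow> real ^ 'd ^ 'v \<Rightarrow> bool" where
  "globally_rigid E \<rho> \<longleftrightarrow>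
     (\<forall>\<sigma> :: real ^ 'd ^ 'v. length_sq E \<sigma> = length_sq E \<rho> \<longrightarrow> congruent_frameworks \<rho> \<sigma>)"

text \<open>A polynomial over the rationals in variables indexed by \<open>'i\<close> is a finitely supported map
  from monomials (finitely supported exponent functions \<open>'i \<Rightarrow>\<^sub>0 nat\<close>) to coefficients.\<close>

definition eval_rat_poly :: "(('i \<Rightarrow>\<^sub>0 nat) \<Rightarrow>\<^sub>0 rat) \<Rightarrow> ('i \<Rightarrow> real) \<Rightarrow> real" where
  "eval_rat_poly p x =
     (\<Sum>m\<in>Poly_Mapping.keys p. of_rat (Poly_Mapping.lookup p m) *
        (\<Prod>i\<in>Poly_Mapping.keys m. x i ^ Poly_Mapping.lookup m i))"

definition generic :: "real ^ 'd ^ 'v \<Rightarrow> bool" where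
  "generic \<rho> \<longleftrightarrow>
     (\<forall>p :: (('v \<times> 'd) \<Rightarrow>\<^sub>0 nat) \<Rightarrow>\<^sub>0 rat.
        p \<noteq> 0 \<longrightarrow> eval_rat_poly p (\<lambda>(u, i). \<rho> $ u $ i) \<noteq> 0)"

definition equilibrium_stress_matrix ::
    "'v::finite set set \<Rightarrow> real ^ 'd ^ 'v \<Rightarrow> real ^ 'v ^ 'v \<Rightarrow> bool" where
  "equilibrium_stress_matrix E \<rho> \<Omega> \<longleftrightarrow>
     transpose \<Omega> = \<Omega> \<and>
     (\<forall>u w. u \<noteq> w \<and> {u, w} \<notin> E \<longrightarrow> \<Omega> $ u $ w = 0) \<and>
     (\<forall>u. (\<Sum>w\<in>UNIV. \<Omega> $ u $ w) = 0) \<and>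
     (\<forall>u. (\<Sum>w\<in>UNIV. \<Omega> $ u $ w *\<^sub>R \<rho> $ w) = 0)"

definition stress_kernel_dim :: "real ^ 'v ^ 'v::finite \<Rightarrow> nat" where
  "stress_kernel_dim \<Omega> = dim {x :: real ^ 'v. \<Omega> *v x = 0}"

text \<open>The zero matrix is an equilibrium stress matrix of every framework and generic frameworks
  exist, so this is a minimum over a nonempty set.\<close>

definition k_min :: "'v::finite set set \<Rightarrow> 'd::finite itself \<Rightarrow> nat" where
  "k_min E (_ :: 'd itself) =
     (LEAST k. \<exists>(\<rho> :: real ^ 'd ^ 'v) \<Omega>.
        generic \<rho> \<and> equilibrium_stress_matrix E \<rho> \<Omega> \<and> k = stress_kernel_dim \<Omega>)"

definition minimal_stress_kernel :: "'v::finite set set \<Rightarrow> 'd::finite itself \<Rightarrow> bool" where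
  "minimal_stress_kernel E (d :: 'd itself) \<longleftrightarrow> k_min E d = CARD('d) + 1"

end

theory Submission
  imports Defs "HOL-Homology.Homology"
begin

text \<open>
  Let \<open>K\<close> be the kernel of an equilibrium stress matrix of a generic framework \<open>\<rho>\<close> for which \<open>dim K\<close>
  is as small as possible. By genericity the kernels of the stresses of nearby frameworks do not drop in
  dimension, and this makes the contact locus flat: the squared lengths of all frameworks with
  coordinates in \<open>K\<close> lie in a linear space \<open>B\<close>, the image of the derivative at \<open>\<rho>\<close>. If \<open>\<rho>\<close> is globally
  rigid it is infinitesimally rigid, so frameworks with coordinates in \<open>K\<close> modulo rigid motions have
  the same dimension as \<open>B\<close>. If \<open>dim K \<ge> d + 2\<close>, the singularities of that quotient have codimension at least two,
  and the length map to \<open>B\<close> is proper and not surjective, so that its degree modulo 2 vanishes and the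
  regular point \<open>\<rho>\<close> is not alone in its fibre.

  The quotient may be non-orientable, so integral degrees are not available for it. Instead a
  fundamental domain of trapezoidal matrices is cut along a hyperplane: the single nondegenerate
  zero of the length map minus its value at \<open>\<rho>\<close> forces degree 1 on the boundary, while on
  the hyperplane the map is invariant under an involution, which forces an even degree.
\<close>

text \<open>Constants are split off from \<open>K\<close>, so a framework becomes an
  \<open>n\<close>-by-\<open>d\<close> matrix of coefficients with \<open>n = dim K - 1\<close>. The
  orthogonal group is used up by making this matrix trapezoidal with nonnegative diagonal; the
  number of free entries is then the dimension of \<open>B\<close>. The walls of this domain are
  given by vanishing diagonal entries. All walls but the last have images of codimension two in
  \<open>B\<close>, so the map can be pushed across them in a generic direction without creating
  zeros. For the last wall there is no further column to rotate with: it is the cutting hyperplane,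
  and the change of sign of the last column is the involution. The inequality \<open>n > d\<close>,
  that is \<open>dim K \<ge> d + 2\<close>, provides an entry of the last column below the diagonal,
  so that the involution acts nontrivially on this wall.

  Global rigidity is used twice: infinitesimally, to make the zero at \<open>\<rho>\<close>
  nondegenerate and to count dimensions, and in full, to exclude all further zeros up to
  signs.\<close>

section \<open>Invariant maps of spheres have even degree\<close>

text \<open>
  The fundamental class of the sphere is the sum of classes \<open>u\<close> and \<open>v\<close> of the two hemispheres
  relative to the equator. Since \<open>r\<close> interchanges the hemispheres and \<open>f\<close> is \<open>r\<close>-invariant, \<open>v\<close> may be
  replaced by its image under \<open>r\<close>, which is \<open>u\<close> or its inverse. So \<open>f\<close> maps the fundamental class to
  an even multiple.
\<close>

lemma Brouwer_degree2_even_if_invariant: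
  fixes r :: "(nat \<Rightarrow> real) \<Rightarrow> nat \<Rightarrow> real"
  assumes cmf: "continuous_map (nsphere (Suc q)) (nsphere (Suc q)) f"
    and cmr: "continuous_map (nsphere (Suc q)) (nsphere (Suc q)) r"
    and rr: "\<And>x. r (r x) = x"
    and rq: "\<And>x. r x (Suc q) = - x (Suc q)"
    and fr: "\<And>x. x \<in> topspace (nsphere (Suc q)) \<Longrightarrow> f (r x) = f x"
    and contr: "contractible_space (subtopology (nsphere (Suc q)) C)"
    and C: "topspace (nsphere (Suc q)) \<inter> C \<noteq> {}"
    and fC: "\<And>x. x (Suc q) = 0 \<Longrightarrow> f x \<in> C"
  shows "even (Brouwer_degree2 (Suc q) f)"
proof -
  define n where "n = Suc q"
  define X where "X = nsphere n"
  define U where "U = {x::nat\<Rightarrow>real. x n \<ge> 0}"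
  define L where "L = {x::nat\<Rightarrow>real. x n \<le> 0}"
  define E where "E = {x::nat\<Rightarrow>real. x n = 0}"
  define XU where "XU = subtopology X U"
  define XL where "XL = subtopology X L"
  have EX: "subtopology X E = nsphere q"
    by (simp add: X_def E_def n_def subtopology_nsphere_equator)
  have EU: "subtopology XU E = nsphere q" and EL: "subtopology XL E = nsphere q"
  proof -
    have "U \<inter> E = E" "L \<inter> E = E" by (auto simp: U_def L_def E_def)
    then show "subtopology XU E = nsphere q" "subtopology XL E = nsphere q"
      using EX by (simp_all add: XU_def XL_def subtopology_subtopology)
  qed
  note sets = U_def L_def E_def
  have incU: "continuous_map XU X id" and incL: "continuous_map XL X id"
    by (auto simp: XU_def XL_def)
  have cmrX: "continuous_map X X r" using cmr by (simp add: X_def n_def)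
  have rUL: "continuous_map XU XL r"
    unfolding XU_def XL_def
    by (rule continuous_map_into_subtopology)
       (auto intro: continuous_map_from_subtopology cmrX simp: U_def L_def rq n_def)
  have rE: "r \<in> E \<rightarrow> E" by (auto simp: E_def n_def rq)
  have cmfX: "continuous_map X X f" using cmf by (simp add: X_def n_def)
  let ?HU = "relative_homology_group n XU E"
  let ?HL = "relative_homology_group n XL E"
  let ?HE = "relative_homology_group n X E"
  let ?HC = "relative_homology_group n X C"
  let ?R = "reduced_homology_group (int q) (nsphere q)"
  let ?H = "reduced_homology_group n X"
  let ?iL = "hom_induced n XL E X E id"
  let ?iU = "hom_induced n XU E X E id"
  let ?f = "hom_induced n X (topspace X \<inter> E) X C f"
  let ?j = "hom_induced n X {} X C id"
  interpret HE: comm_group ?HE by simp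
  \<comment> \<open>By excision each hemisphere modulo the equator computes the sphere modulo the
    other hemisphere; hence the homology of the sphere modulo the equator is the direct sum of the
    contributions of the hemispheres.\<close>
  have *: "(\<lambda>(x, y). ?iL x \<otimes>\<^bsub>?HE\<^esub> ?iU y) \<in> Group.iso (?HL \<times>\<times> ?HU) ?HE"
  proof (rule conjunct1 [OF exact_sequence_sum_lemma [OF abelian_relative_homology_group]])
    show "hom_induced n XL E X U id \<in> Group.iso ?HL (relative_homology_group n X U)"
      unfolding XL_def X_def sets by (rule iso_relative_homology_group_lower_hemisphere)
    show "hom_induced n XU E X L id \<in> Group.iso ?HU (relative_homology_group n X L)"
      unfolding XU_def X_def sets by (rule iso_relative_homology_group_upper_hemisphere)
    show "exact_seq ([relative_homology_group n X L, ?HE, ?HL], [hom_induced n X E X L id, ?iL])"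
      unfolding XL_def by (rule homology_exactness_triple_3) (auto simp: sets)
    show "exact_seq ([relative_homology_group n X U, ?HE, ?HU], [hom_induced n X E X U id, ?iU])"
      unfolding XU_def by (rule homology_exactness_triple_3) (auto simp: sets)
  next
    fix x
    show "hom_induced n X E X U id (?iL x) = hom_induced n XL E X U id x"
      by (subst hom_induced_compose') (use incL in \<open>auto simp: sets\<close>)
    show "hom_induced n X E X L id (?iU x) = hom_induced n XU E X L id x"
      by (subst hom_induced_compose') (use incU in \<open>auto simp: sets\<close>)
  qed
  obtain z where z: "z \<in> carrier ?H" and zgen: "subgroup_generated ?H {z} = ?H"
    using cyclic_reduced_homology_group_nsphere [of n n] by (auto simp: cyclic_group_def X_def)
  have redH: "?H = homology_group n X" by (simp add: un_reduced_homology_group n_def)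
  let ?h1 = "hom_induced n X {} X E id"
  have "?h1 z \<in> carrier ?HE" by (simp add: hom_induced_carrier)
  then obtain u v where u: "u \<in> carrier ?HL" and v: "v \<in> carrier ?HU"
    and h1z: "?h1 z = ?iL u \<otimes>\<^bsub>?HE\<^esub> ?iU v"
  proof -
    have "?h1 z \<in> (\<lambda>(x, y). ?iL x \<otimes>\<^bsub>?HE\<^esub> ?iU y) ` carrier (?HL \<times>\<times> ?HU)"
      using * \<open>?h1 z \<in> carrier ?HE\<close> by (simp only: iso_iff)
    then show ?thesis using that by auto
  qed
  interpret BE: group_hom ?HE ?R "hom_boundary n X E"
    using hom_boundary_reduced_hom[of n X E] EX
    by (simp add: group_hom_axioms_def group_hom_def n_def)
  interpret F: group_hom ?HE ?HC "hom_induced n X E X C f"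
    by (simp add: group_hom_axioms_def group_hom_def hom_induced_hom)
  let ?bL = "hom_boundary n XL E" and ?bU = "hom_boundary n XU E"
  have bL: "?bL \<in> Group.iso ?HL ?R"
    using iso_lower_hemisphere_reduced_homology_group[of "int q" q]
    by (simp add: XL_def X_def L_def E_def n_def)
  interpret BL: group_hom ?HL ?R ?bL
    using bL by (simp add: group_hom_axioms_def group_hom_def iso_iff)
  interpret R: comm_group ?R
    by (rule group.cyclic_imp_abelian_group) (simp_all add: cyclic_reduced_homology_group_nsphere)
  have fE: "f \<in> E \<rightarrow> C" using fC by (auto simp: E_def n_def)
  have bX: "hom_boundary n X E (?iL x) = ?bL x" for x
  proof -
    have "hom_boundary n X E (?iL x) = hom_induced (int n - 1) (nsphere q) {} (nsphere q) {} id (?bL x)"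
      using naturality_hom_induced[OF incL, of E E n] by (simp add: EX EL fun_eq_iff)
    then show ?thesis
      by (metis EL hom_boundary_carrier hom_induced_id)
  qed
  have bX': "hom_boundary n X E (?iU x) = ?bU x" for x
  proof -
    have "hom_boundary n X E (?iU x) = hom_induced (int n - 1) (nsphere q) {} (nsphere q) {} id (?bU x)"
      using naturality_hom_induced[OF incU, of E E n] by (simp add: EX EU fun_eq_iff)
    then show ?thesis
      by (metis EU hom_boundary_carrier hom_induced_id)
  qed
  have cU: "?bU x \<in> carrier ?R" if "x \<in> carrier ?HU" for x
    using hom_boundary_reduced_hom[of n XU E] that by (simp add: EU n_def hom_in_carrier)
  have "hom_boundary n X E (?h1 z) = \<one>\<^bsub>?R\<^esub>"
  proof -
    have "topspace X \<inter> E \<noteq> {}"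
      using EX nonempty_nsphere[of q] by (metis discrete_topology_unique subtopology_eq_discrete_topology_empty topspace_subtopology)
    then have "exact_seq([reduced_homology_group (int n - 1) (subtopology X E), ?HE, ?H],
                    [hom_boundary n X E, ?h1])"
      by (rule homology_exactness_reduced_1)
    then have "?h1 ` carrier ?H = kernel ?HE (reduced_homology_group (int n - 1) (subtopology X E)) (hom_boundary n X E)"
      by simp
    then have "?h1 z \<in> kernel ?HE (reduced_homology_group (int n - 1) (subtopology X E)) (hom_boundary n X E)"
      using z by blast
    then show ?thesis by (simp add: kernel_def EX n_def)
  qed
  then have bz: "?bL u \<otimes>\<^bsub>?R\<^esub> ?bU v = \<one>\<^bsub>?R\<^esub>"
    using h1z bX bX' by (simp add: hom_induced_carrier)
  let ?r = "hom_induced n XU E XL E r"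
  have cv: "?r v \<in> carrier ?HL" by (simp add: hom_induced_carrier)
  define e where "e = Brouwer_degree2 q r"
  have br: "?bL (?r v) = ?bU v [^]\<^bsub>?R\<^esub> e"
  proof -
    have "?bL (?r v) = hom_induced q (nsphere q) {} (nsphere q) {} r (?bU v)"
      using naturality_hom_induced[OF rUL rE, of n] by (simp add: EL EU fun_eq_iff n_def)
    then show ?thesis using Brouwer_degree2[OF cU[OF v], of r] by (simp add: e_def)
  qed
  have e: "e = 1 \<or> e = -1"
  proof -
    have "continuous_map (nsphere q) (nsphere q) r"
      unfolding EX[symmetric]
      by (rule continuous_map_into_subtopology)
         (use rE in \<open>auto intro: continuous_map_from_subtopology cmrX\<close>)
    then have "homeomorphic_maps (nsphere q) (nsphere q) r r"
      by (simp add: homeomorphic_maps_def rr)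
    then show ?thesis
      using Brouwer_degree2_homeomorphic_map homeomorphic_map_maps by (fastforce simp: e_def)
  qed
  \<comment> \<open>The boundary map of the lower hemisphere is injective, so boundaries are
    compared: \<open>r\<close> acts on the equator with degree \<open>e\<close>, and by
    \<open>bz\<close> the boundaries of \<open>u\<close> and \<open>v\<close> cancel.\<close>
  have "?r v = u [^]\<^bsub>?HL\<^esub> (- e)"
  proof (rule inj_onD)
    show "inj_on ?bL (carrier ?HL)" using bL by (simp add: iso_iff)
    have cLu: "?bL u \<in> carrier ?R" and cUv: "?bU v \<in> carrier ?R"
      using u v cU BL.hom_closed by blast+
    have "?bU v \<otimes>\<^bsub>?R\<^esub> ?bL u = \<one>\<^bsub>?R\<^esub>"
      using bz R.m_comm[OF cLu cUv] by simp
    then have "?bU v = inv\<^bsub>?R\<^esub> (?bL u)"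
      using BE.H.inv_equality[OF _ cLu cUv] by simp
    then have "?bL (?r v) = ?bL u [^]\<^bsub>?R\<^esub> (- e)"
      using BE.H.int_pow_inv[OF cLu] BE.H.int_pow_neg[OF cLu] br by simp
    then show "?bL (?r v) = ?bL (u [^]\<^bsub>?HL\<^esub> (- e))"
      using BL.hom_int_pow[OF u] by simp
  qed (use u cv in \<open>auto simp: group.int_pow_closed\<close>)
  then have ur: "u \<otimes>\<^bsub>?HL\<^esub> ?r v = u [^]\<^bsub>?HL\<^esub> (1 - e)"
    using u group.int_pow_mult[OF group_relative_homology_group u, of 1 "-e"]
    by (simp add: group.int_pow_1)
  obtain k :: int where k: "1 - e = k * 2" using e by force
  have fUL: "hom_induced n X E X C f (?iU v) = hom_induced n X E X C f (?iL (?r v))"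
  proof -
    have "hom_induced n X E X C f (?iU v) = hom_induced n XU E X C f v"
      by (subst hom_induced_compose') (use incU fE cmfX in auto)
    also have "\<dots> = hom_induced n XU E X C (f \<circ> r) v"
      by (rule fun_cong[OF hom_induced_eq]) (auto simp: fr XU_def X_def n_def)
    also have "\<dots> = hom_induced n X E X C f (hom_induced n XU E X E r v)"
      by (subst hom_induced_compose')
         (use fE rE cmfX cmrX in \<open>auto simp: XU_def intro: continuous_map_from_subtopology\<close>)
    also have "hom_induced n XU E X E r v = ?iL (?r v)"
      by (subst hom_induced_compose') (use incL rUL rE in auto)
    finally show ?thesis .
  qed
  let ?fz = "hom_induced n X {} X {} f z"
  define a where "a = hom_induced n X E X C f (?iL u)"
  interpret IL: group_hom ?HL ?HE ?iL
    by (simp add: group_hom_axioms_def group_hom_def hom_induced_hom)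
  have aC: "a \<in> carrier ?HC" by (simp add: a_def hom_induced_carrier)
  have "?j ?fz = hom_induced n X {} X C f z"
    by (subst hom_induced_compose') (use cmfX in auto)
  also have "\<dots> = hom_induced n X E X C f (?h1 z)"
    by (subst hom_induced_compose') (use fE cmfX in auto)
  also have "\<dots> = hom_induced n X E X C f (?iL (u \<otimes>\<^bsub>?HL\<^esub> ?r v))"
    using u cv by (simp add: h1z fUL hom_induced_carrier)
  also have "\<dots> = a [^]\<^bsub>?HC\<^esub> (k * 2)"
    using u by (simp add: ur k a_def IL.hom_int_pow F.hom_int_pow hom_induced_carrier)
  finally have jfz: "?j ?fz = a [^]\<^bsub>?HC\<^esub> (k * 2)" .
  \<comment> \<open>The equator is mapped into \<open>C\<close>, so the computation was made
    relative to \<open>C\<close>. As the part of the sphere in \<open>C\<close> is contractible,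
    evenness can be pulled back to the absolute group.\<close>
  have j: "?j \<in> Group.iso ?H ?HC"
    using iso_reduced_homology_by_contractible contr C by (simp add: X_def n_def)
  interpret J: group_hom ?H ?HC ?j
    using j by (simp add: group_hom_axioms_def group_hom_def iso_iff)
  obtain y where y: "y \<in> carrier ?H" "a = ?j y"
  proof -
    have "?j ` carrier ?H = carrier ?HC" using j by (simp only: iso_iff)
    then show ?thesis using aC that by blast
  qed
  obtain l :: int where l: "y = z [^]\<^bsub>?H\<^esub> l"
  proof -
    have "carrier ?H = range (\<lambda>l::int. z [^]\<^bsub>?H\<^esub> l)"
      using group.carrier_subgroup_generated_by_singleton[OF group_reduced_homology_group z]
      by (simp only: zgen)
    then show ?thesis using y(1) that by blast
  qed
  have "?fz = z [^]\<^bsub>?H\<^esub> (l * k * 2)"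
  proof (rule inj_onD)
    show "inj_on ?j (carrier ?H)" using j by (simp add: iso_iff)
    show "?j ?fz = ?j (z [^]\<^bsub>?H\<^esub> (l * k * 2))"
      using z by (simp add: jfz y l J.hom_int_pow group.int_pow_pow mult.assoc hom_induced_carrier)
  qed (use z hom_induced_reduced in \<open>auto simp: group.int_pow_closed\<close>)
  then have "Brouwer_degree2 n f = l * k * 2"
    using Brouwer_degree2_unique_generator[of n f z "l * k * 2"] cmfX zgen by (simp add: X_def)
  then show ?thesis by (simp add: n_def)
qed

section \<open>Radial projection and maps of spheres\<close>

definition sphere_proj :: "nat \<Rightarrow> (nat \<Rightarrow> real) \<Rightarrow> nat \<Rightarrow> real" where
  "sphere_proj p x = (\<lambda>i. if i \<le> p then x i / sqrt (\<Sum>j\<le>p. (x j)\<^sup>2) else 0)"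

lemma topspace_nsphere: "topspace (nsphere p) = {x. (\<Sum>i\<le>p. (x i)\<^sup>2) = 1 \<and> (\<forall>i>p. x i = 0)}"
  by (auto simp: nsphere)

lemma sum_sq_pos: 
  fixes x :: "nat \<Rightarrow> real"
  assumes "\<exists>i\<le>p. x i \<noteq> 0" shows "(\<Sum>j\<le>p. (x j)\<^sup>2) > 0"
proof -
  obtain i where "i \<le> p" "x i \<noteq> 0" using assms by blast
  then show ?thesis
    by (intro sum_pos2[of _ i]) auto
qed

lemma sphere_proj_in_nsphere:
  assumes "\<exists>i\<le>p. x i \<noteq> 0" shows "sphere_proj p x \<in> topspace (nsphere p)"
proof -
  have "(\<Sum>i\<le>p. (sphere_proj p x i)\<^sup>2) = (\<Sum>i\<le>p. (x i)\<^sup>2 / (\<Sum>j\<le>p. (x j)\<^sup>2))"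
    by (simp add: sphere_proj_def power_divide sum_nonneg)
  also have "\<dots> = (\<Sum>i\<le>p. (x i)\<^sup>2) / (\<Sum>j\<le>p. (x j)\<^sup>2)"
    by (rule sum_divide_distrib[symmetric])
  finally have "(\<Sum>i\<le>p. (sphere_proj p x i)\<^sup>2) = (\<Sum>i\<le>p. (x i)\<^sup>2) / (\<Sum>j\<le>p. (x j)\<^sup>2)" .
  with sum_sq_pos[OF assms] show ?thesis by (simp add: topspace_nsphere) (simp add: sphere_proj_def)
qed

lemma sphere_proj_id: "x \<in> topspace (nsphere p) \<Longrightarrow> sphere_proj p x = x"
  by (auto simp: sphere_proj_def topspace_nsphere fun_eq_iff)

lemma continuous_map_sphere_proj:
  assumes "\<And>i. i \<le> p \<Longrightarrow> continuous_map Y euclideanreal (\<lambda>y. F y i)"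
    and "\<And>y. y \<in> topspace Y \<Longrightarrow> \<exists>i\<le>p. F y i \<noteq> 0"
  shows "continuous_map Y (nsphere p) (\<lambda>y. sphere_proj p (F y))"
proof -
  have "continuous_map Y euclideanreal (\<lambda>y. sphere_proj p (F y) i)" for i
  proof (cases "i \<le> p")
    case True
    have "sqrt (\<Sum>j\<le>p. (F y j)\<^sup>2) \<noteq> 0" if "y \<in> topspace Y" for y
      using sum_sq_pos[of p "F y"] assms(2)[OF that] by simp
    moreover have "continuous_map Y euclideanreal (\<lambda>y. sqrt (\<Sum>j\<le>p. (F y j)\<^sup>2))"
      by (rule continuous_map_compose[of _ euclideanreal _ _ sqrt, unfolded o_def])
         (auto intro!: continuous_intros assms)
    ultimately show ?thesis
      using True unfolding sphere_proj_def by (auto intro!: continuous_map_real_divide assms)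
  qed (simp add: sphere_proj_def)
  moreover have "sphere_proj p (F y) \<in> topspace (nsphere p)" if "y \<in> topspace Y" for y
    using assms(2)[OF that] by (rule sphere_proj_in_nsphere)
  ultimately show ?thesis
    unfolding nsphere topspace_nsphere
    by (intro continuous_map_into_subtopology) (auto simp: continuous_map_componentwise_UNIV)
qed

lemma nsphere_top_of_set: "nsphere p = top_of_set (topspace (nsphere p))"
  unfolding topspace_nsphere nsphere by (simp add: euclidean_product_topology)

lemma nsphere_homotopic_sphere_proj:
  assumes "\<And>i. i \<le> p \<Longrightarrow> continuous_on ({0..1} \<times> topspace (nsphere p)) (\<lambda>(t,x). H t x i)"
    and "\<And>t x. t \<in> {0..1} \<Longrightarrow> x \<in> topspace (nsphere p) \<Longrightarrow> \<exists>i\<le>p. H t x i \<noteq> (0::real)"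
  shows "homotopic_with (\<lambda>_. True) (nsphere p) (nsphere p) (\<lambda>x. sphere_proj p (H (0::real) x)) (\<lambda>x. sphere_proj p (H 1 x))"
proof -
  let ?Y = "prod_topology (top_of_set {0..1::real}) (nsphere p)"
  have Y: "?Y = top_of_set ({0..1} \<times> topspace (nsphere p))"
    by (subst nsphere_top_of_set) (simp add: prod_topology_subtopology_eu)
  have "continuous_map ?Y (nsphere p) (\<lambda>y. sphere_proj p (H (fst y) (snd y)))"
    by (rule continuous_map_sphere_proj)
       (use assms in \<open>auto simp: Y case_prod_unfold\<close>)
  then show ?thesis
    unfolding homotopic_with_def by (intro exI[of _ "\<lambda>y. sphere_proj p (H (fst y) (snd y))"]) auto
qed

text \<open>The segment from \<open>x\<close> to the antipode \<open>- c\<close> misses the closed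
  ray through \<open>c\<close> unless \<open>x = c\<close>, so its radial projection contracts the
  punctured sphere to \<open>- c\<close>. Comparing norms settles both the zero vector and the
  ray.\<close>

lemma contractible_punctured_nsphere:
  assumes c: "c \<in> topspace (nsphere p)"
  shows "contractible_space (subtopology (nsphere p) (- {c}))"
proof -
  let ?X = "subtopology (nsphere p) (- {c})"
  define h where "h = (\<lambda>y::real \<times> (nat \<Rightarrow> real). \<lambda>i. (1 - fst y) * snd y i - fst y * c i)"
  let ?Y = "prod_topology (top_of_set {0..1::real}) ?X"
  have sum1: "(\<Sum>i\<le>p. (x i)\<^sup>2) = 1" if "x \<in> topspace (nsphere p)" for x
    using that by (simp add: topspace_nsphere)
  have nz: "\<exists>i\<le>p. h y i \<noteq> 0" if y: "y \<in> topspace ?Y" for y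
  proof (rule ccontr)
    assume *: "\<not> ?thesis"
    obtain t x where yy: "y = (t, x)" by fastforce
    have t: "0 \<le> t" "t \<le> 1" and x: "x \<in> topspace (nsphere p)" "x \<noteq> c" using y yy by auto
    have eq: "(1 - t) * x i = t * c i" if "i \<le> p" for i
      using * that by (auto simp: h_def yy)
    have "(\<Sum>i\<le>p. ((1 - t) * x i)\<^sup>2) = (\<Sum>i\<le>p. (t * c i)\<^sup>2)"
      by (rule sum.cong) (auto simp: eq)
    then have "(1 - t)\<^sup>2 = t\<^sup>2"
      by (simp add: power_mult_distrib sum_distrib_left[symmetric] sum1 x c)
    then have t12: "t = 1/2" by (simp add: power2_eq_square algebra_simps)
    have "x i = c i" for i
    proof (cases "i \<le> p")
      case True then show ?thesis using eq[OF True] t12 by simp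
    next
      case False then show ?thesis using x c by (simp add: topspace_nsphere)
    qed
    then show False using x by auto
  qed
  have "sphere_proj p (h y) \<noteq> c" if y: "y \<in> topspace ?Y" for y
  proof
    assume *: "sphere_proj p (h y) = c"
    obtain t x where yy: "y = (t, x)" by fastforce
    have t: "0 \<le> t" "t \<le> 1" and x: "x \<in> topspace (nsphere p)" "x \<noteq> c" using y yy by auto
    define s where "s = sqrt (\<Sum>j\<le>p. (h y j)\<^sup>2)"
    have s: "s > 0" unfolding s_def using sum_sq_pos[OF nz[OF y]] by simp
    have eq: "(1 - t) * x i = (t + s) * c i" if "i \<le> p" for i
    proof -
      have "h y i / s = c i" using fun_cong[OF *, of i] that by (simp add: sphere_proj_def s_def)
      then have "h y i = s * c i" using s by (simp add: field_simps)
      then show ?thesis by (simp add: h_def yy algebra_simps)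
    qed
    have "(\<Sum>i\<le>p. ((1 - t) * x i)\<^sup>2) = (\<Sum>i\<le>p. ((t + s) * c i)\<^sup>2)"
      by (rule sum.cong) (auto simp: eq)
    then have "(1 - t)\<^sup>2 = (t + s)\<^sup>2"
      by (simp add: power_mult_distrib sum_distrib_left[symmetric] sum1 x c)
    then have ts: "1 - t = t + s" using t s by (simp add: power2_eq_iff)
    have "x i = c i" for i
    proof (cases "i \<le> p")
      case True then show ?thesis using eq[OF True] ts t s by simp
    next
      case False then show ?thesis using x c by (simp add: topspace_nsphere)
    qed
    then show False using x by auto
  qed
  moreover have "continuous_map ?Y (nsphere p) (\<lambda>y. sphere_proj p (h y))"
  proof (rule continuous_map_sphere_proj[OF _ nz])
    fix i assume "i \<le> p"
    have "continuous_map ?Y euclideanreal (\<lambda>y. snd y i)"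
      by (rule continuous_map_compose[of _ ?X snd _ "\<lambda>x. x i", unfolded o_def])
         (auto intro: continuous_map_from_subtopology continuous_map_nsphere_projection continuous_map_snd)
    moreover have "continuous_map ?Y euclideanreal fst"
      by (metis continuous_map_fst continuous_map_into_fulltopology)
    ultimately show "continuous_map ?Y euclideanreal (\<lambda>y. h y i)"
      unfolding h_def by (intro continuous_intros) auto
  qed
  ultimately have cont: "continuous_map ?Y ?X (\<lambda>y. sphere_proj p (h y))"
    by (intro continuous_map_into_subtopology) auto
  have "homotopic_with (\<lambda>_. True) ?X ?X id (\<lambda>x. sphere_proj p (\<lambda>i. - c i))"
    unfolding homotopic_with_def
  proof (intro exI conjI allI ballI)
    \<comment> \<open>A homotopy must agree with its end maps at all sequences, also off the sphere,
      where \<open>sphere_proj\<close> is not the identity; hence the case distinction at time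
      0.\<close>
    show "continuous_map ?Y ?X (\<lambda>y. if fst y = 0 then snd y else sphere_proj p (h y))"
      by (rule continuous_map_eq[OF cont]) (auto simp: h_def sphere_proj_id)
  qed (auto simp: h_def)
  then show ?thesis unfolding contractible_space_def by blast
qed

text \<open>The degree is 1 by the homotopy and even by the invariance under the sign change in
  \<open>J\<close>, which swaps the hemispheres because \<open>p \<in> J\<close>. Avoiding the ray
  through \<open>- c\<close> keeps the image of the equator in a punctured sphere, which is
  contractible.\<close>

theorem nsphere_even_map_not_homotopic_id:
  assumes J: "p \<in> J" and p: "p \<ge> 1"
    and hom: "homotopic_with (\<lambda>_. True) (nsphere p) (nsphere p) id (\<lambda>x. sphere_proj p (F x))"
    and even: "\<And>x i. x \<in> topspace (nsphere p) \<Longrightarrow> i \<le> p \<Longrightarrow> F (\<lambda>i. if i \<in> J then - x i else x i) i = F x i"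
    and c: "\<exists>i\<le>p. c i \<noteq> 0"
    and Fc: "\<And>x \<mu>. x \<in> topspace (nsphere p) \<Longrightarrow> x p = 0 \<Longrightarrow> \<mu> \<ge> 0 \<Longrightarrow> \<exists>i\<le>p. F x i \<noteq> - \<mu> * c i"
  shows False
proof -
  obtain q where q: "p = Suc q" using p by (cases p) auto
  define r where "r = (\<lambda>(x::nat\<Rightarrow>real) i. if i \<in> J then - x i else x i)"
  define c' where "c' = sphere_proj p (\<lambda>i. - c i)"
  \<comment> \<open>The evenness lemma constrains \<open>f\<close> on the whole hyperplane of the
    equator, not only on the sphere. Off the sphere the value zero is safe because it differs from
    the unit vector \<open>c'\<close>.\<close>
  define f where "f = (\<lambda>x. if x \<in> topspace (nsphere p) then sphere_proj p (F x) else (\<lambda>i. 0))"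
  have c': "c' \<in> topspace (nsphere p)" unfolding c'_def using c by (intro sphere_proj_in_nsphere) auto
  have cont: "continuous_map (nsphere p) (nsphere p) (\<lambda>x. sphere_proj p (F x))"
    using hom by (rule homotopic_with_imp_continuous_maps[THEN conjunct2])
  have rS: "r x \<in> topspace (nsphere p)" if "x \<in> topspace (nsphere p)" for x
  proof -
    have "(r x i)\<^sup>2 = (x i)\<^sup>2" for i by (simp add: r_def)
    then show ?thesis using that by (auto simp: topspace_nsphere) (simp add: r_def)
  qed
  have "even (Brouwer_degree2 (Suc q) f)"
  proof (rule Brouwer_degree2_even_if_invariant[where r = r and C = "- {c'}"])
    show "continuous_map (nsphere (Suc q)) (nsphere (Suc q)) f"
      unfolding q[symmetric] by (rule continuous_map_eq[OF cont]) (simp add: f_def)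
    have "continuous_map (nsphere p) euclideanreal (\<lambda>x. r x i)" for i
      by (cases "i \<in> J") (auto simp: r_def intro!: continuous_intros continuous_map_nsphere_projection)
    then have "continuous_map (nsphere p) (powertop_real UNIV) r"
      by (simp add: continuous_map_componentwise_UNIV)
    then show "continuous_map (nsphere (Suc q)) (nsphere (Suc q)) r"
      unfolding q[symmetric] using rS
      by (subst (2) nsphere) (auto intro!: continuous_map_into_subtopology simp: topspace_nsphere)
    show "r (r x) = x" for x by (auto simp: r_def)
    show "r x (Suc q) = - x (Suc q)" for x using J q by (simp add: r_def)
    show "f (r x) = f x" if "x \<in> topspace (nsphere (Suc q))" for x
    proof -
      have "sphere_proj p (F (r x)) = sphere_proj p (F x)"
      proof -
        have e: "F (r x) i = F x i" if "i \<le> p" for i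
          using even[of x i] that \<open>x \<in> _\<close> q by (simp add: r_def)
        then have "(\<Sum>j\<le>p. (F (r x) j)\<^sup>2) = (\<Sum>j\<le>p. (F x j)\<^sup>2)"
          by (intro sum.cong) auto
        then show ?thesis using e by (simp add: sphere_proj_def fun_eq_iff)
      qed
      then show ?thesis using that rS[of x] q by (simp add: f_def)
    qed
    show "contractible_space (subtopology (nsphere (Suc q)) (- {c'}))"
      using contractible_punctured_nsphere[OF c'] q by simp
    show "topspace (nsphere (Suc q)) \<inter> - {c'} \<noteq> {}"
    proof -
      have "(\<lambda>i. - c' i) \<in> topspace (nsphere p)" using c' by (simp add: topspace_nsphere)
      moreover have "(\<lambda>i. - c' i) \<noteq> c'"
      proof
        assume "(\<lambda>i. - c' i) = c'"
        then have "c' i = 0" for i by (metis neg_equal_zero)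
        then show False using c' by (simp add: topspace_nsphere)
      qed
      ultimately show ?thesis using q by auto
    qed
    show "f x \<in> - {c'}" if x0: "x (Suc q) = 0" for x
    proof (cases "x \<in> topspace (nsphere p)")
      case False
      have "(\<lambda>i. 0) \<noteq> c'" using c' by (auto simp: topspace_nsphere)
      then show ?thesis using False by (simp add: f_def)
    next
      case True
      have "sphere_proj p (F x) \<noteq> c'"
      proof
        assume eq: "sphere_proj p (F x) = c'"
        define a where "a = sqrt (\<Sum>j\<le>p. (F x j)\<^sup>2)"
        define b where "b = sqrt (\<Sum>j\<le>p. (c j)\<^sup>2)"
        have "b > 0" unfolding b_def using sum_sq_pos[OF c] by simp
        have "a > 0"
          unfolding a_def using sum_sq_pos[of p "F x"] Fc[OF True, of 0] x0 q by simp
        have "F x i = - (a / b) * c i" if "i \<le> p" for i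
          using fun_cong[OF eq, of i] that \<open>a > 0\<close> \<open>b > 0\<close>
          by (simp add: sphere_proj_def c'_def a_def[symmetric] b_def[symmetric] field_simps)
        then show False using Fc[OF True, of "a / b"] x0 q \<open>a > 0\<close> \<open>b > 0\<close> by auto
      qed
      then show ?thesis using True by (simp add: f_def)
    qed
  qed
  moreover have "Brouwer_degree2 p f = Brouwer_degree2 p (\<lambda>x. sphere_proj p (F x))"
    by (rule Brouwer_degree2_eq) (simp add: f_def)
  moreover have "Brouwer_degree2 p (\<lambda>x. sphere_proj p (F x)) = 1"
    using Brouwer_degree2_homotopic[OF hom] by simp
  ultimately show False using q by simp
qed

section \<open>Lengths of trapezoidal matrices\<close>

text \<open>Independence in coefficient form includes injectivity of the family, as the difference
  of two indicator functions shows. Hence the range is an independent set, and linear extension from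
  it gives the functionals.\<close>

lemma dual_family_exists:
  fixes x :: "'k \<Rightarrow> 'a::real_vector"
  assumes fin: "finite K"
    and ind0: "\<And>c k. (\<Sum>k\<in>K. c k *\<^sub>R x k) = 0 \<Longrightarrow> k \<in> K \<Longrightarrow> c k = 0"
  obtains g :: "'k \<Rightarrow> 'a \<Rightarrow> real" where "\<And>k. k \<in> K \<Longrightarrow> linear (g k)"
    "\<And>k k'. k \<in> K \<Longrightarrow> k' \<in> K \<Longrightarrow> g k (x k') = (if k' = k then 1 else 0)"
proof -
  have inj: "inj_on x K"
  proof (rule inj_onI, rule ccontr)
    fix k k' assume k: "k \<in> K" "k' \<in> K" "x k = x k'" "k \<noteq> k'"
    have "(\<Sum>l\<in>K. ((if l = k then 1 else 0) - (if l = k' then 1 else 0)) *\<^sub>R x l) = 0"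
      using k fin by (simp add: scaleR_diff_left sum_subtractf if_distrib[of "\<lambda>x. x *\<^sub>R _"] cong: if_cong)
    from ind0[OF this k(1)] k(4) show False by simp
  qed
  have ind: "independent (x ` K)"
  proof (rule independent_if_scalars_zero)
    fix g y assume *: "(\<Sum>y\<in>x ` K. g y *\<^sub>R y) = 0" and y: "y \<in> x ` K"
    have "(\<Sum>k\<in>K. g (x k) *\<^sub>R x k) = 0"
      using * by (simp add: sum.reindex[OF inj])
    then show "g y = 0" using ind0[of "\<lambda>k. g (x k)"] y by auto
  qed (simp add: fin)
  have "\<exists>g::'a \<Rightarrow> real. linear g \<and> (\<forall>k'\<in>K. g (x k') = (if k' = k then 1 else 0))" if "k \<in> K" for k
  proof -
    obtain g :: "'a \<Rightarrow> real" where "linear g" "\<forall>y\<in>x ` K. g y = (if y = x k then 1 else 0)"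
      using linear_independent_extend[OF ind, of "\<lambda>y. if y = x k then 1 else 0"] by blast
    then show ?thesis using inj that by (intro exI[of _ g]) (auto simp: inj_on_eq_iff)
  qed
  then show ?thesis using that by metis
qed

text \<open>
  Up to an orthogonal transformation, a framework whose coordinates lie in the span of
  \<open>w 0, \<dots>, w (n - 1)\<close> is given by a lower trapezoidal \<open>n \<times> d\<close> matrix \<open>V\<close>, whose columns are the
  coefficients of the coordinates and whose free entries are indexed by \<open>I\<close>. Then \<open>f V\<close> is its vector of
  squared lengths, and \<open>Idm\<close> is the framework with coordinates \<open>w 0, \<dots>, w (d - 1)\<close>. The last two
  assumptions say that the derivative of \<open>f\<close> at \<open>Idm\<close> is injective and that its image contains
  all values of \<open>f\<close>.
\<close>

locale trapezoid =
  fixes lam :: "'w::euclidean_space \<Rightarrow> 'w \<Rightarrow> 'y::euclidean_space"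
    and w :: "nat \<Rightarrow> 'w" and n d :: nat and \<phi> :: "'y \<Rightarrow> real"
  assumes d: "1 \<le> d" "d < n"
    and bil: "bilinear lam"
    and sym: "lam x y = lam y x"
    and indep_w: "(\<Sum>i<n. a i *\<^sub>R w i) = 0 \<Longrightarrow> i < n \<Longrightarrow> a i = 0"
    and lin_\<phi>: "linear \<phi>"
    and pos: "x \<in> span (w ` {..<n}) \<Longrightarrow> x \<noteq> 0 \<Longrightarrow> \<phi> (lam x x) > 0"
    and indep_L: "(\<Sum>(i, j) \<in> {(i, j). j < d \<and> j \<le> i \<and> i < n}. c (i, j) *\<^sub>R lam (w i) (w j)) = 0
        \<Longrightarrow> j < d \<Longrightarrow> j \<le> i \<Longrightarrow> i < n \<Longrightarrow> c (i, j) = (0::real)"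
    and span_L: "i < n \<Longrightarrow> i' < n \<Longrightarrow>
        lam (w i) (w i') \<in> span ((\<lambda>(i, j). lam (w i) (w j)) ` {(i, j). j < d \<and> j \<le> i \<and> i < n})"
begin

definition I :: "(nat \<times> nat) set" where "I = {(i, j). j < d \<and> j \<le> i \<and> i < n}"
definition L :: "nat \<times> nat \<Rightarrow> 'y" where "L = (\<lambda>(i, j). lam (w i) (w j))"
definition B :: "'y set" where "B = span (L ` I)"
definition supp :: "(nat \<Rightarrow> nat \<Rightarrow> real) \<Rightarrow> bool" where
  "supp V \<longleftrightarrow> (\<forall>i j. (i, j) \<notin> I \<longrightarrow> V i j = 0)"
definition col :: "(nat \<Rightarrow> nat \<Rightarrow> real) \<Rightarrow> nat \<Rightarrow> 'w" where
  "col V j = (\<Sum>i<n. V i j *\<^sub>R w i)"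
definition f :: "(nat \<Rightarrow> nat \<Rightarrow> real) \<Rightarrow> 'y" where
  "f V = (\<Sum>j<d. lam (col V j) (col V j))"
definition Idm :: "nat \<Rightarrow> nat \<Rightarrow> real" where "Idm i j = (if i = j \<and> i < d then 1 else 0)"
definition b :: 'y where "b = f Idm"

lemma finite_I: "finite I"
  by (rule finite_subset[of _ "{..<n} \<times> {..<d}"]) (auto simp: I_def)

lemma mem_I: "(i, j) \<in> I \<longleftrightarrow> j < d \<and> j \<le> i \<and> i < n"
  by (simp add: I_def)

lemma L_indep: "(\<Sum>k\<in>I. c k *\<^sub>R L k) = 0 \<Longrightarrow> k \<in> I \<Longrightarrow> c k = 0"
  using indep_L[of c "snd k" "fst k"] by (cases k) (simp add: I_def L_def case_prod_unfold)

lemma L_in_B: "k \<in> I \<Longrightarrow> L k \<in> B" by (simp add: B_def span_base)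

lemma lam_in_B: "i < n \<Longrightarrow> i' < n \<Longrightarrow> lam (w i) (w i') \<in> B"
  using span_L[of i i'] by (simp add: B_def I_def L_def)

lemma subspace_B: "subspace B" by (simp add: B_def)

lemma lam_simps:
  "lam (x + y) z = lam x z + lam y z" "lam z (x + y) = lam z x + lam z y"
  "lam (x - y) z = lam x z - lam y z" "lam z (x - y) = lam z x - lam z y"
  "lam (c *\<^sub>R x) z = c *\<^sub>R lam x z" "lam z (c *\<^sub>R x) = c *\<^sub>R lam z x"
  "lam (- x) z = - lam x z" "lam z (- x) = - lam z x"
  "lam (sum g S) z = (\<Sum>i\<in>S. lam (g i) z)" "lam z (sum g S) = (\<Sum>i\<in>S. lam z (g i))"
proof -
  have l: "linear (lam z)" and r: "linear (\<lambda>x. lam x z)" for z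
    using bil by (auto simp: bilinear_def)
  show "lam (x + y) z = lam x z + lam y z" "lam z (x + y) = lam z x + lam z y"
    "lam (x - y) z = lam x z - lam y z" "lam z (x - y) = lam z x - lam z y"
    "lam (c *\<^sub>R x) z = c *\<^sub>R lam x z" "lam z (c *\<^sub>R x) = c *\<^sub>R lam z x"
    "lam (- x) z = - lam x z" "lam z (- x) = - lam z x"
    "lam (sum g S) z = (\<Sum>i\<in>S. lam (g i) z)" "lam z (sum g S) = (\<Sum>i\<in>S. lam z (g i))"
    using l r by (simp_all add: linear_add linear_diff linear_scale linear_neg linear_sum
        linear_add[OF r] linear_diff[OF r] linear_scale[OF r] linear_neg[OF r] linear_sum[OF r])
qed

lemma f_expand: "f V = (\<Sum>j<d. \<Sum>i<n. \<Sum>i'<n. (V i j * V i' j) *\<^sub>R lam (w i) (w i'))"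
proof -
  have "lam (col V j) (col V j) = (\<Sum>i<n. \<Sum>i'<n. (V i j * V i' j) *\<^sub>R lam (w i) (w i'))" for j
    unfolding col_def lam_simps(9) by (simp only: lam_simps scaleR_sum_right scaleR_scaleR mult.commute)
  then show ?thesis by (simp add: f_def)
qed

lemma f_in_B: "f V \<in> B"
  unfolding f_expand by (intro subspace_sum subspace_scale subspace_B lam_in_B) auto

lemma continuous_on_f:
  fixes V :: "'z::topological_space \<Rightarrow> nat \<Rightarrow> nat \<Rightarrow> real"
  assumes "\<And>i j. continuous_on S (\<lambda>z. V z i j)"
  shows "continuous_on S (\<lambda>z. f (V z))"
  unfolding f_expand by (intro continuous_intros assms)

lemma col_Idm: "j < d \<Longrightarrow> col Idm j = w j"
proof -
  assume j: "j < d"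
  then have "(\<Sum>i<n. Idm i j *\<^sub>R w i) = (\<Sum>i\<in>{j}. Idm i j *\<^sub>R w i)"
    using d by (intro sum.mono_neutral_right) (auto simp: Idm_def)
  then show ?thesis using j by (simp add: col_def Idm_def)
qed

lemma col_add: "col (\<lambda>i j. V i j + s * H i j) j = col V j + s *\<^sub>R col H j"
  by (simp add: col_def scaleR_add_left sum.distrib scaleR_sum_right)

text \<open>The expansion is exact because \<open>f\<close> is quadratic. Its linear term identifies
  the family \<open>L\<close> with half the derivative of \<open>f\<close> at \<open>Idm\<close>, so
  that independence of \<open>L\<close> makes \<open>Idm\<close> a nondegenerate zero of
  \<open>f - b\<close>.\<close>

lemma f_near:
  assumes H: "supp H"
  shows "f (\<lambda>i j. Idm i j + s * H i j)
       = b + (2 * s) *\<^sub>R (\<Sum>(i, j)\<in>I. H i j *\<^sub>R L (i, j)) + s\<^sup>2 *\<^sub>R f H"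
proof -
  have "lam (w j + s *\<^sub>R y) (w j + s *\<^sub>R y)
      = lam (w j) (w j) + (2 * s) *\<^sub>R lam y (w j) + s\<^sup>2 *\<^sub>R lam y y" for j y
    using scaleR_left_distrib[of s s "lam y (w j)"]
    by (simp add: lam_simps sym[of "w j" y] power2_eq_square algebra_simps)
  then have "f (\<lambda>i j. Idm i j + s * H i j)
      = (\<Sum>j<d. lam (w j) (w j) + (2 * s) *\<^sub>R lam (col H j) (w j) + s\<^sup>2 *\<^sub>R lam (col H j) (col H j))"
    unfolding f_def
    by (intro sum.cong) (simp_all add: col_add col_Idm)
  also have "\<dots> = b + (2 * s) *\<^sub>R (\<Sum>j<d. lam (col H j) (w j)) + s\<^sup>2 *\<^sub>R f H"
    by (simp add: b_def f_def sum.distrib scaleR_sum_right col_Idm)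
  also have "(\<Sum>j<d. lam (col H j) (w j)) = (\<Sum>j<d. \<Sum>i<n. H i j *\<^sub>R L (i, j))"
    by (simp add: col_def lam_simps L_def)
  also have "\<dots> = (\<Sum>(j, i)\<in>{..<d} \<times> {..<n}. H i j *\<^sub>R L (i, j))"
    by (simp add: sum.cartesian_product)
  also have "\<dots> = (\<Sum>(i, j)\<in>{..<n} \<times> {..<d}. H i j *\<^sub>R L (i, j))"
    by (rule sum.reindex_bij_witness[of _ prod.swap prod.swap]) auto
  also have "\<dots> = (\<Sum>(i, j)\<in>I. H i j *\<^sub>R L (i, j))"
  proof (rule sum.mono_neutral_right)
    show "I \<subseteq> {..<n} \<times> {..<d}" by (auto simp: I_def)
  qed (use H in \<open>auto simp: supp_def\<close>)
  finally show ?thesis .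
qed

lemma dual_exists: "\<exists>\<alpha> :: nat \<times> nat \<Rightarrow> 'y \<Rightarrow> real. \<forall>k\<in>I. linear (\<alpha> k) \<and> (\<forall>k'\<in>I. \<alpha> k (L k') = (if k' = k then 1 else 0))"
proof -
  obtain \<alpha> :: "nat \<times> nat \<Rightarrow> 'y \<Rightarrow> real" where "\<And>k. k \<in> I \<Longrightarrow> linear (\<alpha> k)"
    "\<And>k k'. k \<in> I \<Longrightarrow> k' \<in> I \<Longrightarrow> \<alpha> k (L k') = (if k' = k then 1 else (0::real))"
    by (rule dual_family_exists[OF finite_I, of L]) (use L_indep in blast)+
  then show ?thesis by (intro exI[of _ \<alpha>]) auto
qed

text \<open>On \<open>B\<close> these are the coordinates with respect to \<open>L\<close>. They are
  linear on the whole space because the negligibility argument in \<open>generic_direction\<close>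
  takes place there.\<close>

definition \<alpha> :: "nat \<times> nat \<Rightarrow> 'y \<Rightarrow> real" where
  "\<alpha> = (SOME \<alpha>. \<forall>k\<in>I. linear (\<alpha> k) \<and> (\<forall>k'\<in>I. \<alpha> k (L k') = (if k' = k then 1 else 0)))"

lemma linear_\<alpha>: "k \<in> I \<Longrightarrow> linear (\<alpha> k)"
  and \<alpha>_L: "k \<in> I \<Longrightarrow> k' \<in> I \<Longrightarrow> \<alpha> k (L k') = (if k' = k then 1 else 0)"
  using someI_ex[OF dual_exists] unfolding \<alpha>_def by blast+

lemma B_expand: "y \<in> B \<Longrightarrow> y = (\<Sum>k\<in>I. \<alpha> k y *\<^sub>R L k)"
  unfolding B_def
proof (induction rule: span_induct_alt)
  case base
  then show ?case by (simp add: linear_0 linear_\<alpha>)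
next
  case (step c x y)
  then obtain k where k: "k \<in> I" "x = L k" by auto
  have "(\<Sum>k'\<in>I. \<alpha> k' (c *\<^sub>R x + y) *\<^sub>R L k') = c *\<^sub>R (\<Sum>k'\<in>I. \<alpha> k' x *\<^sub>R L k') + (\<Sum>k'\<in>I. \<alpha> k' y *\<^sub>R L k')"
    by (simp add: linear_add linear_scale linear_\<alpha> scaleR_add_left sum.distrib scaleR_sum_right)
  also have "(\<Sum>k'\<in>I. \<alpha> k' x *\<^sub>R L k') = x"
    using k finite_I by (simp add: \<alpha>_L if_distrib[of "\<lambda>x. x *\<^sub>R _"] cong: if_cong)
  finally show ?case using step by simp
qed

lemma \<alpha>_sum: "k \<in> I \<Longrightarrow> \<alpha> k (\<Sum>k'\<in>I. c k' *\<^sub>R L k') = c k"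
  using finite_I by (simp add: linear_sum linear_scale linear_\<alpha> \<alpha>_L if_distrib[of "\<lambda>x. _ * x"] cong: if_cong)

text \<open>Homogeneity reduces the bound to the unit sphere of the span, where compactness gives a
  positive minimum of \<open>\<phi> (lam x x)\<close>. Functionals dual to \<open>w\<close> then
  bound the coefficients of a vector by its norm.\<close>

lemma f_coercive: "\<exists>c>0. \<forall>V. \<phi> (f V) \<ge> c * (\<Sum>j<d. \<Sum>i<n. (V i j)\<^sup>2)"
proof -
  let ?W = "span (w ` {..<n})"
  let ?S = "?W \<inter> sphere 0 1"
  have lin1: "linear (\<lambda>x. lam x z)" "linear (lam z)" for z using bil by (auto simp: bilinear_def)
  obtain K where K: "K > 0" "\<And>x. x \<in> ?W \<Longrightarrow> \<phi> (lam x x) \<ge> K * (norm x)\<^sup>2"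
  proof (cases "?S = {}")
    case True
    have "x = 0" if "x \<in> ?W" for x
    proof (rule ccontr)
      assume "x \<noteq> 0"
      then have "(1 / norm x) *\<^sub>R x \<in> ?S" using that by (simp add: span_scale)
      then show False using True by blast
    qed
    then show ?thesis using that[of 1] linear_0[OF lin1(1)] linear_0[OF lin_\<phi>] by fastforce
  next
    case False
    have comp: "compact ?S" by (simp add: closed_Int_compact closed_subspace)
    have cont: "continuous_on ?S (\<lambda>x. \<phi> (lam x x))"
      by (intro continuous_on_compose2[OF linear_continuous_on[OF linear_conv_bounded_linear[THEN iffD1, OF lin_\<phi>]]]
          bilinear_continuous_on_compose[OF _ _ bil] continuous_intros) auto
    obtain x0 where x0: "x0 \<in> ?S" "\<And>y. y \<in> ?S \<Longrightarrow> \<phi> (lam x0 x0) \<le> \<phi> (lam y y)"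
      using continuous_attains_inf[OF comp False cont] by blast
    have "\<phi> (lam x0 x0) > 0" using x0(1) by (intro pos) auto
    moreover have "\<phi> (lam x x) \<ge> \<phi> (lam x0 x0) * (norm x)\<^sup>2" if x: "x \<in> ?W" for x
    proof (cases "x = 0")
      case True
      then show ?thesis using lin1 linear_0[OF lin_\<phi>] by (simp add: linear_0)
    next
      case False
      define y where "y = (1 / norm x) *\<^sub>R x"
      have y: "y \<in> ?S" using False x by (simp add: y_def span_scale)
      have "x = norm x *\<^sub>R y" using False by (simp add: y_def)
      then have "lam x x = (norm x)\<^sup>2 *\<^sub>R lam y y"
        by (metis lam_simps(5,6) power2_eq_square scaleR_scaleR)
      then have "\<phi> (lam x x) = (norm x)\<^sup>2 * \<phi> (lam y y)"
        using linear_scale[OF lin_\<phi>] by simp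
      then show ?thesis using mult_right_mono[OF x0(2)[OF y], of "(norm x)\<^sup>2"] by (simp add: mult.commute)
    qed
    ultimately show ?thesis using that by blast
  qed
  have "\<exists>c>0. \<forall>a. (norm (\<Sum>i<n. a i *\<^sub>R w i))\<^sup>2 \<ge> c * (\<Sum>i<n. (a i)\<^sup>2)"
  proof -
    obtain g :: "nat \<Rightarrow> 'w \<Rightarrow> real" where g: "\<And>k. k < n \<Longrightarrow> linear (g k)"
      "\<And>k k'. k < n \<Longrightarrow> k' < n \<Longrightarrow> g k (w k') = (if k' = k then 1 else 0)"
      by (rule dual_family_exists[of "{..<n}" w]) (use indep_w in auto)
    have "\<exists>C>0. \<forall>x. norm (g k x) \<le> C * norm x" if "k < n" for k
      using linear_bounded_pos[OF g(1)[OF that]] by metis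
    then obtain C where C: "\<And>k. k < n \<Longrightarrow> C k > 0" "\<And>k x. k < n \<Longrightarrow> norm (g k x) \<le> C k * norm x" by metis
    define D where "D = (\<Sum>k<n. (C k)\<^sup>2)"
    have "(C k)\<^sup>2 > 0" if "k < n" for k using C(1)[OF that] by simp
    then have D: "D > 0" unfolding D_def using d by (intro sum_pos) (auto simp: lessThan_empty_iff)
    have "(\<Sum>i<n. (a i)\<^sup>2) \<le> D * (norm (\<Sum>i<n. a i *\<^sub>R w i))\<^sup>2" for a
    proof -
      let ?x = "\<Sum>i<n. a i *\<^sub>R w i"
      have "a i = g i ?x" if "i < n" for i
        using that g by (simp add: linear_sum linear_scale if_distrib[of "\<lambda>x. _ * x"] cong: if_cong)
      then have "\<bar>a i\<bar> \<le> C i * norm ?x" if "i < n" for i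
        using C(2)[OF that, of ?x] that by simp
      then have "(a i)\<^sup>2 \<le> (C i)\<^sup>2 * (norm ?x)\<^sup>2" if "i < n" for i
        using power_mono[of "\<bar>a i\<bar>" "C i * norm ?x" 2] that by (simp add: power_mult_distrib)
      then show ?thesis unfolding D_def sum_distrib_right by (intro sum_mono) auto
    qed
    then have "(1 / D) * (\<Sum>i<n. (a i)\<^sup>2) \<le> (norm (\<Sum>i<n. a i *\<^sub>R w i))\<^sup>2" for a
      using D by (simp add: field_simps)
    then show ?thesis using D by (intro exI[of _ "1/D"]) auto
  qed
  then obtain c where c: "c > 0" "\<And>a. (norm (\<Sum>i<n. a i *\<^sub>R w i))\<^sup>2 \<ge> c * (\<Sum>i<n. (a i)\<^sup>2)" by blast
  have "\<phi> (f V) \<ge> (K * c) * (\<Sum>j<d. \<Sum>i<n. (V i j)\<^sup>2)" for V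
  proof -
    have "K * c * (\<Sum>i<n. (V i j)\<^sup>2) \<le> \<phi> (lam (col V j) (col V j))" for j
    proof -
      have "col V j \<in> ?W" unfolding col_def by (intro span_sum span_scale span_base) auto
      then have "K * (norm (col V j))\<^sup>2 \<le> \<phi> (lam (col V j) (col V j))" by (rule K)
      moreover have "K * (c * (\<Sum>i<n. (V i j)\<^sup>2)) \<le> K * (norm (col V j))\<^sup>2"
        unfolding col_def using c K by (intro mult_left_mono) auto
      ultimately show ?thesis by (simp add: mult.assoc)
    qed
    then show ?thesis
      unfolding f_def linear_sum[OF lin_\<phi>] sum_distrib_left[of "K * c" "\<lambda>j. _ j"] by (intro sum_mono) auto
  qed
  then show ?thesis using K c by (intro exI[of _ "K * c"]) auto
qed

text \<open>Because \<open>d < n\<close>, every column, also the last one, has a free entry just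
  below the diagonal; so each wall has codimension two among the trapezoidal matrices.\<close>

definition wall :: "nat \<Rightarrow> (nat \<Rightarrow> nat \<Rightarrow> real) set" where
  "wall i = {V. supp V \<and> V i i = 0 \<and> V (Suc i) i = 0}"

text \<open>
  The set where \<open>V i i = 0\<close> has codimension one, but its image under \<open>f\<close> has codimension two, because a
  rotation of the columns \<open>i\<close> and \<open>i + 1\<close> clears one more entry.
\<close>

lemma rotate_into_wall:
  assumes V: "supp V" and i: "Suc i < d" and Vi: "V i i = 0"
  shows "\<exists>V'\<in>wall i. f V' = f V"
proof (cases "V (Suc i) i = 0")
  case True
  then show ?thesis using V Vi by (auto simp: wall_def)
next
  case False
  \<comment> \<open>Columns \<open>i\<close> and \<open>i + 1\<close> are rotated by the angle that
    clears the entry in row \<open>i + 1\<close> of column \<open>i\<close>. Both columns vanish in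
    row \<open>i\<close>, so the trapezoidal shape and the zero at \<open>(i, i)\<close>
    survive.\<close>
  define r where "r = sqrt ((V (Suc i) i)\<^sup>2 + (V (Suc i) (Suc i))\<^sup>2)"
  have r: "r > 0" using False unfolding r_def by (simp add: sum_power2_gt_zero_iff)
  have r2: "r * r = (V (Suc i) i)\<^sup>2 + (V (Suc i) (Suc i))\<^sup>2"
    unfolding r_def using real_sqrt_mult_self by (simp flip: real_sqrt_mult)
  define a where "a = V (Suc i) (Suc i) / r"
  define c where "c = V (Suc i) i / r"
  have ac: "a\<^sup>2 + c\<^sup>2 = 1"
    using r r2 False by (simp add: a_def c_def power_divide power2_eq_square flip: add_divide_distrib)
  define V' where "V' = (\<lambda>k j. if j = i then a * V k i - c * V k (Suc i)
     else if j = Suc i then c * V k i + a * V k (Suc i) else V k j)"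
  have "supp V'"
    using V Vi i by (auto simp: supp_def V'_def mem_I)
      (metis Suc_leI le_neq_implies_less mult_zero_right order_refl)+
  moreover have "V' i i = 0" "V' (Suc i) i = 0"
    using Vi V i by (auto simp: V'_def supp_def mem_I a_def c_def)
  moreover have "f V' = f V"
  proof -
    have ci: "col V' i = a *\<^sub>R col V i - c *\<^sub>R col V (Suc i)"
      by (simp add: col_def V'_def scaleR_sum_right sum_subtractf scaleR_diff_left)
    have cs: "col V' (Suc i) = c *\<^sub>R col V i + a *\<^sub>R col V (Suc i)"
      by (simp add: col_def V'_def scaleR_sum_right sum.distrib scaleR_add_left)
    have co: "col V' j = col V j" if "j \<noteq> i" "j \<noteq> Suc i" for j
      using that by (simp add: col_def V'_def)
    have rot: "lam (a *\<^sub>R x - c *\<^sub>R y) (a *\<^sub>R x - c *\<^sub>R y) + lam (c *\<^sub>R x + a *\<^sub>R y) (c *\<^sub>R x + a *\<^sub>R y)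
        = lam x x + lam y y" for x y
    proof -
      have "lam (a *\<^sub>R x - c *\<^sub>R y) (a *\<^sub>R x - c *\<^sub>R y) + lam (c *\<^sub>R x + a *\<^sub>R y) (c *\<^sub>R x + a *\<^sub>R y)
         = (a\<^sup>2 + c\<^sup>2) *\<^sub>R lam x x + (a\<^sup>2 + c\<^sup>2) *\<^sub>R lam y y"
        by (simp add: lam_simps sym[of y x] power2_eq_square algebra_simps)
      then show ?thesis using ac by simp
    qed
    have split: "{..<d} = insert i (insert (Suc i) ({..<d} - {i, Suc i}))" using i by auto
    have "f V' = lam (col V' i) (col V' i) + lam (col V' (Suc i)) (col V' (Suc i))
        + (\<Sum>j\<in>{..<d} - {i, Suc i}. lam (col V' j) (col V' j))"
      unfolding f_def by (subst split) (simp add: add.assoc)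
    also have "\<dots> = lam (col V i) (col V i) + lam (col V (Suc i)) (col V (Suc i))
        + (\<Sum>j\<in>{..<d} - {i, Suc i}. lam (col V j) (col V j))"
      by (simp add: ci cs rot co)
    also have "\<dots> = f V"
      unfolding f_def by (subst (2) split) (simp add: add.assoc)
    finally show ?thesis .
  qed
  ultimately show ?thesis by (auto simp: wall_def)
qed

end

text \<open>The assumption equates \<open>V\<close> times its transpose with the same product for
  \<open>Idm\<close>: the two frameworks agree up to an orthogonal map. This is the form in which
  global rigidity is used.\<close>

locale trapezoid_unique = trapezoid +
  assumes uniq: "supp V \<Longrightarrow> f V = b \<Longrightarrow> i < n \<Longrightarrow> i' < n \<Longrightarrow>
    (\<Sum>j<d. V i j * V i' j) = (if i = i' \<and> i < d then 1 else 0)"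
begin

text \<open>The first \<open>d\<close> rows are orthonormal and lower triangular. Going down the
  rows, each one is orthogonal to the signed unit vectors above it and so is itself a signed unit
  vector.\<close>

lemma solution_diagonal:
  assumes V: "supp V" "f V = b"
  shows "i < d \<Longrightarrow> (V i i)\<^sup>2 = 1 \<and> (\<forall>j. j \<noteq> i \<longrightarrow> V i j = 0)"
proof (induction i rule: less_induct)
  case (less i)
  have i: "i < n" using less.prems d by simp
  have off: "V i j = 0" if "j < i" for j
  proof -
    have IH: "(V j j)\<^sup>2 = 1" "\<And>l. l \<noteq> j \<Longrightarrow> V j l = 0" using less that by auto
    have "0 = (\<Sum>l<d. V i l * V j l)" using uniq[OF V i, of j] that i by simp
    also have "\<dots> = (\<Sum>l\<in>{j}. V i l * V j l)"
      using that less.prems IH(2) by (intro sum.mono_neutral_right) auto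
    finally show ?thesis using IH(1) by auto
  qed
  have off': "V i j = 0" if "j \<noteq> i" for j
    using that off V(1) by (cases "j < i") (auto simp: supp_def mem_I)
  have "1 = (\<Sum>l<d. V i l * V i l)" using uniq[OF V i i] less.prems by simp
  also have "\<dots> = (\<Sum>l\<in>{i}. V i l * V i l)"
    using less.prems off' by (intro sum.mono_neutral_right) auto
  finally show ?case using off' by (simp add: power2_eq_square)
qed

lemma solution_zero:
  assumes V: "supp V" "f V = b" and i: "d \<le> i"
  shows "V i j = 0"
proof (cases "i < n \<and> j < d")
  case True
  have "(\<Sum>l<d. V i l * V i l) = 0" using uniq[OF V, of i i] True i by simp
  then have "V i j * V i j = 0" using True by (subst (asm) sum_nonneg_eq_0_iff) auto
  then show ?thesis by simp
qed (use V i in \<open>auto simp: supp_def mem_I\<close>)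

text \<open>
  For each \<open>i\<close>, the directions to be avoided are covered by the image of a part of a hyperplane under the
  smooth map \<open>\<Xi> i\<close> (the division by \<open>\<alpha> (i, i) y\<close> is harmless on its domain \<open>D i\<close>).
\<close>

lemma generic_direction:
  "\<exists>e\<in>B. \<phi> e > 0 \<and> (\<forall>i<d. \<forall>V\<in>wall i. \<forall>r. f V - b \<noteq> r *\<^sub>R e)"
proof -
  define Wm where "Wm = (\<lambda>i (y::'b) i' j. if (i', j) \<in> I - {(i, i), (Suc i, i)} then \<alpha> (i', j) y else 0)"
  define pB where "pB = (\<lambda>y. \<Sum>k\<in>I. \<alpha> k y *\<^sub>R L k)"
  \<comment> \<open>If \<open>f V - b = r *\<^sub>R e\<close> with \<open>V\<close> in the wall,
    then \<open>e\<close> is \<open>(f V - b) / r\<close>. The entries of \<open>V\<close> are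
    stored as coordinates of \<open>y\<close>, and \<open>r\<close> in the place
    \<open>(i, i)\<close> that the wall leaves free; the place \<open>(Suc i, i)\<close> stays zero,
    which confines \<open>y\<close> to a hyperplane. The summand \<open>y - pB y\<close> retains the
    component outside \<open>B\<close>, so that source and target have the same dimension.\<close>
  define \<Xi> where "\<Xi> = (\<lambda>i y. inverse (\<alpha> (i, i) y) *\<^sub>R (f (Wm i y) - b) + (y - pB y))"
  define D where "D = (\<lambda>i. {y. \<alpha> (Suc i, i) y = 0 \<and> \<alpha> (i, i) y \<noteq> 0})"
  have inI: "(i, i) \<in> I" "(Suc i, i) \<in> I" if "i < d" for i using that d by (auto simp: mem_I)
  have diff\<alpha>: "\<alpha> k differentiable (at y within S)" if "k \<in> I" for k y S
    using linear_\<alpha>[OF that] by (simp add: linear_imp_differentiable)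
  have "negligible (\<Xi> i ` D i)" if i: "i < d" for i
  proof (rule negligible_differentiable_image_negligible)
    have "negligible {y. \<alpha> (Suc i, i) y = 0}"
    proof (rule negligible_lowdim)
      have ker: "subspace {y. \<alpha> (Suc i, i) y = 0}"
        using linear_subspace_kernel[OF linear_\<alpha>[OF inI(2)[OF i]]] .
      have "L (Suc i, i) \<notin> {y. \<alpha> (Suc i, i) y = 0}" using inI[OF i] by (simp add: \<alpha>_L)
      then have "{y. \<alpha> (Suc i, i) y = 0} \<noteq> UNIV" by blast
      then show "dim {y. \<alpha> (Suc i, i) y = 0} < DIM('b)"
        using dim_eq_full ker dim_subset_UNIV le_neq_implies_less by (metis span_eq_iff)
    qed
    then show "negligible (D i)" by (rule negligible_subset) (auto simp: D_def)
    have Wd: "(\<lambda>y. Wm i y i' j) differentiable (at y within D i)" for i' j y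
      unfolding Wm_def by (cases "(i', j) \<in> I - {(i, i), (Suc i, i)}") (auto intro: diff\<alpha>)
    show "\<Xi> i differentiable_on D i"
      unfolding differentiable_on_def \<Xi>_def f_expand pB_def
      by (intro ballI differentiable_add differentiable_diff differentiable_scaleR differentiable_sum
          differentiable_inverse differentiable_mult Wd diff\<alpha> inI i differentiable_const differentiable_ident finite_I finite_lessThan)
        (auto simp: D_def)
  qed simp
  then have neg: "negligible (\<Union>i<d. \<Xi> i ` D i)" by (intro negligible_Union) auto
  have lin_pB: "linear pB"
    unfolding pB_def
    by (rule linearI) (simp_all add: linear_add linear_scale linear_\<alpha> scaleR_add_left sum.distrib scaleR_sum_right)
  have pB: "pB y \<in> B" for y
    unfolding pB_def by (intro subspace_sum subspace_scale subspace_B L_in_B)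
  have "open {y. \<phi> (pB y) > 0}"
  proof -
    have "linear (\<lambda>y. \<phi> (pB y))" using linear_compose[OF lin_pB lin_\<phi>] by (simp add: o_def)
    then show ?thesis
      by (intro open_Collect_less continuous_intros linear_continuous_on) (simp add: linear_conv_bounded_linear)
  qed
  moreover have "{y. \<phi> (pB y) > 0} \<noteq> {}"
  proof -
    have "pB (L (0, 0)) = L (0, 0)" unfolding pB_def
      using B_expand[OF L_in_B[OF inI(1)[of 0]]] d by simp
    moreover have "w 0 \<noteq> 0" using indep_w[of "\<lambda>i. if i = 0 then 1 else 0" 0] d
      by (auto simp: if_distrib[of "\<lambda>x. x *\<^sub>R _"] cong: if_cong)
    then have "\<phi> (L (0, 0)) > 0"
      using pos[of "w 0"] d by (simp add: L_def span_base)
    ultimately show ?thesis by (metis (mono_tags) empty_iff mem_Collect_eq)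
  qed
  ultimately have "\<not> {y. \<phi> (pB y) > 0} \<subseteq> (\<Union>i<d. \<Xi> i ` D i)"
    using neg negligible_subset open_not_negligible by blast
  then obtain y where y: "\<phi> (pB y) > 0" "\<And>i. i < d \<Longrightarrow> y \<notin> \<Xi> i ` D i" by blast
  show ?thesis
  proof (intro bexI[of _ "pB y"] conjI allI impI ballI notI)
    fix i V r assume i: "i < d" and V: "V \<in> wall i" and eq: "f V - b = r *\<^sub>R pB y"
    have "r \<noteq> 0"
    proof
      assume "r = 0"
      then have "f V = b" using eq by simp
      then show False using solution_diagonal[of V i] V i by (simp add: wall_def)
    qed
    define x where "x = (\<Sum>k\<in>I. (if k = (i, i) then r else V (fst k) (snd k)) *\<^sub>R L k) + (y - pB y)"
    have \<alpha>x: "\<alpha> k x = (if k = (i, i) then r else V (fst k) (snd k))" if k: "k \<in> I" for k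
    proof -
      have "\<alpha> k (y - pB y) = 0"
        using linear_diff[OF linear_\<alpha>[OF k]] \<alpha>_sum[OF k] by (simp add: pB_def)
      then show ?thesis
        unfolding x_def linear_add[OF linear_\<alpha>[OF k]] using \<alpha>_sum[OF k] by simp
    qed
    have "x \<in> D i" using V inI[OF i] \<open>r \<noteq> 0\<close> by (simp add: D_def \<alpha>x wall_def)
    moreover have "\<Xi> i x = y"
    proof -
      have "Wm i x = V"
        using V by (auto simp: fun_eq_iff Wm_def \<alpha>x wall_def supp_def)
      moreover have "x - pB x = y - pB y"
      proof -
        have "pB x = (\<Sum>k\<in>I. (if k = (i, i) then r else V (fst k) (snd k)) *\<^sub>R L k)"
          by (simp add: pB_def \<alpha>x)
        then show ?thesis unfolding x_def by simp
      qed
      ultimately show ?thesis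
        using eq \<open>r \<noteq> 0\<close> inI[OF i] by (simp add: \<Xi>_def \<alpha>x)
    qed
    ultimately show False using y(2)[OF i] by (metis image_eqI)
  qed (use y pB in auto)
qed

end

lemma sphere_proj_scale: "c > 0 \<Longrightarrow> sphere_proj p (\<lambda>i. c * x i) = sphere_proj p x"
proof -
  assume c: "c > 0"
  have "(\<Sum>j\<le>p. (c * x j)\<^sup>2) = c\<^sup>2 * (\<Sum>j\<le>p. (x j)\<^sup>2)"
    by (simp add: power_mult_distrib sum_distrib_left)
  then show ?thesis using c by (simp add: sphere_proj_def fun_eq_iff real_sqrt_mult)
qed

text \<open>
  The map \<open>f - b\<close> is used on the orthant where the diagonal entries other than the last one are nonnegative.
  It is extended to all of the trapezoidal matrices by clamping these entries and pushing in the direction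
  \<open>e\<close>, which creates no zeros when \<open>e\<close> is generic. The cutoff makes the map constantly \<open>e\<close> far away from
  the centre, which is chosen invariant under a change of sign of the last column.
\<close>

context trapezoid
begin

definition clamp_diag :: "(nat \<Rightarrow> nat \<Rightarrow> real) \<Rightarrow> nat \<Rightarrow> nat \<Rightarrow> real" where
  "clamp_diag V = (\<lambda>i j. if i = j \<and> Suc i < d then max 0 (V i j) else V i j)"
definition slack :: "(nat \<Rightarrow> nat \<Rightarrow> real) \<Rightarrow> real" where
  "slack V = (\<Sum>i<d - 1. max 0 (- V i i))"
definition defect :: "'y \<Rightarrow> (nat \<Rightarrow> nat \<Rightarrow> real) \<Rightarrow> 'y" where
  "defect e V = f (clamp_diag V) - b + slack V *\<^sub>R e"
definition center_dist_sq :: "(nat \<Rightarrow> nat \<Rightarrow> real) \<Rightarrow> real" where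
  "center_dist_sq V = (\<Sum>(i, j)\<in>I. (V i j - (if i = j \<and> Suc i < d then 1 else 0))\<^sup>2)"
definition cutoff :: "real \<Rightarrow> (nat \<Rightarrow> nat \<Rightarrow> real) \<Rightarrow> real" where
  "cutoff R V = min 1 (max 0 (center_dist_sq V / R - 1))"
definition cut_defect :: "real \<Rightarrow> 'y \<Rightarrow> (nat \<Rightarrow> nat \<Rightarrow> real) \<Rightarrow> 'y" where
  "cut_defect R e V = (1 - cutoff R V) *\<^sub>R defect e V + cutoff R V *\<^sub>R e"
definition flip_col :: "(nat \<Rightarrow> nat \<Rightarrow> real) \<Rightarrow> nat \<Rightarrow> nat \<Rightarrow> real" where
  "flip_col V = (\<lambda>i j. if j = d - 1 then - V i j else V i j)"

lemma slack_nonneg: "slack V \<ge> 0" by (simp add: slack_def sum_nonneg)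

lemma supp_clamp_diag: "supp V \<Longrightarrow> supp (clamp_diag V)" by (simp add: supp_def clamp_diag_def)

lemma supp_Idm: "supp Idm" using d by (simp add: supp_def Idm_def mem_I)

lemma b_in_B: "b \<in> B" by (simp add: b_def f_in_B)

lemma defect_in_B: "e \<in> B \<Longrightarrow> defect e V \<in> B"
  unfolding defect_def by (intro subspace_add subspace_diff subspace_scale subspace_B f_in_B b_in_B)

lemma cut_defect_in_B: "e \<in> B \<Longrightarrow> cut_defect R e V \<in> B"
  unfolding cut_defect_def by (intro subspace_add subspace_scale subspace_B defect_in_B)

lemma clamp_diag_id: "(\<And>i. Suc i < d \<Longrightarrow> V i i \<ge> 0) \<Longrightarrow> clamp_diag V = V"
  by (auto simp: clamp_diag_def fun_eq_iff)

lemma slack_eq_0_iff: "slack V = 0 \<longleftrightarrow> (\<forall>i. Suc i < d \<longrightarrow> V i i \<ge> 0)"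
proof -
  have "slack V = 0 \<longleftrightarrow> (\<forall>i\<in>{..<d-1}. max 0 (- V i i) = 0)"
    unfolding slack_def by (rule sum_nonneg_eq_0_iff) auto
  also have "\<dots> \<longleftrightarrow> (\<forall>i. Suc i < d \<longrightarrow> V i i \<ge> 0)" 
  proof -
    have "max 0 (- V i i) = 0 \<longleftrightarrow> V i i \<ge> 0" for i by auto
    then show ?thesis by (simp add: Ball_def less_diff_conv)
  qed
  finally show ?thesis .
qed

lemma f_flip_col: "f (flip_col V) = f V"
  unfolding f_expand by (intro sum.cong) (auto simp: flip_col_def)

lemma cut_defect_flip_col: "cut_defect R e (flip_col V) = cut_defect R e V"
proof -
  have "clamp_diag (flip_col V) = flip_col (clamp_diag V)" by (auto simp: clamp_diag_def flip_col_def fun_eq_iff)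
  moreover have "slack (flip_col V) = slack V" by (auto simp: slack_def flip_col_def intro!: sum.cong)
  moreover have "center_dist_sq (flip_col V) = center_dist_sq V" by (auto simp: center_dist_sq_def flip_col_def intro!: sum.cong)
  ultimately show ?thesis by (simp add: cut_defect_def defect_def cutoff_def f_flip_col)
qed

lemma continuous_on_cut_defect:
  fixes V :: "'z::topological_space \<Rightarrow> nat \<Rightarrow> nat \<Rightarrow> real"
  assumes V: "\<And>i j. continuous_on S (\<lambda>z. V z i j)" and R: "R > 0"
  shows "continuous_on S (\<lambda>z. cut_defect R e (V z))"
proof -
  have 1: "continuous_on S (\<lambda>z. clamp_diag (V z) i j)" for i j
  proof (cases "i = j \<and> Suc i < d")
    case True
    then show ?thesis unfolding clamp_diag_def by (simp add: continuous_on_max V)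
  next
    case False
    then have "clamp_diag (V z) i j = V z i j" for z by (auto simp: clamp_diag_def)
    then show ?thesis by (simp add: V)
  qed
  have 2: "continuous_on S (\<lambda>z. cutoff R (V z))"
    unfolding cutoff_def center_dist_sq_def case_prod_unfold using R by (intro continuous_intros V) auto
  show ?thesis unfolding cut_defect_def defect_def slack_def by (intro continuous_intros 1 2 V continuous_on_f)
qed

text \<open>Under \<open>\<phi>\<close> the terms from \<open>f\<close> and from the push are
  nonnegative. If they do not outweigh \<open>\<phi> b\<close>, then both the clamped matrix and
  \<open>slack V\<close> are bounded, and \<open>V\<close> differs from the clamped matrix by at
  most \<open>slack V\<close> in each entry.\<close>

lemma defect_coercive:
  assumes e: "\<phi> e > 0"
  shows "\<exists>R0>0. \<forall>V. center_dist_sq V > R0 \<longrightarrow> \<phi> (defect e V) > 0"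
proof -
  obtain c where c: "c > 0" "\<And>V. \<phi> (f V) \<ge> c * (\<Sum>j<d. \<Sum>i<n. (V i j)\<^sup>2)" using f_coercive by blast
  \<comment> \<open>The summands bound a clamped entry (\<open>x\<^sup>2 \<le> a\<close> gives
    \<open>\<bar>x\<bar> \<le> a + 1\<close>), the slack, and the entry of the centre.\<close>
  define M where "M = \<bar>\<phi> b\<bar> / c + 1 + \<bar>\<phi> b\<bar> / \<phi> e + 1"
  have "center_dist_sq V \<le> M\<^sup>2 * card I" if le: "\<phi> (defect e V) \<le> 0" for V
  proof -
    have eq: "\<phi> (defect e V) = \<phi> (f (clamp_diag V)) - \<phi> b + slack V * \<phi> e"
      by (simp add: defect_def linear_add[OF lin_\<phi>] linear_diff[OF lin_\<phi>] linear_scale[OF lin_\<phi>])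
    let ?N = "\<Sum>j<d. \<Sum>i<n. (clamp_diag V i j)\<^sup>2"
    have N0: "0 \<le> c * ?N" using c by (simp add: sum_nonneg)
    have s0: "0 \<le> slack V * \<phi> e" using slack_nonneg e by simp
    have cN: "c * ?N \<le> \<bar>\<phi> b\<bar>" using le eq c(2)[of "clamp_diag V"] s0 by linarith
    have "slack V * \<phi> e \<le> \<bar>\<phi> b\<bar>" using le eq c(2)[of "clamp_diag V"] N0 by linarith
    then have s: "slack V \<le> \<bar>\<phi> b\<bar> / \<phi> e" using e by (simp add: field_simps)
    have N: "?N \<le> \<bar>\<phi> b\<bar> / c" using cN c by (simp add: field_simps)
    have "(V i j - (if i = j \<and> Suc i < d then 1 else 0))\<^sup>2 \<le> M\<^sup>2" if ij: "(i, j) \<in> I" for i j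
    proof -
      have "(clamp_diag V i j)\<^sup>2 \<le> (\<Sum>i<n. (clamp_diag V i j)\<^sup>2)"
        using ij by (intro member_le_sum) (auto simp: mem_I)
      also have "\<dots> \<le> ?N"
        using ij by (intro member_le_sum[of j "{..<d}" "\<lambda>j. \<Sum>i<n. (clamp_diag V i j)\<^sup>2"]) (auto simp: mem_I sum_nonneg)
      finally have *: "(clamp_diag V i j)\<^sup>2 \<le> \<bar>\<phi> b\<bar> / c" using N by simp
      have "\<bar>clamp_diag V i j\<bar> \<le> \<bar>\<phi> b\<bar> / c + 1"
      proof (rule ccontr)
        assume "\<not> ?thesis"
        then have "1 \<le> \<bar>clamp_diag V i j\<bar>" "\<bar>\<phi> b\<bar> / c < \<bar>clamp_diag V i j\<bar>"
          using c by (auto simp: not_le) (smt (verit) divide_nonneg_pos)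
        then have "\<bar>\<phi> b\<bar> / c < \<bar>clamp_diag V i j\<bar> * \<bar>clamp_diag V i j\<bar>"
          using mult_left_mono[of 1 "\<bar>clamp_diag V i j\<bar>" "\<bar>clamp_diag V i j\<bar>"] by linarith
        then show False using * by (simp add: power2_eq_square)
      qed
      moreover have "\<bar>V i j - clamp_diag V i j\<bar> \<le> slack V"
      proof (cases "i = j \<and> Suc i < d")
        case True
        have "max 0 (- V i i) \<le> slack V"
          unfolding slack_def using True by (intro member_le_sum) auto
        then show ?thesis using True by (auto simp: clamp_diag_def max_def split: if_splits)
      next
        case False
        then show ?thesis using slack_nonneg by (auto simp: clamp_diag_def)
      qed
      ultimately have "\<bar>V i j - (if i = j \<and> Suc i < d then 1 else 0)\<bar> \<le> M"
        using s unfolding M_def by (auto split: if_splits)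
      then show ?thesis by (metis abs_ge_zero power2_abs power_mono)
    qed
    then have "center_dist_sq V \<le> (\<Sum>k\<in>I. M\<^sup>2)" unfolding center_dist_sq_def by (intro sum_mono) auto
    then show ?thesis by (simp add: mult.commute)
  qed
  then have "\<phi> (defect e V) > 0" if "center_dist_sq V > M\<^sup>2 * card I + 1" for V
    using that by (meson linorder_not_le less_le_trans less_add_one order_less_trans)
  then show ?thesis by (intro exI[of _ "M\<^sup>2 * card I + 1"]) (auto intro: add_nonneg_pos)
qed

end

context trapezoid_unique
begin

section \<open>Zeros of the extended map and its degree\<close>

definition generic_dir :: "'b \<Rightarrow> bool" where
  "generic_dir e \<longleftrightarrow> (\<forall>i<d. \<forall>V\<in>wall i. \<forall>r. f V - b \<noteq> r *\<^sub>R e)"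

text \<open>The push moves values along the line through \<open>e\<close> only, so a value of
  \<open>defect\<close> on this line yields one of \<open>f - b\<close> at the clamped matrix. If an
  entry was clamped, a rotation takes this matrix into a wall; if the last column has the two zeros,
  it already lies in one. There \<open>e\<close> was chosen to exclude it.\<close>

lemma defect_avoids_line:
  assumes e: "generic_dir e" and V: "supp V" and eq: "defect e V = r *\<^sub>R e"
    and *: "slack V \<noteq> 0 \<or> V (d - 1) (d - 1) = 0 \<and> V d (d - 1) = 0"
  shows False
proof -
  have eq': "f (clamp_diag V) - b = (r - slack V) *\<^sub>R e"
    using eq by (simp add: defect_def algebra_simps)
  show False
  proof (cases "slack V = 0")
    case False
    then obtain i where i: "Suc i < d" "V i i < 0" by (auto simp: slack_eq_0_iff not_le)
    then have "clamp_diag V i i = 0" by (simp add: clamp_diag_def)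
    then obtain V' where "V' \<in> wall i" "f V' = f (clamp_diag V)"
      using rotate_into_wall[OF supp_clamp_diag[OF V] i(1)] by blast
    then have "f V' - b = (r - slack V) *\<^sub>R e" "i < d" using eq' i by auto
    then show False using e \<open>V' \<in> wall i\<close> unfolding generic_dir_def by blast
  next
    case True
    then have "clamp_diag V \<in> wall (d - 1)"
      using * d supp_clamp_diag[OF V] by (auto simp: wall_def clamp_diag_def)
    then show False using e eq' d unfolding generic_dir_def
      by (metis One_nat_def diff_less less_le_trans zero_less_one)
  qed
qed

text \<open>A zero cannot have positive slack, so it lies over \<open>b\<close> and is diagonal with
  entries 1 and -1 in the first \<open>d\<close> places. The sign conditions single out
  \<open>Idm\<close>.\<close>

lemma defect_zero:
  assumes e: "generic_dir e" and V: "supp V" and eq: "defect e V = 0" and ge: "V (d - 1) (d - 1) \<ge> 0"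
  shows "V = Idm"
proof -
  have s: "slack V = 0" using defect_avoids_line[OF e V, of 0] eq by auto
  then have nn: "V i i \<ge> 0" if "i < d" for i
  proof (cases "Suc i < d")
    case True
    then show ?thesis using s by (simp add: slack_eq_0_iff)
  next
    case False
    then have "i = d - 1" using that by simp
    then show ?thesis using ge by simp
  qed
  have "clamp_diag V = V" using s by (intro clamp_diag_id) (simp add: slack_eq_0_iff)
  then have fV: "f V = b" using eq s by (simp add: defect_def)
  have "V i j = Idm i j" for i j
  proof (cases "i < d")
    case True
    have "(V i i)\<^sup>2 = 1" "j \<noteq> i \<Longrightarrow> V i j = 0" using solution_diagonal[OF V fV True] by auto
    then show ?thesis using nn[OF True] True by (cases "i = j") (auto simp: Idm_def power2_eq_1_iff)
  next
    case False
    then show ?thesis using solution_zero[OF V fV, of i j] by (simp add: Idm_def)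
  qed
  then show ?thesis by (simp add: fun_eq_iff)
qed

text \<open>
  A ray from \<open>Idm\<close> in the direction of a point \<open>x\<close> of the unit sphere is followed until its last diagonal entry
  vanishes, at parameter \<open>rr x\<close>, or until it is far away, at parameter \<open>T\<close>. As \<open>Idm\<close> is the only zero met,
  the normalized value at the end point is homotopic to \<open>x\<close>. On the other hand it does not change when
  the other entries in the last column of \<open>x\<close> change sign, hence it has even degree.
\<close>

theorem contradiction: False
proof -
  obtain e where e: "e \<in> B" "\<phi> e > 0" "generic_dir e"
    using generic_direction unfolding generic_dir_def by blast
  obtain R0 where R0: "R0 > 0" "\<And>V. center_dist_sq V > R0 \<Longrightarrow> \<phi> (defect e V) > 0" using defect_coercive[OF e(2)] by blast
  \<comment> \<open>\<open>R0\<close> makes \<open>\<phi>\<close> positive on \<open>defect\<close>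
    beyond \<open>R\<close>. The term \<open>4 * card I\<close> keeps the unit ball around
    \<open>Idm\<close> below the cutoff, since each entry there is within 2 of the centre.\<close>
  define R where "R = R0 + 4 * card I + 1"
  have R: "R > 0" "R \<ge> 1" "R \<ge> 4 * card I" "\<And>V. center_dist_sq V > R \<Longrightarrow> \<phi> (defect e V) > 0"
    using R0 by (auto simp: R_def)
  define k0 where "k0 = (d - 1, d - 1)"
  define k1 where "k1 = (d, d - 1)"
  have k01: "k0 \<in> I" "k1 \<in> I" "k0 \<noteq> k1" using d by (auto simp: k0_def k1_def mem_I)
  define p where "p = card I - 1"
  have "card {k0, k1} \<le> card I" using k01 by (intro card_mono finite_I) auto
  then have cI: "card I = Suc p" and p: "p \<ge> 1" using k01 by (auto simp: p_def)
  \<comment> \<open>The entry \<open>k1\<close> below the last diagonal entry gets the number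
    \<open>p\<close>, the coordinate whose vanishing defines the equator.\<close>
  obtain \<kappa> where \<kappa>: "bij_betw \<kappa> I {..p}" "\<kappa> k1 = p"
  proof -
    have "card (I - {k1}) = card {..<p}" using k01 cI finite_I by simp
    then obtain h where h: "bij_betw h (I - {k1}) {..<p}"
      using bij_betw_iff_card finite_I by (metis finite_Diff finite_lessThan)
    have "bij_betw (h(k1 := p)) (I - {k1}) {..<p}"
      using h by (subst bij_betw_cong[of _ _ h]) auto
    then have "bij_betw (h(k1 := p)) (I - {k1} \<union> {k1}) ({..<p} \<union> {(h(k1 := p)) k1})"
      by (intro notIn_Un_bij_betw) auto
    then have "bij_betw (h(k1 := p)) (insert k1 (I - {k1})) (insert p {..<p})" by simp
    then show ?thesis using that[of "h(k1 := p)"] k01 by (simp add: insert_absorb lessThan_Suc_atMost flip: lessThan_Suc)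
  qed
  define \<iota> where "\<iota> = the_inv_into I \<kappa>"
  have \<iota>: "\<iota> i \<in> I" "\<kappa> (\<iota> i) = i" if "i \<le> p" for i
    using \<kappa>(1) that by (auto simp: \<iota>_def bij_betw_def intro!: the_inv_into_into f_the_inv_into_f)
  have \<kappa>p: "\<kappa> k \<le> p" "\<iota> (\<kappa> k) = k" if "k \<in> I" for k
    using \<kappa>(1) that by (auto simp: \<iota>_def bij_betw_def the_inv_into_f_f)
  define mat where "mat = (\<lambda>(x::nat\<Rightarrow>real) i j. if (i, j) \<in> I then x (\<kappa> (i, j)) else 0)"
  define P where "P = (\<lambda>r x i j. Idm i j + r * mat x i j)"
  define S where "S = topspace (nsphere p)"
  have supp_mat: "supp (mat x)" for x by (simp add: supp_def mat_def)
  have supp_P: "supp (P r x)" for r x using supp_mat[of x] supp_Idm by (simp add: supp_def P_def)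
  have S_le1: "\<bar>x k\<bar> \<le> 1" if "x \<in> S" for x k
    using topspace_nsphere_1[of x p k] that by (simp add: S_def abs_square_le_1)
  have mat_le1: "\<bar>mat x i j\<bar> \<le> 1" if "x \<in> S" for x i j
    using S_le1[OF that] by (simp add: mat_def)
  have mat_nz: "\<exists>i j. mat x i j \<noteq> 0" if "x \<in> S" for x
  proof -
    have "(\<Sum>i\<le>p. (x i)\<^sup>2) = 1" using that by (simp add: S_def topspace_nsphere)
    then obtain i where "i \<le> p" "x i \<noteq> 0" by (metis (mono_tags, lifting) atMost_iff power_zero_numeral sum.neutral zero_neq_one)
    then have "mat x (fst (\<iota> i)) (snd (\<iota> i)) \<noteq> 0" using \<iota>[of i] by (simp add: mat_def)
    then show ?thesis by blast
  qed
  have P_Idm: "r = 0" if "x \<in> S" "P r x = Idm" for r x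
    using mat_nz[OF that(1)] that(2) by (auto simp: P_def fun_eq_iff)
  have zero_B: "y = 0" if "y \<in> B" "\<And>i. i \<le> p \<Longrightarrow> \<alpha> (\<iota> i) y = 0" for y
  proof -
    have "\<alpha> k y = 0" if "k \<in> I" for k using \<open>\<And>i. i \<le> p \<Longrightarrow> \<alpha> (\<iota> i) y = 0\<close>[of "\<kappa> k"] \<kappa>p[OF that] by simp
    then show ?thesis using B_expand[OF \<open>y \<in> B\<close>] by simp
  qed
  have \<theta>: "0 \<le> cutoff R V" "cutoff R V \<le> 1" for V by (auto simp: cutoff_def)
  \<comment> \<open>Beyond \<open>R\<close> both \<open>defect\<close> and \<open>e\<close> are
    positive under \<open>\<phi>\<close>, hence so is their convex combination. Within
    \<open>R\<close> the cutoff vanishes and \<open>defect_zero\<close> leaves only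
    \<open>Idm\<close>.\<close>
  have ft_nz: "cut_defect R e (P r x) \<noteq> 0" if x: "x \<in> S" and r: "r > 0" and ge: "1 + r * mat x (d - 1) (d - 1) \<ge> 0" for r x
  proof (cases "center_dist_sq (P r x) > R")
    case True
    have "\<phi> (cut_defect R e (P r x)) = (1 - cutoff R (P r x)) * \<phi> (defect e (P r x)) + cutoff R (P r x) * \<phi> e"
      by (simp add: cut_defect_def linear_add[OF lin_\<phi>] linear_scale[OF lin_\<phi>])
    moreover have "\<dots> > 0"
      using R(4)[OF True] e(2) \<theta>[of "P r x"]
      by (cases "cutoff R (P r x) = 0") (auto intro: add_nonneg_pos)
    ultimately show ?thesis using linear_0[OF lin_\<phi>] by auto
  next
    case False
    then have "cutoff R (P r x) = 0" using R by (simp add: cutoff_def field_simps)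
    then have "cut_defect R e (P r x) = defect e (P r x)" by (simp add: cut_defect_def)
    moreover have "P r x (d - 1) (d - 1) \<ge> 0" using ge d by (simp add: P_def Idm_def)
    ultimately show ?thesis
      using defect_zero[OF e(3) supp_P, of r x] P_Idm[OF x, of r] r by auto
  qed
  have ft_small: "cut_defect R e (P r x) = f (P r x) - b" if x: "x \<in> S" and r: "0 \<le> r" "r \<le> 1" for r x
  proof -
    have rm: "\<bar>r * mat x i j\<bar> \<le> 1" for i j
      using mult_mono[of r 1 "\<bar>mat x i j\<bar>" 1] mat_le1[OF x, of i j] r by (simp add: abs_mult)
    have "P r x i i \<ge> 0" if "Suc i < d" for i
      using rm[of i i] that by (simp add: P_def Idm_def)
    then have "clamp_diag (P r x) = P r x" "slack (P r x) = 0" by (auto simp: slack_eq_0_iff clamp_diag_id)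
    moreover have "center_dist_sq (P r x) \<le> (\<Sum>k\<in>I. 4)"
      unfolding center_dist_sq_def
    proof (rule sum_mono, clarify)
      fix i j
      have "\<bar>P r x i j - (if i = j \<and> Suc i < d then 1 else 0)\<bar> \<le> 2"
        using rm[of i j] by (auto simp: P_def Idm_def)
      then show "(P r x i j - (if i = j \<and> Suc i < d then 1 else 0))\<^sup>2 \<le> 4"
        using power_mono[of "\<bar>P r x i j - (if i = j \<and> Suc i < d then 1 else 0)\<bar>" 2 2] by simp
    qed
    then have "center_dist_sq (P r x) \<le> R" using R by simp
    then have "cutoff R (P r x) = 0" using R by (simp add: cutoff_def field_simps)
    ultimately show ?thesis by (simp add: cut_defect_def defect_def)
  qed
  have \<alpha>_near: "\<alpha> (\<iota> i) (f (P r x) - b) = 2 * r * x i + r\<^sup>2 * \<alpha> (\<iota> i) (f (mat x))" if i: "i \<le> p" for r x i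
  proof -
    have "f (P r x) - b = (2 * r) *\<^sub>R (\<Sum>k\<in>I. x (\<kappa> k) *\<^sub>R L k) + r\<^sup>2 *\<^sub>R f (mat x)"
      using f_near[OF supp_mat, of r x] by (simp add: P_def mat_def case_prod_unfold)
    then show ?thesis
      using \<iota>[OF i] by (simp add: linear_add linear_scale linear_\<alpha> \<alpha>_sum)
  qed
  \<comment> \<open>If the direction has entry \<open>m > - 1 / T\<close> at \<open>k0\<close>, the
    squared distance from the centre at parameter \<open>T\<close> is
    \<open>T\<^sup>2 + 1 + 2 * T * m\<close>. It exceeds \<open>T\<^sup>2 - 1 \<ge> 2 * R\<close>,
    where the cutoff is 1.\<close>
  define T where "T = 2 * R + 2"
  have T: "T \<ge> 4" using R by (simp add: T_def)
  \<comment> \<open>The last diagonal entry along the ray is \<open>1 + r * m\<close>, which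
    vanishes at \<open>r = - 1 / m\<close>. The maximum caps this parameter at \<open>T\<close>
    continuously and covers \<open>m \<ge> 0\<close> as well.\<close>
  define rr where "rr = (\<lambda>x. 1 / max (1 / T) (- mat x (d - 1) (d - 1)))"
  have rr: "rr x \<ge> 1" "1 + rr x * mat x (d - 1) (d - 1) \<ge> 0" if "x \<in> S" for x
  proof -
    have m: "max (1 / T) (- mat x (d - 1) (d - 1)) \<le> 1" "max (1 / T) (- mat x (d - 1) (d - 1)) > 0"
      using T mat_le1[OF that, of "d-1" "d-1"] by (auto simp: less_max_iff_disj)
    then show "rr x \<ge> 1" by (simp add: rr_def)
    have "- mat x (d - 1) (d - 1) \<le> max (1 / T) (- mat x (d - 1) (d - 1))" by simp
    then show "1 + rr x * mat x (d - 1) (d - 1) \<ge> 0"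
      unfolding rr_def using m by (simp add: field_simps)
  qed
  \<comment> \<open>By \<open>\<alpha>_near\<close>, \<open>H1 t x\<close> lists the coordinates of
    \<open>f (P t x) - b\<close> divided by \<open>2 * t\<close>. In this form it extends to
    \<open>t = 0\<close>, where it is \<open>x\<close>. From parameter 1 to \<open>rr x\<close> the
    homotopy continues with \<open>H2\<close>; at the junction the two differ by the factor
    2.\<close>
  define H1 where "H1 = (\<lambda>t x i. x i + t / 2 * \<alpha> (\<iota> i) (f (mat x)))"
  define H2 where "H2 = (\<lambda>t x i. \<alpha> (\<iota> i) (cut_defect R e (P ((1 - t) + t * rr x) x)))"
  have cont_coord: "continuous_on A (\<lambda>z::real \<times> (nat \<Rightarrow> real). snd z k)" for A k
    by (rule continuous_on_compose2[OF continuous_on_product_coordinates continuous_on_snd]) (auto intro: continuous_intros)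
  have cont_mat: "continuous_on A (\<lambda>z::real \<times> (nat \<Rightarrow> real). mat (snd z) i j)" for A i j
    unfolding mat_def by (cases "(i, j) \<in> I") (auto intro: cont_coord)
  have cont_\<alpha>: "continuous_on A (\<lambda>z. \<alpha> (\<iota> i) (g z))" if "i \<le> p" "continuous_on A g" for A i and g :: "real \<times> (nat \<Rightarrow> real) \<Rightarrow> 'b"
    using linear_\<alpha>[OF \<iota>(1)[OF that(1)]] that(2)
    by (simp add: linear_conv_bounded_linear bounded_linear.continuous_on)
  have hom1: "homotopic_with (\<lambda>_. True) (nsphere p) (nsphere p) (\<lambda>x. sphere_proj p (H1 0 x)) (\<lambda>x. sphere_proj p (H1 1 x))"
  proof (rule nsphere_homotopic_sphere_proj)
    show "continuous_on ({0..1} \<times> topspace (nsphere p)) (\<lambda>(t, x). H1 t x i)" if "i \<le> p" for i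
      unfolding H1_def case_prod_unfold
      by (intro continuous_intros cont_coord cont_\<alpha> that continuous_on_f cont_mat) auto
    fix t x assume t: "t \<in> {0..1::real}" and x: "x \<in> topspace (nsphere p)"
    then have xS: "x \<in> S" by (simp add: S_def)
    show "\<exists>i\<le>p. H1 t x i \<noteq> 0"
    proof (cases "t = 0")
      case True
      then show ?thesis
        using mat_nz[OF xS] \<kappa>p by (auto simp: H1_def mat_def split: if_splits)
    next
      case False
      show ?thesis
      proof (rule ccontr)
        assume "\<not> ?thesis"
        then have H0: "H1 t x i = 0" if "i \<le> p" for i using that by blast
        have "\<alpha> (\<iota> i) (f (P t x) - b) = 2 * t * H1 t x i" if "i \<le> p" for i
          using \<alpha>_near[OF that, of t x] by (simp add: H1_def power2_eq_square algebra_simps)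
        then have "\<alpha> (\<iota> i) (f (P t x) - b) = 0" if "i \<le> p" for i
          using H0[OF that] that by simp
        then have "f (P t x) - b = 0"
          by (intro zero_B subspace_diff subspace_B f_in_B b_in_B)
        moreover have "1 + t * mat x (d - 1) (d - 1) \<ge> 0"
        proof -
          have "- 1 \<le> mat x (d - 1) (d - 1)" using mat_le1[OF xS, of "d - 1" "d - 1"] by linarith
          then have "t * (- 1) \<le> t * mat x (d - 1) (d - 1)" using t by (intro mult_left_mono) auto
          then show ?thesis using t by auto
        qed
        ultimately show False using ft_nz[OF xS, of t] ft_small[OF xS, of t] t False by auto
      qed
    qed
  qed
  have hom2: "homotopic_with (\<lambda>_. True) (nsphere p) (nsphere p) (\<lambda>x. sphere_proj p (H2 0 x)) (\<lambda>x. sphere_proj p (H2 1 x))"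
  proof (rule nsphere_homotopic_sphere_proj)
    have "continuous_on A (\<lambda>z::real \<times> (nat \<Rightarrow> real). rr (snd z))" for A
      unfolding rr_def using T by (intro continuous_intros cont_mat) (auto simp: max_def)
    then show "continuous_on ({0..1} \<times> topspace (nsphere p)) (\<lambda>(t, x). H2 t x i)" if "i \<le> p" for i
      unfolding H2_def case_prod_unfold P_def
      using R by (intro cont_\<alpha> that continuous_on_cut_defect continuous_intros cont_mat) auto
    fix t x assume t: "t \<in> {0..1::real}" and x: "x \<in> topspace (nsphere p)"
    then have xS: "x \<in> S" by (simp add: S_def)
    define r where "r = (1 - t) + t * rr x"
    have r1: "1 \<le> r" "r \<le> rr x"
      using t rr(1)[OF xS] mult_left_mono[of 1 "rr x" t] mult_right_mono[of 1 "rr x" "1 - t"]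
      by (auto simp: r_def algebra_simps)
    have "1 + r * mat x (d - 1) (d - 1) \<ge> 0"
    proof (cases "mat x (d - 1) (d - 1) \<ge> 0")
      case False
      then have "rr x * mat x (d - 1) (d - 1) \<le> r * mat x (d - 1) (d - 1)"
        using r1 by (intro mult_right_mono_neg) auto
      then show ?thesis using rr(2)[OF xS] by linarith
    qed (use r1 in simp)
    then have "cut_defect R e (P r x) \<noteq> 0" using ft_nz[OF xS] r1 by simp
    then show "\<exists>i\<le>p. H2 t x i \<noteq> 0"
      unfolding H2_def r_def[symmetric] using zero_B[OF cut_defect_in_B[OF e(1)], of R "P r x"] by blast
  qed
  have "sphere_proj p (H2 0 x) = sphere_proj p (H1 1 x)" if "x \<in> topspace (nsphere p)" for x
  proof -
    have "sphere_proj p (H2 0 x) = sphere_proj p (\<lambda>i. 2 * H1 1 x i)"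
    proof -
      have e: "H2 0 x i = 2 * H1 1 x i" if "i \<le> p" for i
        using ft_small[of x 1] \<open>x \<in> topspace (nsphere p)\<close> \<alpha>_near[OF that, of 1 x]
        by (simp add: H2_def H1_def S_def)
      then have "(\<Sum>j\<le>p. (H2 0 x j)\<^sup>2) = (\<Sum>j\<le>p. (2 * H1 1 x j)\<^sup>2)" by (intro sum.cong) auto
      then show ?thesis using e by (simp add: sphere_proj_def fun_eq_iff)
    qed
    then show ?thesis by (simp add: sphere_proj_scale)
  qed
  then have "homotopic_with (\<lambda>_. True) (nsphere p) (nsphere p) (\<lambda>x. sphere_proj p (H1 1 x)) (\<lambda>x. sphere_proj p (H2 1 x))"
    by (intro homotopic_with_eq[OF hom2]) auto
  then have "homotopic_with (\<lambda>_. True) (nsphere p) (nsphere p) (\<lambda>x. sphere_proj p (H1 0 x)) (\<lambda>x. sphere_proj p (H2 1 x))"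
    using hom1 homotopic_with_trans by blast
  then have hom: "homotopic_with (\<lambda>_. True) (nsphere p) (nsphere p) id (\<lambda>x. sphere_proj p (H2 1 x))"
    by (rule homotopic_with_eq) (auto simp: H1_def sphere_proj_id)
  \<comment> \<open>The entry \<open>k0\<close> is left out of \<open>J\<close> because
    \<open>rr\<close> depends on it; its sign does not matter where the ray ends on the
    hyperplane.\<close>
  define J where "J = {\<kappa> (i, d - 1) |i. d \<le> i \<and> i < n}"
  have far: "cut_defect R e (P (rr x) x) = e" if x: "x \<in> S" and lt: "- mat x (d - 1) (d - 1) < 1 / T" for x
  proof -
    have rT: "rr x = T" using lt by (simp add: rr_def max_def)
    have k: "(\<Sum>k\<in>I. (x (\<kappa> k))\<^sup>2) = 1"
    proof -
      have "(\<Sum>k\<in>I. (x (\<kappa> k))\<^sup>2) = (\<Sum>i\<le>p. (x i)\<^sup>2)"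
        by (rule sum.reindex_bij_betw[OF \<kappa>(1)])
      then show ?thesis using x by (simp add: S_def topspace_nsphere)
    qed
    let ?m = "mat x (d - 1) (d - 1)"
    have mk: "?m = x (\<kappa> k0)" using k01 by (simp add: mat_def k0_def)
    have "center_dist_sq (P T x) = (\<Sum>k\<in>I. ((if k = k0 then 1 else 0) + T * x (\<kappa> k))\<^sup>2)"
      unfolding center_dist_sq_def
    proof (intro sum.cong refl, clarify)
      fix a c assume ac: "(a, c) \<in> I"
      have "(if a = c \<and> a < d then 1 else 0) = (if a = c \<and> Suc a < d then 1 else 0) + (if (a, c) = k0 then 1 else (0::real))"
        using d unfolding k0_def by (cases "Suc a < d") auto
      then show "(P T x a c - (if a = c \<and> Suc a < d then 1 else 0))\<^sup>2
          = ((if (a, c) = k0 then 1 else 0) + T * x (\<kappa> (a, c)))\<^sup>2"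
        using ac by (simp add: P_def Idm_def mat_def)
    qed
    also have "\<dots> = (\<Sum>k\<in>I. T\<^sup>2 * (x (\<kappa> k))\<^sup>2 + (if k = k0 then 1 + 2 * T * x (\<kappa> k) else 0))"
      by (intro sum.cong) (auto simp: power2_eq_square algebra_simps)
    also have "\<dots> = T\<^sup>2 + (1 + 2 * T * ?m)"
      using k01 finite_I k by (simp add: sum.distrib flip: sum_distrib_left mk)
    finally have nT: "center_dist_sq (P T x) = T\<^sup>2 + (1 + 2 * T * ?m)" .
    have "T * ?m > -1" using lt T by (simp add: field_simps)
    then have "center_dist_sq (P T x) \<ge> T * T - 1" using nT by (simp add: power2_eq_square)
    moreover have "T * T \<ge> 4 * T" using T by (intro mult_right_mono) auto
    ultimately have "center_dist_sq (P T x) \<ge> 2 * R" using T by (simp add: T_def)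
    then have "cutoff R (P T x) = 1" using R by (simp add: cutoff_def field_simps)
    then show ?thesis by (simp add: cut_defect_def rT)
  qed
  have on_wall: "P (rr x) x (d - 1) (d - 1) = 0" if "\<not> - mat x (d - 1) (d - 1) < 1 / T" for x
  proof -
    have "rr x = 1 / (- mat x (d - 1) (d - 1))" using that by (simp add: rr_def max_def)
    moreover have "mat x (d - 1) (d - 1) \<noteq> 0" using that T by auto
    ultimately show ?thesis using d by (simp add: P_def Idm_def)
  qed
  show False
  proof (rule nsphere_even_map_not_homotopic_id[OF _ p hom, of J "\<lambda>i. \<alpha> (\<iota> i) e"])
    show "p \<in> J" using \<kappa>(2) d by (auto simp: J_def k1_def)
    have "e \<noteq> 0" using e(2) linear_0[OF lin_\<phi>] by auto
    then show "\<exists>i\<le>p. \<alpha> (\<iota> i) e \<noteq> 0" using zero_B[OF e(1)] by blast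
  next
    fix x i assume x: "x \<in> topspace (nsphere p)" and i: "i \<le> p"
    let ?y = "\<lambda>i. if i \<in> J then - x i else x i"
    have J: "\<kappa> (i, j) \<in> J \<longleftrightarrow> j = d - 1 \<and> d \<le> i" if "(i, j) \<in> I" for i j
    proof
      assume "\<kappa> (i, j) \<in> J"
      then obtain i' where i': "\<kappa> (i, j) = \<kappa> (i', d - 1)" "d \<le> i'" "i' < n" by (auto simp: J_def)
      moreover have "(i', d - 1) \<in> I" using i' d by (simp add: mem_I)
      ultimately show "j = d - 1 \<and> d \<le> i" using \<kappa>(1) that by (auto simp: bij_betw_def inj_on_eq_iff)
    qed (use that in \<open>auto simp: J_def mem_I\<close>)
    have my: "mat ?y i j = (if j = d - 1 \<and> d \<le> i then - mat x i j else mat x i j)" for i j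
      by (simp add: mat_def J)
    have yS: "?y \<in> S"
    proof -
      have "(?y i)\<^sup>2 = (x i)\<^sup>2" for i by simp
      then show ?thesis using x by (auto simp: S_def topspace_nsphere simp del: power2_minus)
    qed
    have m0: "mat ?y (d - 1) (d - 1) = mat x (d - 1) (d - 1)" using d by (simp add: my)
    then have rry: "rr ?y = rr x" by (simp add: rr_def)
    have "cut_defect R e (P (rr ?y) ?y) = cut_defect R e (P (rr x) x)"
    proof (cases "- mat x (d - 1) (d - 1) < 1 / T")
      case True
      then show ?thesis using far[of x] far[OF yS] x m0 by (simp add: S_def)
    next
      case False
      \<comment> \<open>At the end point the entry \<open>k0\<close> is zero, so changing the signs
        in \<open>J\<close> amounts to changing the sign of the entire last column.\<close>
      have "P (rr ?y) ?y = flip_col (P (rr x) x)"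
      proof (intro ext)
        fix i j
        consider "j \<noteq> d - 1" | "j = d - 1" "i < d - 1" | "j = d - 1" "i = d - 1" | "j = d - 1" "d \<le> i"
          by linarith
        then show "P (rr ?y) ?y i j = flip_col (P (rr x) x) i j"
        proof cases
          case 2
          then show ?thesis using supp_P by (simp add: flip_col_def supp_def mem_I)
        next
          case 3
          then show ?thesis using on_wall[OF False] on_wall[of ?y] False m0 by (simp add: flip_col_def)
        qed (auto simp: flip_col_def rry P_def my Idm_def)
      qed
      then show ?thesis by (simp add: cut_defect_flip_col)
    qed
    then show "H2 1 ?y i = H2 1 x i" by (simp add: H2_def)
  next
    fix x and \<mu> :: real assume x: "x \<in> topspace (nsphere p)" and xp: "x p = 0" and \<mu>: "\<mu> \<ge> 0"
    show "\<exists>i\<le>p. H2 1 x i \<noteq> - \<mu> * \<alpha> (\<iota> i) e"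
    proof (rule ccontr)
      assume neg: "\<not> ?thesis"
      let ?V = "P (rr x) x"
      have "cut_defect R e ?V + \<mu> *\<^sub>R e = 0"
      proof (rule zero_B)
        show "cut_defect R e ?V + \<mu> *\<^sub>R e \<in> B" by (intro subspace_add subspace_scale subspace_B cut_defect_in_B e(1))
        show "\<alpha> (\<iota> i) (cut_defect R e ?V + \<mu> *\<^sub>R e) = 0" if "i \<le> p" for i
          using neg that \<iota>[OF that] by (auto simp: H2_def linear_add linear_scale linear_\<alpha>)
      qed
      then have cut_defect: "cut_defect R e ?V = - \<mu> *\<^sub>R e" by (simp add: eq_neg_iff_add_eq_0)
      have e0: "e \<noteq> 0" using e(2) linear_0[OF lin_\<phi>] by auto
      show False
      proof (cases "- mat x (d - 1) (d - 1) < 1 / T")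
        case True
        have "e = - \<mu> *\<^sub>R e" using far[of x] True x cut_defect by (simp add: S_def)
        then have "(1 + \<mu>) *\<^sub>R e = 0" unfolding scaleR_add_left by (metis eq_neg_iff_add_eq_0 scaleR_minus_left scaleR_one)
        then show False using e0 \<mu> by simp
      next
        case False
        let ?t = "cutoff R ?V"
        have eq: "(1 - ?t) *\<^sub>R defect e ?V = - (\<mu> + ?t) *\<^sub>R e"
          using cut_defect by (simp add: cut_defect_def algebra_simps eq_neg_iff_add_eq_0)
        show False
        proof (cases "?t = 1")
          case True
          then show False using eq e0 \<mu> by simp
        next
          case t1: False
          have "defect e ?V = (1 / (1 - ?t)) *\<^sub>R ((1 - ?t) *\<^sub>R defect e ?V)" using t1 by simp
          also have "\<dots> = (- (\<mu> + ?t) / (1 - ?t)) *\<^sub>R e" by (simp only: eq scaleR_scaleR times_divide_eq_left mult_1)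
          finally have fhe: "defect e ?V = (- (\<mu> + ?t) / (1 - ?t)) *\<^sub>R e" .
          \<comment> \<open>On the equator the entry \<open>k1\<close> vanishes together with
            \<open>k0\<close>, which is the second alternative of
            \<open>defect_avoids_line\<close>.\<close>
          have "?V d (d - 1) = 0"
            using xp \<kappa>(2) k01 by (simp add: P_def Idm_def mat_def k1_def)
          then show False
            using defect_avoids_line[OF e(3) supp_P fhe] on_wall[OF False] by blast
        qed
      qed
    qed
  qed
qed

end

section \<open>Rational polynomials at generic points\<close>

text \<open>A closure under operations lets polynomial dependence of determinants and matrix
  products follow from introduction rules. The link to coefficient maps is made once, in
  \<open>ratpoly_representable\<close>.\<close>

inductive ratpoly :: "(('i \<Rightarrow> real) \<Rightarrow> real) \<Rightarrow> bool" where
  ratpoly_const: "ratpoly (\<lambda>x. of_rat q)"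
| ratpoly_var: "ratpoly (\<lambda>x. x i)"
| ratpoly_add: "ratpoly g \<Longrightarrow> ratpoly h \<Longrightarrow> ratpoly (\<lambda>x. g x + h x)"
| ratpoly_mult: "ratpoly g \<Longrightarrow> ratpoly h \<Longrightarrow> ratpoly (\<lambda>x. g x * h x)"

lemma ratpoly_0: "ratpoly (\<lambda>x. 0)" and ratpoly_1: "ratpoly (\<lambda>x. 1)"
  and ratpoly_minus1: "ratpoly (\<lambda>x. - 1)"
  using ratpoly_const[of 0] ratpoly_const[of 1] ratpoly_const[of "-1"] by (simp_all add: of_rat_minus)

lemma ratpoly_uminus: "ratpoly g \<Longrightarrow> ratpoly (\<lambda>x. - g x)"
  using ratpoly_mult[OF ratpoly_minus1, of g] by simp

lemma ratpoly_diff: "ratpoly g \<Longrightarrow> ratpoly h \<Longrightarrow> ratpoly (\<lambda>x. g x - h x)"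
  using ratpoly_add[OF _ ratpoly_uminus, of g h] by simp

lemma ratpoly_sum: "(\<And>a. a \<in> A \<Longrightarrow> ratpoly (g a)) \<Longrightarrow> ratpoly (\<lambda>x. \<Sum>a\<in>A. g a x)"
  by (induction A rule: infinite_finite_induct) (auto intro: ratpoly_0 ratpoly_add)

lemma ratpoly_prod: "(\<And>a. a \<in> A \<Longrightarrow> ratpoly (g a)) \<Longrightarrow> ratpoly (\<lambda>x. \<Prod>a\<in>A. g a x)"
  by (induction A rule: infinite_finite_induct) (auto intro: ratpoly_1 ratpoly_mult)

lemma ratpoly_if: "ratpoly g \<Longrightarrow> ratpoly h \<Longrightarrow> ratpoly (\<lambda>x. if P then g x else h x)"
  by (cases P) simp_all

lemma ratpoly_det:
  fixes M :: "('i \<Rightarrow> real) \<Rightarrow> real ^ 'n ^ 'n"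
  assumes "\<And>i j. ratpoly (\<lambda>x. M x $ i $ j)"
  shows "ratpoly (\<lambda>x. det (M x))"
proof -
  have "ratpoly (\<lambda>x. of_int k)" for k :: int
    using ratpoly_const[of "of_int k"] by simp
  then show ?thesis
    unfolding det_def by (intro ratpoly_sum ratpoly_mult ratpoly_prod assms)
qed

definition monomial_val :: "('i \<Rightarrow>\<^sub>0 nat) \<Rightarrow> ('i \<Rightarrow> real) \<Rightarrow> real" where
  "monomial_val m x = (\<Prod>i\<in>Poly_Mapping.keys m. x i ^ Poly_Mapping.lookup m i)"

lemma monomial_val_superset:
  assumes "finite A" "Poly_Mapping.keys m \<subseteq> A"
  shows "monomial_val m x = (\<Prod>i\<in>A. x i ^ Poly_Mapping.lookup m i)"
  unfolding monomial_val_def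
  by (rule prod.mono_neutral_left) (use assms in \<open>auto simp: in_keys_iff\<close>)

lemma monomial_val_add: "monomial_val (m + m') x = monomial_val m x * monomial_val m' x"
proof -
  let ?A = "Poly_Mapping.keys m \<union> Poly_Mapping.keys m'"
  have "Poly_Mapping.keys (m + m') \<subseteq> ?A" by (rule Poly_Mapping.keys_add)
  then show ?thesis
    by (simp add: monomial_val_superset[of ?A] lookup_add power_add prod.distrib)
qed

lemma eval_rat_poly_superset:
  assumes "finite A" "Poly_Mapping.keys p \<subseteq> A"
  shows "eval_rat_poly p x = (\<Sum>m\<in>A. of_rat (Poly_Mapping.lookup p m) * monomial_val m x)"
  unfolding eval_rat_poly_def monomial_val_def
  by (rule sum.mono_neutral_left) (use assms in \<open>auto simp: in_keys_iff\<close>)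

lemma eval_rat_poly_add: "eval_rat_poly (p + q) x = eval_rat_poly p x + eval_rat_poly q x"
proof -
  let ?A = "Poly_Mapping.keys p \<union> Poly_Mapping.keys q"
  have "Poly_Mapping.keys (p + q) \<subseteq> ?A" by (rule Poly_Mapping.keys_add)
  then show ?thesis
    by (simp add: eval_rat_poly_superset[of ?A] lookup_add of_rat_add distrib_right sum.distrib)
qed

lemma eval_rat_poly_0: "eval_rat_poly 0 x = 0"
  by (simp add: eval_rat_poly_def)

lemma eval_rat_poly_sum: "eval_rat_poly (sum P A) x = (\<Sum>a\<in>A. eval_rat_poly (P a) x)"
  by (induction A rule: infinite_finite_induct) (simp_all add: eval_rat_poly_0 eval_rat_poly_add)

lemma eval_rat_poly_single: "eval_rat_poly (Poly_Mapping.single m c) x = of_rat c * monomial_val m x"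
  by (subst eval_rat_poly_superset[of "{m}"]) auto

lemma ratpoly_representable: "ratpoly g \<Longrightarrow> \<exists>p. \<forall>x. eval_rat_poly p x = g x"
proof (induction rule: ratpoly.induct)
  case (ratpoly_const q)
  show ?case
    by (intro exI[of _ "Poly_Mapping.single 0 q"]) (simp add: eval_rat_poly_single monomial_val_def)
next
  case (ratpoly_var i)
  show ?case
    by (intro exI[of _ "Poly_Mapping.single (Poly_Mapping.single i 1) 1"])
       (simp add: eval_rat_poly_single monomial_val_def)
next
  case (ratpoly_add g h)
  then show ?case by (metis eval_rat_poly_add)
next
  case (ratpoly_mult g h)
  then obtain p q where p: "\<And>x. eval_rat_poly p x = g x" and q: "\<And>x. eval_rat_poly q x = h x" by metis
  let ?r = "\<Sum>m\<in>Poly_Mapping.keys p. \<Sum>m'\<in>Poly_Mapping.keys q.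
     Poly_Mapping.single (m + m') (Poly_Mapping.lookup p m * Poly_Mapping.lookup q m')"
  have "eval_rat_poly ?r x = eval_rat_poly p x * eval_rat_poly q x" for x
  proof -
    have "eval_rat_poly ?r x = (\<Sum>m\<in>Poly_Mapping.keys p. \<Sum>m'\<in>Poly_Mapping.keys q.
        (of_rat (Poly_Mapping.lookup p m) * monomial_val m x) *
        (of_rat (Poly_Mapping.lookup q m') * monomial_val m' x))"
      by (simp add: eval_rat_poly_sum eval_rat_poly_single monomial_val_add of_rat_mult ac_simps)
    also have "\<dots> = eval_rat_poly p x * eval_rat_poly q x"
      by (simp only: sum_product eval_rat_poly_def monomial_val_def)
    finally show ?thesis .
  qed
  then show ?case using p q by (intro exI[of _ ?r]) simp
qed

text \<open>Mostly applied contrapositively: a nonzero value at a convenient point \<open>x\<close>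
  forces a nonzero value at the generic framework.\<close>

lemma generic_ratpoly_eq_0:
  assumes "generic \<rho>" "ratpoly g" "g (\<lambda>(u, i). \<rho> $ u $ i) = 0"
  shows "g x = 0"
proof -
  obtain p where p: "\<And>x. eval_rat_poly p x = g x" using ratpoly_representable[OF assms(2)] by blast
  then have "p = 0" using assms(1,3) by (auto simp: generic_def)
  then show ?thesis using p[of x] by (simp add: eval_rat_poly_0)
qed

section \<open>Kernels of matrices with rational polynomial entries\<close>

text \<open>
  If \<open>S\<close> is a set of free coordinates for the kernel of \<open>A\<close>, then \<open>transpose A ** A + coord_proj S\<close> is
  invertible, and its inverse maps the range of \<open>coord_proj S\<close> onto the kernel of \<open>A\<close>. This parametrizes
  kernels by rational functions of the entries of \<open>A\<close>.
\<close>

definition coord_proj :: "'n set \<Rightarrow> real ^ 'n ^ 'n" where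
  "coord_proj S = (\<chi> i j. if i = j \<and> i \<in> S then 1 else 0)"

lemma coord_proj_vec [simp]: "(coord_proj S *v x) $ i = (if i \<in> S then x $ i else 0)"
  by (simp add: coord_proj_def matrix_vector_mult_def if_distrib[of "\<lambda>y. y * _"] cong: if_cong)

lemma dim_coordinate_subspace: "dim {x :: real ^ 'n. \<forall>i. i \<notin> S \<longrightarrow> x $ i = 0} = card S"
proof -
  let ?D = "(\<lambda>i. axis i (1::real)) ` S"
  have eq: "{x :: real ^ 'n. \<forall>i. i \<notin> S \<longrightarrow> x $ i = 0} = {x. \<forall>i\<in>Basis. i \<notin> ?D \<longrightarrow> x \<bullet> i = 0}"
    by (auto simp: Basis_vec_def inner_axis axis_eq_axis)
  have D: "?D \<subseteq> Basis" by (auto simp: Basis_vec_def)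
  have "dim {x :: real ^ 'n. \<forall>i. i \<notin> S \<longrightarrow> x $ i = 0} = card ?D"
    unfolding eq by (rule dim_substandard[OF D])
  then show ?thesis by (simp add: card_image inj_on_def axis_eq_axis)
qed

lemma subspace_coordinate: "subspace {x :: real ^ 'n. \<forall>i. i \<notin> S \<longrightarrow> x $ i = 0}"
  by (auto simp: subspace_def)

lemma coordinate_chart_exists:
  fixes V :: "(real ^ 'n) set"
  assumes V: "subspace V"
  shows "\<exists>S. card S = dim V \<and> (\<forall>x\<in>V. (\<forall>i\<in>S. x $ i = 0) \<longrightarrow> x = 0)"
proof -
  obtain B where B: "B \<subseteq> V" "independent B" "V \<subseteq> span B" "card B = dim V" using basis_exists by blast
  have "B \<subseteq> B \<union> Basis" by simp
  then obtain C where C: "B \<subseteq> C" "C \<subseteq> B \<union> Basis" "independent C" "B \<union> Basis \<subseteq> span C"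
    using maximal_independent_subset_extend[OF _ B(2)] by blast
  have finC: "finite C" using C(3) by (rule independent_imp_finite)
  have "UNIV \<subseteq> span C" using span_minimal[OF C(4)] by (metis subspace_span span_UNIV span_Basis span_mono sup.boundedE C(4) span_span)
  then have cC: "card C = CARD('n)" using C(3) by (metis DIM_cart DIM_real basis_card_eq_dim dim_UNIV mult.right_neutral subset_UNIV dim_eq_card top.extremum_uniqueI)
  define T where "T = {i. axis i (1::real) \<in> C - B}"
  have CB: "C - B = (\<lambda>i. axis i (1::real)) ` T"
    using C(2) by (auto simp: T_def Basis_vec_def)
  have cT: "card T = CARD('n) - dim V"
  proof -
    have "card (C - B) = card T" by (simp add: CB card_image inj_on_def axis_eq_axis)
    then show ?thesis using card_Diff_subset[of B C] C(1) finC B cC by (simp add: finite_subset)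
  qed
  have "card (- T) = dim V"
    using cT dim_subset_UNIV[of V] by (simp add: Compl_eq_Diff_UNIV card_Diff_subset)
  moreover have "x = 0" if x: "x \<in> V" and x0: "\<And>i. i \<in> - T \<Longrightarrow> x $ i = 0" for x
  proof -
    have "x = (\<Sum>i\<in>UNIV. x $ i *\<^sub>R axis i 1)"
      using basis_expansion[of x] by (simp add: scalar_mult_eq_scaleR)
    also have "\<dots> = (\<Sum>i\<in>T. x $ i *\<^sub>R axis i 1)"
      using x0 by (intro sum.mono_neutral_right) auto
    also have "\<dots> \<in> span (C - B)" unfolding CB by (intro span_sum span_scale span_base) auto
    finally have 1: "x \<in> span (C - B)" .
    have 2: "x \<in> span B" using x B by blast
    have "span B \<inter> span (C - B) = {0}"
    proof -
      have "dim {y + z |y z. y \<in> span B \<and> z \<in> span (C - B)} + dim (span B \<inter> span (C - B))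
          = dim (span B) + dim (span (C - B))"
        by (intro dim_sums_Int subspace_span)
      moreover have "{y + z |y z. y \<in> span B \<and> z \<in> span (C - B)} = span C"
        using span_Un[of B "C - B"] C(1) by (auto simp: Un_absorb1)
      moreover have "dim (span C) = card C" "dim (span B) = card B" "dim (span (C - B)) = card (C - B)"
        using C(3) B(2) independent_mono[OF C(3), of "C - B"] by (auto simp: dim_eq_card_independent)
      moreover have "card C = card B + card (C - B)"
        using C(1) finC by (simp add: card_Diff_subset finite_subset card_mono)
      ultimately have "dim (span B \<inter> span (C - B)) = 0" by simp
      then show ?thesis using subspace_0[OF subspace_span] by (auto simp: dim_eq_0)
    qed
    then show ?thesis using 1 2 by blast
  qed
  ultimately show ?thesis by blast
qed

lemma subspace_kernel_matrix: "subspace {x :: real ^ 'n. A *v x = (0 :: real ^ 'm)}"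
  by (auto simp: subspace_def matrix_vector_right_distrib matrix_vector_mult_scaleR)

lemma kernel_coordinates:
  fixes A :: "real ^ 'n ^ 'm"
  shows "\<exists>S. card S = dim {x. A *v x = 0} \<and> (\<forall>x. A *v x = 0 \<longrightarrow> (\<forall>i\<in>S. x $ i = 0) \<longrightarrow> x = 0)"
  using coordinate_chart_exists[OF subspace_kernel_matrix, of A] by simp

text \<open>The quadratic form of the matrix is the squared norm of \<open>A *v x\<close> plus the
  sum of the squares of the coordinates in \<open>S\<close>, so its kernel is their common zero
  set.\<close>

lemma det_gram_plus_proj:
  fixes A :: "real ^ 'n ^ 'm"
  shows "det (transpose A ** A + coord_proj S) \<noteq> 0 \<longleftrightarrow>
    (\<forall>x. A *v x = 0 \<longrightarrow> (\<forall>i\<in>S. x $ i = 0) \<longrightarrow> x = 0)" (is "det ?N \<noteq> 0 \<longleftrightarrow> ?R")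
proof -
  have "det ?N \<noteq> 0 \<longleftrightarrow> (\<forall>x. ?N *v x = 0 \<longrightarrow> x = 0)"
    by (metis invertible_det_nz invertible_left_inverse matrix_left_invertible_ker)
  also have "\<dots> \<longleftrightarrow> ?R"
  proof -
    have "?N *v x = 0 \<longleftrightarrow> A *v x = 0 \<and> (\<forall>i\<in>S. x $ i = 0)" for x
    proof
      assume N: "?N *v x = 0"
      have "x \<bullet> (?N *v x) = (A *v x) \<bullet> (A *v x) + (\<Sum>i\<in>UNIV. if i \<in> S then x $ i * x $ i else 0)"
      proof -
        have "x \<bullet> (transpose A *v y) = (A *v x) \<bullet> y" for y
          by (metis dot_lmul_matrix inner_commute transpose_matrix_vector)
        moreover have "x \<bullet> (coord_proj S *v x) = (\<Sum>i\<in>UNIV. if i \<in> S then x $ i * x $ i else 0)"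
          by (simp add: inner_vec_def if_distrib[of "\<lambda>y. _ * y"] cong: if_cong)
        ultimately show ?thesis
          by (simp add: matrix_vector_mult_add_rdistrib inner_add_right flip: matrix_vector_mul_assoc)
      qed
      moreover have "(\<Sum>i\<in>UNIV. if i \<in> S then x $ i * x $ i else 0) \<ge> 0" by (intro sum_nonneg) auto
      moreover have "x \<bullet> (?N *v x) = 0" using N by simp
      ultimately have "(A *v x) \<bullet> (A *v x) = 0" and s: "(\<Sum>i\<in>UNIV. if i \<in> S then x $ i * x $ i else 0) = 0"
        using inner_ge_zero[of "A *v x"] by linarith+
      then have "A *v x = 0" by simp
      moreover have "x $ i = 0" if "i \<in> S" for i
      proof -
        have "\<forall>i\<in>UNIV. (if i \<in> S then x $ i * x $ i else 0) = 0"
          using s by (subst (asm) sum_nonneg_eq_0_iff) auto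
        then have "(if i \<in> S then x $ i * x $ i else 0) = 0" by blast
        then show ?thesis using that by simp
      qed
      ultimately show "A *v x = 0 \<and> (\<forall>i\<in>S. x $ i = 0)" by blast
    next
      assume *: "A *v x = 0 \<and> (\<forall>i\<in>S. x $ i = 0)"
      then have "coord_proj S *v x = 0" by (simp add: vec_eq_iff)
      then show "?N *v x = 0" using * by (simp add: matrix_vector_mult_add_rdistrib flip: matrix_vector_mul_assoc)
    qed
    then show ?thesis by blast
  qed
  finally show ?thesis .
qed

lemma dim_kernel_le_card:
  fixes A :: "real ^ 'n ^ 'm"
  assumes "\<And>x. A *v x = 0 \<Longrightarrow> (\<And>i. i \<in> S \<Longrightarrow> x $ i = 0) \<Longrightarrow> x = 0"
  shows "dim {x. A *v x = 0} \<le> card S"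
proof -
  let ?K = "{x. A *v x = 0}"
  have "inj_on (\<lambda>x. coord_proj S *v x) (span ?K)"
  proof (rule inj_onI)
    fix x y assume "x \<in> span ?K" "y \<in> span ?K" and eq: "coord_proj S *v x = coord_proj S *v y"
    then have "A *v x = 0" "A *v y = 0" by (simp_all add: span_eq_iff[THEN iffD2, OF subspace_kernel_matrix])
    then have "A *v (x - y) = 0" by (simp add: matrix_vector_mult_diff_distrib)
    moreover have "(x - y) $ i = 0" if "i \<in> S" for i
      using arg_cong[OF eq, of "\<lambda>v. v $ i"] that by simp
    ultimately show "x = y" using assms[of "x - y"] by simp
  qed
  then have "dim ?K = dim ((\<lambda>x. coord_proj S *v x) ` ?K)"
    using dim_image_eq[of "\<lambda>x. coord_proj S *v x" ?K] by simp
  also have "\<dots> \<le> dim {x :: real ^ 'n. \<forall>i. i \<notin> S \<longrightarrow> x $ i = 0}"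
    by (intro dim_subset) auto
  finally show ?thesis by (simp add: dim_coordinate_subspace)
qed

text \<open>On the kernel of \<open>A\<close> the matrix acts as \<open>coord_proj S\<close>,
  injectively into a space of dimension \<open>card S\<close>. By the dimension bound it is onto, so
  the unique solution is a kernel vector. \<open>T\<close> is independent of \<open>A\<close>
  because it will be kept fixed while \<open>A\<close> moves.\<close>

lemma kernel_chart:
  fixes A :: "real ^ 'n ^ 'm" and T :: "real ^ 'm ^ 'n"
  assumes inv: "det (T ** A + coord_proj S) \<noteq> 0" and card: "card S \<le> dim {x. A *v x = 0}"
    and x: "(T ** A + coord_proj S) *v x = coord_proj S *v a"
  shows "A *v x = 0"
proof -
  let ?N = "T ** A + coord_proj S"
  let ?K = "{x. A *v x = 0}"
  let ?W = "{x :: real ^ 'n. \<forall>i. i \<notin> S \<longrightarrow> x $ i = 0}"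
  have inj: "inj (\<lambda>x. ?N *v x)"
    using inv by (metis invertible_det_nz invertible_left_inverse matrix_left_invertible_injective)
  have NK: "?N *v x = coord_proj S *v x" if "A *v x = 0" for x
    using that by (simp add: matrix_vector_mult_add_rdistrib flip: matrix_vector_mul_assoc)
  have sub: "(\<lambda>x. ?N *v x) ` ?K \<subseteq> ?W" by (auto simp: NK)
  have "dim ((\<lambda>x. ?N *v x) ` ?K) = dim ?K"
    using inj by (intro dim_image_eq) (auto intro: inj_on_subset)
  then have "(\<lambda>x. ?N *v x) ` ?K = ?W"
    using card sub dim_subset[OF sub]
    by (intro subspace_dim_equal subspace_coordinate linear_subspace_image subspace_kernel_matrix)
       (auto simp: dim_coordinate_subspace)
  moreover have "coord_proj S *v a \<in> ?W" by simp
  ultimately obtain z where "A *v z = 0" "?N *v z = coord_proj S *v a" by (metis (mono_tags, lifting) imageE mem_Collect_eq)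
  then have "z = x" using inj x by (metis injD)
  then show ?thesis using \<open>A *v z = 0\<close> by simp
qed

text \<open>With free coordinates \<open>S\<close> of the kernel at \<open>x\<close>, the
  determinant of the Gram matrix plus \<open>coord_proj S\<close> is a rational polynomial that is
  nonzero at \<open>x\<close>. It is then nonzero at \<open>\<rho>\<close>, where \<open>S\<close>
  bounds the kernel too.\<close>

lemma generic_kernel_dim_minimal:
  fixes A :: "('v::finite \<times> 'd::finite \<Rightarrow> real) \<Rightarrow> real ^ 'n ^ 'm"
  assumes gen: "generic \<rho>" and A: "\<And>i j. ratpoly (\<lambda>x. A x $ i $ j)"
  shows "dim {z. A (\<lambda>(u, i). \<rho> $ u $ i) *v z = 0} \<le> dim {z. A x *v z = 0}"
proof -
  obtain S where S: "card S = dim {z. A x *v z = 0}"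
    "\<forall>z. A x *v z = 0 \<longrightarrow> (\<forall>i\<in>S. z $ i = 0) \<longrightarrow> z = 0"
    using kernel_coordinates[of "A x"] by blast
  let ?g = "\<lambda>x. det (transpose (A x) ** A x + coord_proj S)"
  have "?g x \<noteq> 0" unfolding det_gram_plus_proj using S(2) by blast
  moreover have "ratpoly ?g"
  proof (rule ratpoly_det)
    show "ratpoly (\<lambda>x. (transpose (A x) ** A x + coord_proj S) $ i $ j)" for i j
      by (simp add: matrix_matrix_mult_def transpose_def coord_proj_def)
         (intro ratpoly_add ratpoly_sum ratpoly_mult A ratpoly_0 ratpoly_1 conjI impI ratpoly_if)
  qed
  ultimately have "?g (\<lambda>(u, i). \<rho> $ u $ i) \<noteq> 0" using generic_ratpoly_eq_0[OF gen] by blast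
  then have "dim {z. A (\<lambda>(u, i). \<rho> $ u $ i) *v z = 0} \<le> card S"
    unfolding det_gram_plus_proj by (intro dim_kernel_le_card) blast
  then show ?thesis using S by simp
qed

section \<open>Stresses\<close>

text \<open>Numerators of Cramer's rule: leaving out the division keeps solutions polynomial in the
  entries.\<close>

definition cramer_num :: "real ^ 'n ^ 'n \<Rightarrow> real ^ 'n \<Rightarrow> real ^ 'n" where
  "cramer_num N c = (\<chi> k. det (\<chi> i j. if j = k then c $ i else N $ i $ j))"

lemma cramer_num_solves:
  assumes "det N \<noteq> 0" shows "N *v cramer_num N c = det N *\<^sub>R c"
proof -
  have "N *v (\<chi> k. det (\<chi> i j. if j = k then c $ i else N $ i $ j) / det N) = c"
    using cramer[OF assms] by blast
  moreover have "cramer_num N c = det N *\<^sub>R (\<chi> k. det (\<chi> i j. if j = k then c $ i else N $ i $ j) / det N)"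
    using assms by (simp add: cramer_num_def vec_eq_iff)
  ultimately show ?thesis by (simp only: matrix_vector_mult_scaleR)
qed

lemma inverse_cramer_num:
  assumes "det N \<noteq> 0" shows "N *v (cramer_num N c /\<^sub>R det N) = c"
  using cramer_num_solves[OF assms, of c] assms by (simp add: matrix_vector_mult_scaleR)

lemma cramer_num_unique:
  assumes "det N \<noteq> 0" "N *v x = c" shows "x = cramer_num N c /\<^sub>R det N"
proof -
  have "N *v x = N *v (cramer_num N c /\<^sub>R det N)" using assms inverse_cramer_num by metis
  then show ?thesis
    by (metis assms(1) invertible_det_nz invertible_left_inverse matrix_left_invertible_injective injD)
qed

section \<open>Continuity of solutions of linear systems\<close>

lemma tendsto_det:
  fixes M :: "'z \<Rightarrow> real ^ 'n ^ 'n"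
  assumes "(M \<longlongrightarrow> M0) F" shows "((\<lambda>t. det (M t)) \<longlongrightarrow> det M0) F"
  unfolding det_def by (intro tendsto_intros tendsto_vec_nth assms)

lemma tendsto_cramer_num:
  assumes "(M \<longlongrightarrow> M0) F" "(c \<longlongrightarrow> c0) F"
  shows "((\<lambda>t. cramer_num (M t) (c t)) \<longlongrightarrow> cramer_num M0 c0) F"
proof -
  have "((\<lambda>t. if j = k then c t $ i else M t $ i $ j) \<longlongrightarrow> (if j = k then c0 $ i else M0 $ i $ j)) F" for i j k
    by (cases "j = k") (auto intro!: tendsto_vec_nth assms)
  then show ?thesis
    unfolding cramer_num_def by (intro tendsto_vec_lambda tendsto_det)
qed

lemma tendsto_matrix_vector_mult:
  fixes M :: "'z \<Rightarrow> real ^ 'n ^ 'm"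
  assumes "(M \<longlongrightarrow> M0) F" "(c \<longlongrightarrow> c0) F"
  shows "((\<lambda>t. M t *v c t) \<longlongrightarrow> M0 *v c0) F"
  unfolding matrix_vector_mult_def by (intro tendsto_intros tendsto_vec_nth assms)

lemma tendsto_matrix_mult:
  fixes M :: "'z \<Rightarrow> real ^ 'n ^ 'm" and M' :: "'z \<Rightarrow> real ^ 'k ^ 'n"
  assumes "(M \<longlongrightarrow> M0) F" "(M' \<longlongrightarrow> M0') F"
  shows "((\<lambda>t. M t ** M' t) \<longlongrightarrow> M0 ** M0') F"
  unfolding matrix_matrix_mult_def by (intro tendsto_intros tendsto_vec_nth assms)

lemma tendsto_transpose:
  fixes M :: "'z \<Rightarrow> real ^ 'n ^ 'm"
  assumes "(M \<longlongrightarrow> M0) F"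
  shows "((\<lambda>t. transpose (M t)) \<longlongrightarrow> transpose M0) F"
  unfolding transpose_def by (intro tendsto_intros tendsto_vec_nth assms)

text \<open>Fredholm alternative: the component of \<open>v\<close> orthogonal to the range lies in
  the kernel by symmetry, hence is orthogonal to \<open>v\<close> and vanishes.\<close>

lemma symmetric_kernel_orthogonal_range:
  fixes M :: "real ^ 'n ^ 'n"
  assumes M: "transpose M = M" and v: "\<And>x. M *v x = 0 \<Longrightarrow> x \<bullet> v = 0"
  shows "\<exists>y. M *v y = v"
proof -
  have adj: "x \<bullet> (M *v y) = (M *v x) \<bullet> y" for x y
    by (metis M dot_lmul_matrix inner_commute transpose_matrix_vector)
  have sub: "subspace (range (\<lambda>x. M *v x))"
    by (intro linear_subspace_image subspace_UNIV) simp
  obtain y z where y: "y \<in> span (range (\<lambda>x. M *v x))"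
    and z: "\<And>w. w \<in> span (range (\<lambda>x. M *v x)) \<Longrightarrow> orthogonal z w" and v': "v = y + z"
    using orthogonal_subspace_decomp_exists[of "range (\<lambda>x. M *v x)" v] by metis
  have "(M *v z) \<bullet> w = 0" for w
    using z[OF span_base, of "M *v w"] by (simp add: orthogonal_def adj)
  then have "M *v z = 0" by (metis inner_eq_zero_iff)
  then have "z \<bullet> v = 0" by (rule v)
  moreover have "z \<bullet> y = 0" using z[OF y] by (simp add: orthogonal_def)
  ultimately have "z = 0" by (simp add: v' inner_add_right)
  then show ?thesis using y v' sub by (auto simp: span_eq_iff[THEN iffD2, OF sub])
qed

text \<open>The polarized squared-length map of frameworks on a line. Indexing by all ordered pairs
  makes the type independent of \<open>E\<close>, so edges and all pairs (\<open>E = UNIV\<close>)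
  are treated alike; each edge then occurs twice, which \<open>edge_weight\<close> takes into
  account.\<close>

definition edge_form :: "'v::finite set set \<Rightarrow> real ^ 'v \<Rightarrow> real ^ 'v \<Rightarrow> real ^ ('v \<times> 'v)" where
  "edge_form E x y = (\<chi> k. if {fst k, snd k} \<in> E
     then (x $ fst k - x $ snd k) * (y $ fst k - y $ snd k) else 0)"

definition edge_weight :: "'v::finite set set \<Rightarrow> real ^ ('v \<times> 'v) \<Rightarrow> 'v \<Rightarrow> 'v \<Rightarrow> real" where
  "edge_weight E \<omega> u w = (if {u, w} \<in> E then \<omega> $ (u, w) + \<omega> $ (w, u) else 0)"

definition laplacian :: "'v::finite set set \<Rightarrow> real ^ ('v \<times> 'v) \<Rightarrow> real ^ 'v ^ 'v" where
  "laplacian E \<omega> = (\<chi> u w. (if u = w then \<Sum>z\<in>UNIV. edge_weight E \<omega> u z else 0) - edge_weight E \<omega> u w)"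

lemma edge_weight_sym: "edge_weight E \<omega> u w = edge_weight E \<omega> w u"
  by (simp add: edge_weight_def insert_commute)

lemma laplacian_mult: "(laplacian E \<omega> *v y) $ u = (\<Sum>w\<in>UNIV. edge_weight E \<omega> u w * (y $ u - y $ w))"
  by (simp add: laplacian_def matrix_vector_mult_def left_diff_distrib right_diff_distrib sum_subtractf
      if_distrib[of "\<lambda>x. x * _"] sum_distrib_right cong: if_cong)

lemma transpose_laplacian: "transpose (laplacian E \<omega>) = laplacian E \<omega>"
  by (auto simp: transpose_def laplacian_def vec_eq_iff edge_weight_sym)

text \<open>Summation by parts. It translates orthogonality to edge forms into conditions on the
  stress matrix.\<close>

lemma edge_form_inner: "\<omega> \<bullet> edge_form E x y = x \<bullet> (laplacian E \<omega> *v y)"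
proof -
  let ?e = "\<lambda>u w. if {u, w} \<in> E then \<omega> $ (u, w) else 0"
  have "x \<bullet> (laplacian E \<omega> *v y) = (\<Sum>u\<in>UNIV. \<Sum>w\<in>UNIV. x $ u * (edge_weight E \<omega> u w * (y $ u - y $ w)))"
    by (simp add: inner_vec_def laplacian_mult sum_distrib_left)
  also have "\<dots> = (\<Sum>u\<in>UNIV. \<Sum>w\<in>UNIV. ?e u w * (x $ u * (y $ u - y $ w)) + ?e w u * (x $ u * (y $ u - y $ w)))"
    by (intro sum.cong refl) (simp add: edge_weight_def insert_commute algebra_simps)
  also have "\<dots> = (\<Sum>u\<in>UNIV. \<Sum>w\<in>UNIV. ?e u w * (x $ u * (y $ u - y $ w)))
      + (\<Sum>w\<in>UNIV. \<Sum>u\<in>UNIV. ?e w u * (x $ u * (y $ u - y $ w)))"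
    by (simp only: sum.distrib sum.swap[of "\<lambda>u w. ?e w u * _ u w"])
  also have "\<dots> = (\<Sum>u\<in>UNIV. \<Sum>w\<in>UNIV. ?e u w * ((x $ u - x $ w) * (y $ u - y $ w)))"
    unfolding sum.distrib[symmetric] by (intro sum.cong refl) (simp add: algebra_simps)
  also have "\<dots> = (\<Sum>k\<in>UNIV \<times> UNIV. ?e (fst k) (snd k) * ((x $ fst k - x $ snd k) * (y $ fst k - y $ snd k)))"
    by (simp add: sum.cartesian_product case_prod_unfold)
  also have "\<dots> = \<omega> \<bullet> edge_form E x y"
    by (simp add: inner_vec_def edge_form_def if_distrib[of "\<lambda>y. y * _"] if_distrib[of "\<lambda>y. _ * y"] cong: if_cong)
  finally show ?thesis by simp
qed

lemma laplacian_add: "laplacian E (\<omega> + \<eta>) = laplacian E \<omega> + laplacian E \<eta>"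
  and laplacian_scale: "laplacian E (c *\<^sub>R \<omega>) = c *\<^sub>R laplacian E \<omega>"
proof -
  have "edge_weight E (\<omega> + \<eta>) u w = edge_weight E \<omega> u w + edge_weight E \<eta> u w"
    and "edge_weight E (c *\<^sub>R \<omega>) u w = c * edge_weight E \<omega> u w" for u w
    by (simp_all add: edge_weight_def algebra_simps)
  then show "laplacian E (\<omega> + \<eta>) = laplacian E \<omega> + laplacian E \<eta>" "laplacian E (c *\<^sub>R \<omega>) = c *\<^sub>R laplacian E \<omega>"
    by (simp_all add: laplacian_def vec_eq_iff sum.distrib sum_distrib_left right_diff_distrib)
qed

lemma tendsto_laplacian: "(\<omega> \<longlongrightarrow> \<omega>0) F \<Longrightarrow> ((\<lambda>t. laplacian E (\<omega> t)) \<longlongrightarrow> laplacian E \<omega>0) F"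
proof -
  assume \<omega>: "(\<omega> \<longlongrightarrow> \<omega>0) F"
  have "((\<lambda>t. edge_weight E (\<omega> t) u w) \<longlongrightarrow> edge_weight E \<omega>0 u w) F" for u w
    unfolding edge_weight_def by (cases "{u, w} \<in> E") (auto intro!: tendsto_intros tendsto_vec_nth \<omega>)
  moreover from this have "((\<lambda>t. if u = w then \<Sum>z\<in>UNIV. edge_weight E (\<omega> t) u z else 0)
      \<longlongrightarrow> (if u = w then \<Sum>z\<in>UNIV. edge_weight E \<omega>0 u z else 0)) F" for u w
    by (cases "u = w") (auto intro!: tendsto_intros)
  ultimately show ?thesis unfolding laplacian_def by (intro tendsto_intros)
qed

definition coord_vec :: "real ^ 'd ^ 'v \<Rightarrow> 'd \<Rightarrow> real ^ 'v" where
  "coord_vec \<rho> i = (\<chi> u. \<rho> $ u $ i)"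

text \<open>Applied to \<open>\<omega>\<close> it gives the resultant force at each vertex; its
  kernel is the space of stresses and its transpose is the rigidity matrix.\<close>

definition equil_matrix :: "'v::finite set set \<Rightarrow> real ^ 'd ^ 'v \<Rightarrow> real ^ ('v \<times> 'v) ^ ('v \<times> 'd)" where
  "equil_matrix E \<rho> = (\<chi> k. edge_form E (axis (fst k) 1) (coord_vec \<rho> (snd k)))"

lemma equil_matrix_mult: "(equil_matrix E \<rho> *v \<omega>) $ (u, i) = (laplacian E \<omega> *v coord_vec \<rho> i) $ u"
proof -
  have "(equil_matrix E \<rho> *v \<omega>) $ (u, i) = \<omega> \<bullet> edge_form E (axis u 1) (coord_vec \<rho> i)"
    by (simp add: matrix_vector_mult_def equil_matrix_def inner_vec_def mult.commute)
  then show ?thesis by (simp add: edge_form_inner inner_axis')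
qed

lemma equil_matrix_eq_0_iff: "equil_matrix E \<rho> *v \<omega> = 0 \<longleftrightarrow> (\<forall>i. laplacian E \<omega> *v coord_vec \<rho> i = 0)"
  by (auto simp: vec_eq_iff equil_matrix_mult)

lemma equil_matrix_add: "equil_matrix E (\<rho> + \<tau>) = equil_matrix E \<rho> + equil_matrix E \<tau>"
  and equil_matrix_scale: "equil_matrix E (t *\<^sub>R \<tau>) = t *\<^sub>R equil_matrix E \<tau>"
  by (simp_all add: equil_matrix_def edge_form_def coord_vec_def vec_eq_iff algebra_simps)

lemma equilibrium_stress_laplacian:
  assumes "equil_matrix E \<rho> *v \<omega> = 0"
  shows "equilibrium_stress_matrix E \<rho> (laplacian E \<omega>)"
proof -
  have "(\<Sum>w\<in>UNIV. laplacian E \<omega> $ u $ w) = 0" for u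
    by (simp add: laplacian_def sum_subtractf)
  moreover have "(\<Sum>w\<in>UNIV. laplacian E \<omega> $ u $ w *\<^sub>R \<rho> $ w) = 0" for u
  proof -
    have "(laplacian E \<omega> *v coord_vec \<rho> i) $ u = 0" for i using assms by (simp add: equil_matrix_eq_0_iff)
    then show ?thesis by (simp add: vec_eq_iff matrix_vector_mult_def coord_vec_def)
  qed
  moreover have "laplacian E \<omega> $ u $ w = 0" if "u \<noteq> w" "{u, w} \<notin> E" for u w
    using that by (simp add: laplacian_def edge_weight_def)
  ultimately show ?thesis by (simp add: equilibrium_stress_matrix_def transpose_laplacian)
qed

definition framework_of_coords :: "('v \<times> 'd \<Rightarrow> real) \<Rightarrow> real ^ 'd ^ 'v" where
  "framework_of_coords x = (\<chi> u i. x (u, i))"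

lemma framework_of_coords_inverse: "framework_of_coords (\<lambda>(u, i). \<rho> $ u $ i) = \<rho>"
  by (simp add: framework_of_coords_def vec_eq_iff)

lemma framework_of_coords_surj: "\<exists>x. framework_of_coords x = \<rho>"
  using framework_of_coords_inverse by blast

lemma ratpoly_equil_matrix: "ratpoly (\<lambda>x. equil_matrix E (framework_of_coords x) $ i $ j)"
  unfolding equil_matrix_def edge_form_def coord_vec_def framework_of_coords_def axis_def
  by (simp, intro conjI impI ratpoly_mult ratpoly_diff ratpoly_var ratpoly_0 ratpoly_1 ratpoly_if)
     (auto intro!: ratpoly_mult ratpoly_diff ratpoly_var ratpoly_0 ratpoly_1 ratpoly_minus1 ratpoly_uminus)

lemma rational_vector_dense:
  assumes "open S" "S \<noteq> {}"
  obtains a :: "rat ^ 'n" where "(\<chi> i. of_rat (a $ i)) \<in> (S :: (real ^ 'n) set)"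
proof -
  have "S \<inter> (\<Union>f \<in> Basis \<rightarrow> \<rat>. { \<Sum>i :: real ^ 'n \<in> Basis. f i *\<^sub>R i }) \<noteq> {}"
    using open_Int_closure_eq_empty[OF assms(1), of "\<Union>f \<in> Basis \<rightarrow> \<rat>. { \<Sum>i :: real ^ 'n \<in> Basis. f i *\<^sub>R i }"]
      closure_rational_coordinates[where 'a = "real ^ 'n"] assms(2) by auto
  then obtain f where f: "f \<in> Basis \<rightarrow> \<rat>" "(\<Sum>i :: real ^ 'n \<in> Basis. f i *\<^sub>R i) \<in> S" by blast
  let ?x = "\<Sum>i :: real ^ 'n \<in> Basis. f i *\<^sub>R i"
  have "\<exists>q. ?x $ i = of_rat q" for i
  proof -
    have "?x $ i = ?x \<bullet> axis i 1" by (simp add: inner_axis)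
    also have "\<dots> = f (axis i 1)"
      by (subst inner_sum_left_Basis) auto
    finally show ?thesis using f(1) by (auto simp: Pi_iff Rats_def Basis_vec_def)
  qed
  then obtain q where "\<And>i. ?x $ i = of_rat (q i)" by metis
  then have "?x = (\<chi> i. of_rat ((\<chi> i. q i) $ i))" by (simp add: vec_eq_iff)
  with f(2) have "(\<chi> i. of_rat ((\<chi> i. q i) $ i)) \<in> S" by (simp only:)
  then show ?thesis by (rule that)
qed

lemma ratpoly_laplacian:
  assumes "\<And>k. ratpoly (\<lambda>x. \<omega> x $ k)"
  shows "ratpoly (\<lambda>x. laplacian E (\<omega> x) $ u $ w)"
proof -
  have ew: "ratpoly (\<lambda>x. edge_weight E (\<omega> x) u w)" for u w
    unfolding edge_weight_def by (intro ratpoly_if ratpoly_add assms ratpoly_0)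
  show ?thesis
    unfolding laplacian_def
    by (simp only: vec_lambda_beta) (intro ratpoly_diff ratpoly_if ratpoly_sum ew ratpoly_0)
qed

abbreviation stress_gram :: "'v::finite set set \<Rightarrow> ('v \<times> 'v) set \<Rightarrow> real ^ 'd ^ 'v \<Rightarrow> real ^ ('v \<times> 'v) ^ ('v \<times> 'v)" where
  "stress_gram E S \<rho> \<equiv> transpose (equil_matrix E \<rho>) ** equil_matrix E \<rho> + coord_proj S"

lemma kernel_dim_equil_matrix_minimal:
  fixes \<rho> \<sigma> :: "real ^ 'd::finite ^ 'v::finite"
  shows "generic \<rho> \<Longrightarrow> dim {\<omega>. equil_matrix E \<rho> *v \<omega> = 0} \<le> dim {\<omega>. equil_matrix E \<sigma> *v \<omega> = 0}"
proof -
  assume gen: "generic \<rho>"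
  obtain x :: "'v \<times> 'd \<Rightarrow> real" where x: "framework_of_coords x = \<sigma>" using framework_of_coords_surj by blast
  show ?thesis
    using generic_kernel_dim_minimal[OF gen ratpoly_equil_matrix, of E x] by (simp add: framework_of_coords_inverse x)
qed

text \<open>
  A stress of \<open>\<sigma>\<close> is approximated by one with rational parameters \<open>a\<close> in the parametrization of the
  stresses. With \<open>a\<close> fixed the stress matrix is a rational polynomial in the framework, so its rank
  is at most its rank at the generic framework \<open>\<rho>\<close>.
\<close>

lemma stress_kernel_dim_locally_minimal:
  fixes \<rho> \<sigma> :: "real ^ 'd::finite ^ 'v::finite"
  assumes gen: "generic \<rho>"
    and S: "card S = dim {\<omega>. equil_matrix E \<rho> *v \<omega> = 0}"
    and N\<rho>: "det (stress_gram E S \<rho>) \<noteq> 0" and N\<sigma>: "det (stress_gram E S \<sigma>) \<noteq> 0"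
    and min: "\<And>\<omega>. equil_matrix E \<rho> *v \<omega> = 0 \<Longrightarrow> k \<le> dim {x. laplacian E \<omega> *v x = 0}"
    and \<omega>: "equil_matrix E \<sigma> *v \<omega> = 0"
  shows "k \<le> dim {x. laplacian E \<omega> *v x = 0}"
proof (rule ccontr)
  assume less: "\<not> k \<le> dim {x. laplacian E \<omega> *v x = 0}"
  obtain S' where S': "card S' = dim {x. laplacian E \<omega> *v x = 0}"
    "\<forall>x. laplacian E \<omega> *v x = 0 \<longrightarrow> (\<forall>i\<in>S'. x $ i = 0) \<longrightarrow> x = 0"
    using kernel_coordinates[of "laplacian E \<omega>"] by blast
  obtain y :: "'v \<times> 'd \<Rightarrow> real" where y: "framework_of_coords y = \<sigma>" using framework_of_coords_surj by blast
  \<comment> \<open>The stress with free coordinates \<open>a\<close>, scaled by the determinant so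
    as to be polynomial. The scaling does not change kernels.\<close>
  define M where "M = (\<lambda>a. laplacian E (cramer_num (stress_gram E S \<sigma>) (coord_proj S *v a)))"
  define h where "h = (\<lambda>a. det (transpose (M a) ** M a + coord_proj S'))"
  have "stress_gram E S \<sigma> *v \<omega> = coord_proj S *v \<omega>"
    using \<omega> by (simp add: matrix_vector_mult_add_rdistrib flip: matrix_vector_mul_assoc)
  from arg_cong[OF cramer_num_unique[OF N\<sigma> this], of "\<lambda>v. det (stress_gram E S \<sigma>) *\<^sub>R v"]
  have "cramer_num (stress_gram E S \<sigma>) (coord_proj S *v \<omega>) = det (stress_gram E S \<sigma>) *\<^sub>R \<omega>"
    using N\<sigma> by simp
  then have "M \<omega> = det (stress_gram E S \<sigma>) *\<^sub>R laplacian E \<omega>" by (simp add: M_def laplacian_scale)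
  then have "M \<omega> *v x = 0 \<longleftrightarrow> laplacian E \<omega> *v x = 0" for x
    using N\<sigma> by (simp add: scaleR_matrix_vector_assoc[symmetric])
  then have "h \<omega> \<noteq> 0" unfolding h_def det_gram_plus_proj using S'(2) by blast
  moreover have "open {a. h a \<noteq> 0}"
  proof -
    have "(h \<longlongrightarrow> h a) (at a)" for a
      unfolding h_def M_def
      by (intro tendsto_det tendsto_add tendsto_matrix_mult tendsto_transpose tendsto_laplacian
          tendsto_cramer_num tendsto_matrix_vector_mult tendsto_const tendsto_ident_at)
    then have "continuous_on UNIV h" by (simp add: continuous_on_def)
    then show ?thesis by (intro open_Collect_neq) auto
  qed
  ultimately obtain q :: "rat ^ ('v \<times> 'v)" where q: "h (\<chi> i. of_rat (q $ i)) \<noteq> 0"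
    using rational_vector_dense[of "{a. h a \<noteq> 0}"] by auto
  define a :: "real ^ ('v \<times> 'v)" where "a = (\<chi> i. of_rat (q $ i))"
  define Q where "Q = (\<lambda>x :: 'v \<times> 'd \<Rightarrow> real. laplacian E (cramer_num (stress_gram E S (framework_of_coords x)) (coord_proj S *v a)))"
  have rN: "ratpoly (\<lambda>x :: 'v \<times> 'd \<Rightarrow> real. stress_gram E S (framework_of_coords x) $ i $ j)" for i j
    by (simp add: matrix_matrix_mult_def transpose_def coord_proj_def)
       (intro ratpoly_add ratpoly_sum ratpoly_mult ratpoly_equil_matrix ratpoly_0 ratpoly_1 conjI impI ratpoly_if)
  have rc: "ratpoly (\<lambda>x :: 'v \<times> 'd \<Rightarrow> real. cramer_num (stress_gram E S (framework_of_coords x)) (coord_proj S *v a) $ k)" for k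
  proof -
    have "ratpoly (\<lambda>x :: 'v \<times> 'd \<Rightarrow> real. (coord_proj S *v a) $ i)" for i
      by (simp add: a_def) (intro conjI impI ratpoly_const ratpoly_0)
    then have "ratpoly (\<lambda>x :: 'v \<times> 'd \<Rightarrow> real.
        if j = k then (coord_proj S *v a) $ i else stress_gram E S (framework_of_coords x) $ i $ j)" for i j
      by (intro ratpoly_if rN)
    then show ?thesis unfolding cramer_num_def by (simp only: vec_lambda_beta) (rule ratpoly_det, simp only: vec_lambda_beta)
  qed
  have "dim {z. Q (\<lambda>(u, i). \<rho> $ u $ i) *v z = 0} \<le> dim {z. Q y *v z = 0}"
    unfolding Q_def by (rule generic_kernel_dim_minimal[OF gen]) (rule ratpoly_laplacian[OF rc])
  also have "\<dots> \<le> card S'"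
  proof (rule dim_kernel_le_card)
    fix x assume "Q y *v x = 0" "\<And>i. i \<in> S' \<Longrightarrow> x $ i = 0"
    moreover have "Q y = M a" by (simp add: Q_def M_def y)
    ultimately show "x = 0" using q unfolding h_def a_def[symmetric] det_gram_plus_proj by auto
  qed
  also have "\<dots> < k" using less S'(1) by simp
  finally have lt: "dim {z. laplacian E (cramer_num (stress_gram E S \<rho>) (coord_proj S *v a)) *v z = 0} < k"
    by (simp add: Q_def framework_of_coords_inverse)
  have "equil_matrix E \<rho> *v cramer_num (stress_gram E S \<rho>) (coord_proj S *v a) = 0"
  proof (rule kernel_chart[OF N\<rho>])
    show "stress_gram E S \<rho> *v cramer_num (stress_gram E S \<rho>) (coord_proj S *v a)
      = coord_proj S *v (det (stress_gram E S \<rho>) *\<^sub>R a)"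
      by (simp only: cramer_num_solves[OF N\<rho>] matrix_vector_mult_scaleR)
  qed (simp add: S)
  then show False using min lt by fastforce
qed

lemma tendsto_cramer_inverse:
  assumes "(M \<longlongrightarrow> M0) F" "(c \<longlongrightarrow> c0) F" "det M0 \<noteq> 0"
  shows "((\<lambda>t. cramer_num (M t) (c t) /\<^sub>R det (M t)) \<longlongrightarrow> cramer_num M0 c0 /\<^sub>R det M0) F"
  by (intro tendsto_intros tendsto_cramer_num tendsto_det assms)

text \<open>
  The assumption on \<open>\<eta>\<close> makes \<open>\<eta>\<close> the first-order variation of a curve \<open>om\<close> of stresses of frameworks
  \<open>\<rho> + t *\<^sub>R \<tau>\<close>. The kernels along it have constant dimension, so \<open>x\<close> extends to vectors \<open>xt t\<close> of these kernels,
  and the claim is the first-order term of \<open>x \<bullet> (laplacian E (om t) *v xt t) = 0\<close>.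
\<close>

lemma contact_locus_flat:
  fixes \<rho> :: "real ^ 'd::finite ^ 'v::finite"
  assumes gen: "generic \<rho>"
    and \<omega>: "equil_matrix E \<rho> *v \<omega> = 0"
    and min: "\<And>\<omega>'. equil_matrix E \<rho> *v \<omega>' = 0 \<Longrightarrow> dim {x. laplacian E \<omega> *v x = 0} \<le> dim {x. laplacian E \<omega>' *v x = 0}"
    and \<eta>: "\<And>x i. laplacian E \<omega> *v x = 0 \<Longrightarrow> x \<bullet> (laplacian E \<eta> *v coord_vec \<rho> i) = 0"
    and x: "laplacian E \<omega> *v x = 0"
  shows "x \<bullet> (laplacian E \<eta> *v x) = 0"
proof -
  \<comment> \<open>The solutions \<open>z i\<close> become the coordinates of a velocity
    \<open>\<tau>\<close> for which the equilibrium equation holds to first order, which is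
    \<open>lin\<close>.\<close>
  have "\<exists>z. laplacian E \<omega> *v z = - (laplacian E \<eta> *v coord_vec \<rho> i)" for i
    by (rule symmetric_kernel_orthogonal_range) (auto simp: transpose_laplacian \<eta>)
  then obtain z where z: "\<And>i. laplacian E \<omega> *v z i = - (laplacian E \<eta> *v coord_vec \<rho> i)" by metis
  define \<tau> :: "real ^ 'd ^ 'v" where "\<tau> = (\<chi> u i. z i $ u)"
  have vt: "coord_vec \<tau> i = z i" for i by (simp add: coord_vec_def \<tau>_def vec_eq_iff)
  have lin: "equil_matrix E \<rho> *v \<eta> + equil_matrix E \<tau> *v \<omega> = 0"
    by (auto simp: vec_eq_iff equil_matrix_mult vt z)
  obtain S where S: "card S = dim {\<omega>. equil_matrix E \<rho> *v \<omega> = 0}"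
    "\<forall>x. equil_matrix E \<rho> *v x = 0 \<longrightarrow> (\<forall>i\<in>S. x $ i = 0) \<longrightarrow> x = 0"
    using kernel_coordinates[of "equil_matrix E \<rho>"] by blast
  obtain S' where S': "card S' = dim {x. laplacian E \<omega> *v x = 0}"
    "\<forall>x. laplacian E \<omega> *v x = 0 \<longrightarrow> (\<forall>i\<in>S'. x $ i = 0) \<longrightarrow> x = 0"
    using kernel_coordinates[of "laplacian E \<omega>"] by blast
  define r where "r = (\<lambda>t. \<rho> + t *\<^sub>R \<tau>)"
  define A where "A = (\<lambda>t. equil_matrix E (r t))"
  define N where "N = (\<lambda>t. stress_gram E S (r t))"
  \<comment> \<open>\<open>\<omega> + t *\<^sub>R \<eta>\<close> fails to be a stress of
    \<open>r t\<close> only by \<open>t * t\<close> times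
    \<open>equil_matrix E \<tau> *v \<eta>\<close>. Subtracting \<open>(t * t) *\<^sub>R y t\<close>
    removes the error: for small \<open>t\<close>, \<open>om t\<close> is the stress of
    \<open>r t\<close> with the same coordinates in \<open>S\<close>.\<close>
  define c where "c = (\<lambda>t. transpose (A t) *v (equil_matrix E \<tau> *v \<eta>))"
  define y where "y = (\<lambda>t. cramer_num (N t) (c t) /\<^sub>R det (N t))"
  define om where "om = (\<lambda>t. \<omega> + t *\<^sub>R \<eta> - (t * t) *\<^sub>R y t)"
  define G where "G = (\<lambda>t. transpose (laplacian E (om t)) ** laplacian E (om t) + coord_proj S')"
  define xt where "xt = (\<lambda>t. cramer_num (G t) (coord_proj S' *v x) /\<^sub>R det (G t))"
  have At: "A t = equil_matrix E \<rho> + t *\<^sub>R equil_matrix E \<tau>" for t by (simp add: A_def r_def equil_matrix_add equil_matrix_scale)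
  have N0: "det (N 0) \<noteq> 0"
    unfolding N_def r_def by (simp add: det_gram_plus_proj) (use S(2) in blast)
  have limA: "(A \<longlongrightarrow> A 0) (at 0)" unfolding At by (intro tendsto_eq_intros) auto
  then have limN: "(N \<longlongrightarrow> N 0) (at 0)"
    unfolding N_def by (intro tendsto_intros tendsto_matrix_mult tendsto_transpose limA[unfolded A_def])
  have limy: "(y \<longlongrightarrow> y 0) (at 0)"
    unfolding y_def c_def
    by (intro tendsto_cramer_inverse limN tendsto_matrix_vector_mult tendsto_transpose limA tendsto_const N0)
  have om0: "om 0 = \<omega>" by (simp add: om_def)
  have limom: "(om \<longlongrightarrow> om 0) (at 0)"
    unfolding om_def by (intro tendsto_intros limy)
  have limG: "(G \<longlongrightarrow> G 0) (at 0)"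
    unfolding G_def by (intro tendsto_intros tendsto_matrix_mult tendsto_transpose tendsto_laplacian limom)
  have G0: "det (G 0) \<noteq> 0" unfolding G_def om0 det_gram_plus_proj using S'(2) by blast
  have "(xt \<longlongrightarrow> xt 0) (at 0)"
    unfolding xt_def by (intro tendsto_cramer_inverse limG tendsto_const G0)
  moreover have "x = xt 0"
    unfolding xt_def
    by (rule cramer_num_unique[OF G0])
       (use x in \<open>simp add: G_def om0 matrix_vector_mult_add_rdistrib flip: matrix_vector_mul_assoc\<close>)
  ultimately have limx: "(xt \<longlongrightarrow> x) (at 0)" by simp
  have evN: "eventually (\<lambda>t. det (N t) \<noteq> 0) (at 0)"
    using tendsto_imp_eventually_ne[OF tendsto_det[OF limN] N0] .
  have evG: "eventually (\<lambda>t. det (G t) \<noteq> 0) (at 0)"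
    using tendsto_imp_eventually_ne[OF tendsto_det[OF limG] G0] .
  \<comment> \<open>The stress matrix of \<open>om t\<close> is that of \<open>\<omega>\<close> plus
    \<open>t\<close> times the matrix here, and the former drops out against \<open>x\<close> by
    symmetry. Dividing by \<open>t\<close> leaves an identity for which continuity of
    \<open>xt\<close> suffices.\<close>
  have pt: "x \<bullet> (laplacian E (\<eta> - t *\<^sub>R y t) *v xt t) = 0" if t: "t \<noteq> 0" "det (N t) \<noteq> 0" "det (G t) \<noteq> 0" for t
  proof -
    have Ny: "N t *v y t = c t" unfolding y_def by (rule inverse_cramer_num[OF t(2)])
    have Aom: "A t *v (\<omega> + t *\<^sub>R \<eta>) = (t * t) *\<^sub>R (equil_matrix E \<tau> *v \<eta>)"
    proof -
      have "A t *v (\<omega> + t *\<^sub>R \<eta>) = equil_matrix E \<rho> *v \<omega> + t *\<^sub>R (equil_matrix E \<rho> *v \<eta> + equil_matrix E \<tau> *v \<omega>)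
          + (t * t) *\<^sub>R (equil_matrix E \<tau> *v \<eta>)"
        by (simp add: At matrix_vector_mult_add_rdistrib matrix_vector_right_distrib
            matrix_vector_mult_scaleR scaleR_matrix_vector_assoc[symmetric] algebra_simps)
      then show ?thesis by (simp add: \<omega> lin)
    qed
    have "N t *v om t = transpose (A t) *v (A t *v (\<omega> + t *\<^sub>R \<eta>)) + coord_proj S *v (\<omega> + t *\<^sub>R \<eta>) - (t * t) *\<^sub>R c t"
      unfolding om_def matrix_vector_mult_diff_distrib matrix_vector_mult_scaleR Ny
      by (simp add: N_def A_def matrix_vector_mult_add_rdistrib flip: matrix_vector_mul_assoc)
    also have "\<dots> = coord_proj S *v (\<omega> + t *\<^sub>R \<eta>)"
      by (simp add: Aom c_def matrix_vector_mult_scaleR)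
    finally have Nom: "N t *v om t = coord_proj S *v (\<omega> + t *\<^sub>R \<eta>)" .
    have "equil_matrix E (r t) *v om t = 0"
    proof (rule kernel_chart)
      show "det (stress_gram E S (r t)) \<noteq> 0" using t(2) by (simp add: N_def)
      show "card S \<le> dim {x. equil_matrix E (r t) *v x = 0}" unfolding S(1) by (rule kernel_dim_equil_matrix_minimal[OF gen])
      show "stress_gram E S (r t) *v om t = coord_proj S *v (\<omega> + t *\<^sub>R \<eta>)" using Nom by (simp add: N_def)
    qed
    then have "card S' \<le> dim {x. laplacian E (om t) *v x = 0}"
      unfolding S'(1)
      by (intro stress_kernel_dim_locally_minimal[OF gen S(1) _ _ min]) (use N0 t(2) in \<open>auto simp: N_def r_def\<close>)
    then have Lx: "laplacian E (om t) *v xt t = 0"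
      using t(3) inverse_cramer_num[OF t(3), of "coord_proj S' *v x"]
      by (intro kernel_chart[of "transpose (laplacian E (om t))" _ S' _ x]) (auto simp: G_def xt_def)
    have "om t = \<omega> + t *\<^sub>R (\<eta> - t *\<^sub>R y t)" by (simp add: om_def algebra_simps)
    then have "laplacian E (om t) = laplacian E \<omega> + t *\<^sub>R laplacian E (\<eta> - t *\<^sub>R y t)" by (simp add: laplacian_add laplacian_scale)
    then have "0 = x \<bullet> (laplacian E \<omega> *v xt t) + t * (x \<bullet> (laplacian E (\<eta> - t *\<^sub>R y t) *v xt t))"
      using Lx by (metis inner_add_right inner_scaleR_right inner_zero_right matrix_vector_mult_add_rdistrib scaleR_matrix_vector_assoc)
    moreover have "x \<bullet> (laplacian E \<omega> *v xt t) = 0"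
      using x by (metis dot_lmul_matrix inner_zero_left transpose_laplacian transpose_matrix_vector)
    ultimately show ?thesis using t(1) by simp
  qed
  have "eventually (\<lambda>t. x \<bullet> (laplacian E (\<eta> - t *\<^sub>R y t) *v xt t) = 0) (at 0)"
    using evN evG eventually_neq_at_within[of 0 0 UNIV] by eventually_elim (rule pt)
  then have "((\<lambda>t. x \<bullet> (laplacian E (\<eta> - t *\<^sub>R y t) *v xt t)) \<longlongrightarrow> 0) (at 0)"
    by (rule tendsto_eventually)
  moreover have "((\<lambda>t. x \<bullet> (laplacian E (\<eta> - t *\<^sub>R y t) *v xt t)) \<longlongrightarrow> x \<bullet> (laplacian E (\<eta> - 0 *\<^sub>R y 0) *v x)) (at 0)"
    by (intro tendsto_intros tendsto_matrix_vector_mult tendsto_laplacian limy limx)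
  ultimately have "x \<bullet> (laplacian E (\<eta> - 0 *\<^sub>R y 0) *v x) = 0"
    by (intro tendsto_unique[OF _ _ ]) (auto)
  then show ?thesis by simp
qed

section \<open>Infinitesimal rigidity\<close>

definition framework_of_vec :: "real ^ ('v::finite \<times> 'd::finite) \<Rightarrow> real ^ 'd ^ 'v" where
  "framework_of_vec s = (\<chi> u i. s $ (u, i))"

text \<open>It is linear in \<open>s\<close>, and \<open>rig_matrix E s *v s\<close> is the vector
  of squared lengths, with derivative \<open>2 *\<^sub>R rig_matrix E s\<close>.\<close>

definition rig_matrix :: "'v::finite set set \<Rightarrow> real ^ ('v \<times> 'd::finite) \<Rightarrow> real ^ ('v \<times> 'd) ^ ('v \<times> 'v)" where
  "rig_matrix E s = transpose (equil_matrix E (framework_of_vec s))"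

lemma framework_of_vec_surj: "\<exists>s. framework_of_vec s = (\<rho> :: real ^ 'd::finite ^ 'v::finite)"
  by (intro exI[of _ "\<chi> k. \<rho> $ fst k $ snd k"]) (simp add: framework_of_vec_def vec_eq_iff)

lemma rig_matrix_mult: "(rig_matrix E s *v h) $ (u, w) =
  (if {u, w} \<in> E then (framework_of_vec s $ u - framework_of_vec s $ w) \<bullet> (framework_of_vec h $ u - framework_of_vec h $ w) else 0)"
proof (cases "{u, w} \<in> E")
  case True
  have ax: "(\<Sum>x\<in>UNIV. (axis x (1::real) $ u - axis x 1 $ w) * h $ (x, i)) = h $ (u, i) - h $ (w, i)" for i
    by (simp add: axis_def left_diff_distrib sum_subtractf if_distrib[of "\<lambda>y. y * _"] cong: if_cong)
  have "(rig_matrix E s *v h) $ (u, w)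
      = (\<Sum>(x, i)\<in>UNIV \<times> UNIV. (axis x (1::real) $ u - axis x 1 $ w) * (s $ (u, i) - s $ (w, i)) * h $ (x, i))"
    using True by (simp add: rig_matrix_def transpose_def matrix_vector_mult_def equil_matrix_def edge_form_def coord_vec_def
        framework_of_vec_def case_prod_unfold)
  also have "\<dots> = (\<Sum>i\<in>UNIV. \<Sum>x\<in>UNIV. (axis x (1::real) $ u - axis x 1 $ w) * (s $ (u, i) - s $ (w, i)) * h $ (x, i))"
    by (subst sum.swap) (simp add: sum.cartesian_product)
  also have "\<dots> = (\<Sum>i\<in>UNIV. (s $ (u, i) - s $ (w, i)) * (\<Sum>x\<in>UNIV. (axis x (1::real) $ u - axis x 1 $ w) * h $ (x, i)))"
    by (simp add: sum_distrib_left mult_ac)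
  also have "\<dots> = (framework_of_vec s $ u - framework_of_vec s $ w) \<bullet> (framework_of_vec h $ u - framework_of_vec h $ w)"
    by (simp add: ax inner_vec_def framework_of_vec_def)
  finally show ?thesis using True by simp
next
  case False
  then show ?thesis
    by (simp add: rig_matrix_def transpose_def matrix_vector_mult_def equil_matrix_def edge_form_def)
qed

lemma rig_matrix_commute: "rig_matrix E s *v h = rig_matrix E h *v s"
  by (auto simp: vec_eq_iff rig_matrix_mult inner_commute)

lemma rig_matrix_add: "rig_matrix E (s + s') = rig_matrix E s + rig_matrix E s'"
  and rig_matrix_scale: "rig_matrix E (c *\<^sub>R s) = c *\<^sub>R rig_matrix E s"
proof -
  have "framework_of_vec (s + s') = framework_of_vec s + framework_of_vec s'" "framework_of_vec (c *\<^sub>R s) = c *\<^sub>R framework_of_vec s"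
    by (simp_all add: framework_of_vec_def vec_eq_iff)
  then show "rig_matrix E (s + s') = rig_matrix E s + rig_matrix E s'" "rig_matrix E (c *\<^sub>R s) = c *\<^sub>R rig_matrix E s"
    by (simp_all add: rig_matrix_def equil_matrix_add equil_matrix_scale) (simp_all add: transpose_def vec_eq_iff)
qed

lemma has_derivative_lengths:
  "((\<lambda>s. rig_matrix E s *v s) has_derivative (\<lambda>h. 2 *\<^sub>R (rig_matrix E s *v h))) (at s within S)"
proof -
  have "bilinear (\<lambda>s h. rig_matrix E s *v h)"
    unfolding bilinear_def
    by (auto intro!: linearI simp: rig_matrix_add rig_matrix_scale matrix_vector_mult_add_rdistrib matrix_vector_right_distrib
        matrix_vector_mult_scaleR scaleR_matrix_vector_assoc[symmetric])
  then have bb: "bounded_bilinear (\<lambda>s h. rig_matrix E s *v h)" by (simp add: bilinear_conv_bounded_bilinear)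
  show ?thesis
    by (rule has_derivative_eq_rhs[OF bounded_bilinear.FDERIV[OF bb has_derivative_ident has_derivative_ident]])
       (simp add: fun_eq_iff rig_matrix_commute[of E _ s] scaleR_2)
qed

lemma has_vector_derivative_lengths:
  assumes "(\<gamma> has_vector_derivative v) (at t)"
  shows "((\<lambda>t. rig_matrix E (\<gamma> t) *v \<gamma> t) has_vector_derivative 2 *\<^sub>R (rig_matrix E (\<gamma> t) *v v)) (at t)"
  using has_derivative_compose[OF assms[unfolded has_vector_derivative_def] has_derivative_lengths]
  by (simp add: has_vector_derivative_def o_def matrix_vector_mult_scaleR mult.commute)

lemma length_sq_cong:
  assumes "graph E" "rig_matrix E s *v s = rig_matrix E s' *v s'"
  shows "length_sq E (framework_of_vec s) = length_sq E (framework_of_vec s')"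
proof
  fix e show "length_sq E (framework_of_vec s) e = length_sq E (framework_of_vec s') e"
  proof (cases "e \<in> E")
    case True
    then obtain u w where e: "e = {u, w}" using assms(1) by (auto simp: graph_def card_2_iff)
    have "(rig_matrix E s *v s) $ (u, w) = (rig_matrix E s' *v s') $ (u, w)" using assms(2) by simp
    then show ?thesis using True by (simp add: e length_sq_edge rig_matrix_mult power2_norm_eq_inner)
  qed (simp add: length_sq_def)
qed

lemma congruent_lengths:
  assumes "congruent_frameworks (framework_of_vec s) (framework_of_vec s')"
  shows "rig_matrix F s *v s = rig_matrix F s' *v s'"
proof -
  obtain g a where g: "orthogonal_transformation g" and T: "\<And>u. framework_of_vec s' $ u = g (framework_of_vec s $ u) + a"
    using assms by (auto simp: congruent_frameworks_def Eucl_def)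
  have "framework_of_vec s' $ u - framework_of_vec s' $ w = g (framework_of_vec s $ u - framework_of_vec s $ w)" for u w
    using linear_diff[OF orthogonal_transformation_linear[OF g]] by (simp add: T)
  then have "(framework_of_vec s' $ u - framework_of_vec s' $ w) \<bullet> (framework_of_vec s' $ u - framework_of_vec s' $ w)
      = (framework_of_vec s $ u - framework_of_vec s $ w) \<bullet> (framework_of_vec s $ u - framework_of_vec s $ w)" for u w
    using g by (simp only: orthogonal_transformation_def)
  then have "(rig_matrix F s *v s) $ k = (rig_matrix F s' *v s') $ k" for k by (cases k) (simp add: rig_matrix_mult)
  then show ?thesis by (simp add: vec_eq_iff)
qed

lemma kernel_dim_rig_matrix_minimal:
  fixes s s' :: "real ^ ('v::finite \<times> 'd::finite)"
  assumes "generic (framework_of_vec s)"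
  shows "dim {x. rig_matrix E s *v x = 0} \<le> dim {x. rig_matrix E s' *v x = 0}"
proof -
  obtain x :: "'v \<times> 'd \<Rightarrow> real" where x: "framework_of_coords x = framework_of_vec s'" using framework_of_coords_surj by blast
  have "ratpoly (\<lambda>x. transpose (equil_matrix E (framework_of_coords x)) $ i $ j)" for i j
    by (simp add: transpose_def ratpoly_equil_matrix)
  from generic_kernel_dim_minimal[where A = "\<lambda>x. transpose (equil_matrix E (framework_of_coords x))", OF assms this, of x] show ?thesis
    by (simp add: framework_of_coords_inverse x rig_matrix_def)
qed

text \<open>
  The rank of the rigidity matrix is constant near a generic framework. Hence an infinitesimal motion \<open>h\<close>
  is the velocity of a curve \<open>\<gamma>\<close> of frameworks with constant edge lengths.
\<close>

theorem globally_rigid_imp_infinitesimally_rigid: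
  fixes s h :: "real ^ ('v::finite \<times> 'd::finite)"
  assumes gen: "generic (framework_of_vec s)" and glob: "globally_rigid E (framework_of_vec s)" and E: "graph E"
    and h: "rig_matrix E s *v h = 0"
  shows "rig_matrix F s *v h = 0"
proof -
  obtain S where S: "card S = dim {x. rig_matrix E s *v x = 0}"
    "\<forall>x. rig_matrix E s *v x = 0 \<longrightarrow> (\<forall>i\<in>S. x $ i = 0) \<longrightarrow> x = 0"
    using kernel_coordinates[of "rig_matrix E s"] by blast
  define T where "T = transpose (rig_matrix E s)"
  define M where "M = (\<lambda>x. T ** rig_matrix E x + coord_proj S)"
  \<comment> \<open>The squared lengths, reduced by the transposed rigidity matrix at
    \<open>s\<close> and completed by the free coordinates. The factor 1/2 makes \<open>M x\<close>
    the derivative, which is invertible at \<open>s\<close>.\<close>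
  define \<Psi> where "\<Psi> = (\<lambda>x. (1/2) *\<^sub>R (T *v (rig_matrix E x *v x)) + coord_proj S *v x)"
  define f' where "f' = (\<lambda>x. Blinfun (\<lambda>k. M x *v k))"
  have f': "blinfun_apply (f' x) = (\<lambda>k. M x *v k)" for x
    unfolding f'_def by (rule bounded_linear_Blinfun_apply) simp
  have der: "(\<Psi> has_derivative blinfun_apply (f' x)) (at x)" for x
  proof -
    have 1: "((\<lambda>x. T *v (rig_matrix E x *v x)) has_derivative (\<lambda>k. T *v (2 *\<^sub>R (rig_matrix E x *v k)))) (at x)"
      by (rule bounded_linear.has_derivative[OF _ has_derivative_lengths]) simp
    have 2: "((\<lambda>x. coord_proj S *v x) has_derivative (\<lambda>k. coord_proj S *v k)) (at x)"
      by (simp add: bounded_linear_imp_has_derivative)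
    show ?thesis
      unfolding \<Psi>_def f' M_def
      by (rule has_derivative_eq_rhs[OF has_derivative_add[OF has_derivative_scaleR_right[OF 1] 2]])
         (simp add: fun_eq_iff matrix_vector_mult_scaleR matrix_vector_mult_add_rdistrib flip: matrix_vector_mul_assoc)
  qed
  have contf: "continuous_on UNIV f'"
  proof (rule continuous_on_blinfun_componentwise)
    fix k :: "real ^ ('v \<times> 'd)"
    have "M x *v k = T *v (rig_matrix E k *v x) + coord_proj S *v k" for x
      by (simp add: M_def matrix_vector_mult_add_rdistrib rig_matrix_commute[of E x] flip: matrix_vector_mul_assoc)
    then show "continuous_on UNIV (\<lambda>x. f' x k)"
      unfolding f'
      by (simp, intro continuous_on_add continuous_on_const
          bounded_linear.continuous_on[OF matrix_vector_mul_bounded_linear] continuous_on_id)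
  qed
  have detM: "det (M s) \<noteq> 0" unfolding M_def T_def det_gram_plus_proj using S(2) by blast
  then obtain Mi where Mi: "Mi ** M s = mat 1" by (metis invertible_det_nz invertible_left_inverse)
  have inv: "Blinfun (\<lambda>k. Mi *v k) o\<^sub>L f' s = id_blinfun"
    by (rule blinfun_eqI) (simp add: f' bounded_linear_Blinfun_apply matrix_vector_mul_assoc Mi)
  obtain U V g g' where U: "s \<in> U" and V: "open V" "\<Psi> s \<in> V" and hom: "homeomorphism U V \<Psi> g"
    and g': "\<And>y. y \<in> V \<Longrightarrow> (g has_derivative (g' y)) (at y)"
    and g'i: "\<And>y. y \<in> V \<Longrightarrow> g' y = Hilbert_Choice.inv (blinfun_apply (f' (g y)))"
    and bij: "\<And>y. y \<in> V \<Longrightarrow> bij (blinfun_apply (f' (g y)))"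
    by (rule inverse_function_theorem[OF open_UNIV der contf UNIV_I inv]) blast
  \<comment> \<open>The velocity of this curve solves the system of \<open>kernel_chart\<close>, so
    it stays in the kernel of the rigidity matrix of \<open>\<gamma> t\<close>; this keeps the edge
    lengths constant.\<close>
  define \<gamma> where "\<gamma> = (\<lambda>t. g (\<Psi> s + t *\<^sub>R (coord_proj S *v h)))"
  have "\<gamma> 0 = s" using hom U by (simp add: \<gamma>_def homeomorphism_def)
  obtain e where e: "e > 0" "\<And>t. \<bar>t\<bar> < e \<Longrightarrow> \<Psi> s + t *\<^sub>R (coord_proj S *v h) \<in> V"
  proof -
    have "open ((\<lambda>t. \<Psi> s + t *\<^sub>R (coord_proj S *v h)) -` V)"
      by (intro open_vimage V continuous_intros)
    moreover have "0 \<in> (\<lambda>t. \<Psi> s + t *\<^sub>R (coord_proj S *v h)) -` V" using V by simp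
    ultimately obtain e where "e > 0" "ball 0 e \<subseteq> (\<lambda>t. \<Psi> s + t *\<^sub>R (coord_proj S *v h)) -` V"
      using open_contains_ball by blast
    then show ?thesis using that by (auto simp: subset_iff)
  qed
  define v where "v = (\<lambda>t. g' (\<Psi> s + t *\<^sub>R (coord_proj S *v h)) (coord_proj S *v h))"
  have d\<gamma>: "(\<gamma> has_vector_derivative v t) (at t)" if t: "\<bar>t\<bar> < e" for t
  proof -
    have 1: "((\<lambda>t. \<Psi> s + t *\<^sub>R (coord_proj S *v h)) has_derivative (\<lambda>k. k *\<^sub>R (coord_proj S *v h))) (at t)"
      by (auto intro!: derivative_eq_intros)
    note 2 = has_derivative_compose[OF 1 g'[OF e(2)[OF t]]]
    moreover have "linear (g' (\<Psi> s + t *\<^sub>R (coord_proj S *v h)))"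
      using g'[OF e(2)[OF t]] has_derivative_linear by blast
    ultimately show ?thesis
      by (simp add: has_vector_derivative_def \<gamma>_def v_def linear_scale)
  qed
  have Mv: "M (\<gamma> t) *v v t = coord_proj S *v h" "det (M (\<gamma> t)) \<noteq> 0" if t: "\<bar>t\<bar> < e" for t
  proof -
    have b: "bij (\<lambda>k. M (\<gamma> t) *v k)" using bij[OF e(2)[OF t]] by (simp add: f' \<gamma>_def)
    have "v t = Hilbert_Choice.inv (\<lambda>k. M (\<gamma> t) *v k) (coord_proj S *v h)"
      using g'i[OF e(2)[OF t]] by (simp add: v_def \<gamma>_def f')
    then show "M (\<gamma> t) *v v t = coord_proj S *v h"
      using b by (simp add: bij_is_surj surj_f_inv_f[of "\<lambda>k. M (\<gamma> t) *v k"])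
    show "det (M (\<gamma> t)) \<noteq> 0"
      using b by (metis bij_is_inj invertible_det_nz invertible_left_inverse matrix_left_invertible_injective)
  qed
  have Rv: "rig_matrix E (\<gamma> t) *v v t = 0" if t: "\<bar>t\<bar> < e" for t
  proof (rule kernel_chart)
    show "det (T ** rig_matrix E (\<gamma> t) + coord_proj S) \<noteq> 0" using Mv(2)[OF t] by (simp add: M_def)
    show "card S \<le> dim {x. rig_matrix E (\<gamma> t) *v x = 0}" unfolding S(1) by (rule kernel_dim_rig_matrix_minimal[OF gen])
    show "(T ** rig_matrix E (\<gamma> t) + coord_proj S) *v v t = coord_proj S *v h" using Mv(1)[OF t] by (simp add: M_def)
  qed
  have const: "rig_matrix E (\<gamma> t) *v \<gamma> t = rig_matrix E s *v s" if t: "\<bar>t\<bar> < e" for t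
  proof -
    have "((\<lambda>t. rig_matrix E (\<gamma> t) *v \<gamma> t) has_derivative (\<lambda>h. 0)) (at u within {-e<..<e})" if "u \<in> {-e<..<e}" for u
      using has_vector_derivative_lengths[OF d\<gamma>[of u], of E] Rv[of u] that
      by (auto simp: has_vector_derivative_def abs_less_iff intro: has_derivative_at_withinI)
    then obtain c where "\<forall>u\<in>{-e<..<e}. rig_matrix E (\<gamma> u) *v \<gamma> u = c"
      using has_derivative_zero_constant[of "{-e<..<e}" "\<lambda>t. rig_matrix E (\<gamma> t) *v \<gamma> t"] by auto
    then show ?thesis using t e(1) \<open>\<gamma> 0 = s\<close> by (metis abs_less_iff abs_zero greaterThanLessThan_iff minus_less_iff)
  qed
  \<comment> \<open>Global rigidity makes \<open>\<gamma> t\<close> congruent to \<open>s\<close>,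
    so the distances of all pairs are constant, not only those along edges.\<close>
  have constF: "rig_matrix F (\<gamma> t) *v \<gamma> t = rig_matrix F s *v s" if t: "\<bar>t\<bar> < e" for t
  proof -
    have "length_sq E (framework_of_vec (\<gamma> t)) = length_sq E (framework_of_vec s)" using length_sq_cong[OF E const[OF t]] .
    then show ?thesis using glob congruent_lengths[of s "\<gamma> t" F] by (simp add: globally_rigid_def)
  qed
  have "v 0 = h"
  proof -
    have "M s *v v 0 = M s *v h"
      using Mv(1)[of 0] e(1) \<open>\<gamma> 0 = s\<close> h
      by (simp add: M_def matrix_vector_mult_add_rdistrib flip: matrix_vector_mul_assoc)
    then show ?thesis by (metis Mi matrix_vector_mul_assoc matrix_vector_mul_lid)
  qed
  have 1: "((\<lambda>t. rig_matrix F (\<gamma> t) *v \<gamma> t) has_vector_derivative 2 *\<^sub>R (rig_matrix F s *v h)) (at 0)"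
    using has_vector_derivative_lengths[OF d\<gamma>[of 0], of F] e(1) by (simp add: \<open>\<gamma> 0 = s\<close> \<open>v 0 = h\<close>)
  have 2: "((\<lambda>t. rig_matrix F (\<gamma> t) *v \<gamma> t) has_vector_derivative 0) (at 0)"
    by (rule has_vector_derivative_transform_within_open[where S = "{-e<..<e}" and f = "\<lambda>_. rig_matrix F s *v s"])
       (use e(1) constF in \<open>auto simp: abs_less_iff\<close>)
  show ?thesis using vector_derivative_unique_at[OF 1 2] by simp
qed

section \<open>Contact loci\<close>

lemma bilinear_edge_form: "bilinear (edge_form E)"
  unfolding bilinear_def by (auto intro!: linearI simp: edge_form_def vec_eq_iff algebra_simps)

lemma edge_form_commute: "edge_form E x y = edge_form E y x"
  by (simp add: edge_form_def vec_eq_iff)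

lemma edge_form_simps:
  "edge_form E (x + x') y = edge_form E x y + edge_form E x' y"
  "edge_form E x (y + y') = edge_form E x y + edge_form E x y'"
  "edge_form E (c *\<^sub>R x) y = c *\<^sub>R edge_form E x y"
  "edge_form E x (c *\<^sub>R y) = c *\<^sub>R edge_form E x y"
  "edge_form E (sum g S) y = (\<Sum>i\<in>S. edge_form E (g i) y)"
  "edge_form E x (sum g S) = (\<Sum>i\<in>S. edge_form E x (g i))"
proof -
  have l: "linear (\<lambda>x. edge_form E x y)" and r: "linear (edge_form E x)" for x y
    using bilinear_edge_form[of E] by (auto simp: bilinear_def)
  show "edge_form E (x + x') y = edge_form E x y + edge_form E x' y"
    "edge_form E x (y + y') = edge_form E x y + edge_form E x y'"
    "edge_form E (c *\<^sub>R x) y = c *\<^sub>R edge_form E x y"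
    "edge_form E x (c *\<^sub>R y) = c *\<^sub>R edge_form E x y"
    "edge_form E (sum g S) y = (\<Sum>i\<in>S. edge_form E (g i) y)"
    "edge_form E x (sum g S) = (\<Sum>i\<in>S. edge_form E x (g i))"
    by (simp_all add: linear_add[OF l] linear_add[OF r] linear_scale[OF l] linear_scale[OF r]
        linear_sum[OF l] linear_sum[OF r])
qed

lemma edge_form_const: "edge_form E (\<chi> u. c) y = 0"
  by (simp add: edge_form_def vec_eq_iff)

lemma rig_matrix_edge_form: "rig_matrix E s *v h = (\<Sum>i\<in>UNIV. edge_form E (coord_vec (framework_of_vec s) i) (coord_vec (framework_of_vec h) i))"
proof -
  have "(rig_matrix E s *v h) $ k = (\<Sum>i\<in>UNIV. edge_form E (coord_vec (framework_of_vec s) i) (coord_vec (framework_of_vec h) i)) $ k" for k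
    by (cases k) (simp add: rig_matrix_mult edge_form_def coord_vec_def inner_vec_def)
  then show ?thesis by (simp add: vec_eq_iff)
qed

text \<open>All distances determine the Gram matrix: after subtracting the values at a base vertex
  \<open>u0\<close>, pairs with \<open>u0\<close> show that the form \<open>Q\<close> vanishes on
  the diagonal, and the other pairs that its symmetric part vanishes. Independence modulo constants
  then strips off the vectors on both sides.\<close>

lemma edge_form_UNIV_independent:
  fixes w :: "nat \<Rightarrow> real ^ 'v::finite"
  assumes ind: "\<And>a c i. (\<Sum>i<n. a i *\<^sub>R w i) = (\<chi> u. c) \<Longrightarrow> i < n \<Longrightarrow> a i = 0"
    and C: "(\<Sum>i<n. \<Sum>j<n. C i j *\<^sub>R edge_form UNIV (w i) (w j)) = 0"
    and ij: "i < n" "j < n"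
  shows "C i j + C j i = 0"
proof -
  fix u0 :: 'v
  define z where "z = (\<lambda>i u. w i $ u - w i $ u0)"
  define Q where "Q = (\<lambda>u v. \<Sum>i<n. \<Sum>j<n. C i j * (z i u * z j v))"
  have Q4: "Q u u + Q v v - Q u v - Q v u = 0" for u v
  proof -
    have "0 = (\<Sum>i<n. \<Sum>j<n. C i j *\<^sub>R edge_form UNIV (w i) (w j)) $ (u, v)" using C by simp
    also have "\<dots> = (\<Sum>i<n. \<Sum>j<n. C i j * ((z i u - z i v) * (z j u - z j v)))"
      by (simp add: edge_form_def z_def)
    also have "\<dots> = Q u u + Q v v - Q u v - Q v u"
      unfolding Q_def sum.distrib[symmetric] sum_subtractf[symmetric]
      by (intro sum.cong refl) (simp add: algebra_simps)
    finally show ?thesis by simp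
  qed
  have "Q u u = 0" for u
    using Q4[of u u0] by (simp add: Q_def z_def)
  then have Q2: "Q u v + Q v u = 0" for u v using Q4[of u v] by simp
  define D where "D = (\<lambda>i j. C i j + C j i)"
  have const: "a i = 0" if "\<And>u. (\<Sum>i<n. a i * z i u) = 0" "i < n" for a i
  proof -
    have "(\<Sum>i<n. a i *\<^sub>R w i) $ u = (\<Sum>i<n. a i * w i $ u0)" for u
      using that(1)[of u] by (simp add: z_def right_diff_distrib sum_subtractf)
    then have "(\<Sum>i<n. a i *\<^sub>R w i) = (\<chi> u. \<Sum>i<n. a i * w i $ u0)" by (simp add: vec_eq_iff)
    then show ?thesis using ind that(2) by blast
  qed
  have "(\<Sum>i<n. (\<Sum>j<n. D i j * z j v) * z i u) = 0" for u v
  proof -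
    have "Q v u = (\<Sum>i<n. \<Sum>j<n. C j i * (z j v * z i u))" unfolding Q_def by (rule sum.swap)
    then have "Q u v + Q v u = (\<Sum>i<n. \<Sum>j<n. D i j * (z i u * z j v))"
      unfolding Q_def sum.distrib[symmetric] D_def by (simp add: algebra_simps sum.distrib)
    then have "0 = (\<Sum>i<n. \<Sum>j<n. D i j * (z i u * z j v))" using Q2[of u v] by simp
    also have "\<dots> = (\<Sum>i<n. (\<Sum>j<n. D i j * z j v) * z i u)"
      unfolding sum_distrib_right by (intro sum.cong refl) simp
    finally show ?thesis by simp
  qed
  then have "(\<Sum>j<n. D i j * z j v) = 0" for v
    using const[of "\<lambda>i. \<Sum>j<n. D i j * z j v" i] ij by blast
  then have "D i j = 0" using const[of "D i" j] ij by blast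
  then show ?thesis by (simp add: D_def)
qed

text \<open>By \<open>generic_kernel_dim_minimal\<close> one framework suffices: \<open>d\<close>
  vertices at the unit vectors and the others at the origin.\<close>

lemma generic_affinely_independent:
  fixes \<rho> :: "real ^ 'd::finite ^ 'v::finite"
  assumes gen: "generic \<rho>" and card: "CARD('v) \<ge> CARD('d) + 1"
    and eq: "(\<Sum>i\<in>UNIV. a i *\<^sub>R coord_vec \<rho> i) = (\<chi> u. c)"
  shows "a i = 0" "c = 0"
proof -
  define A :: "('v \<times> 'd \<Rightarrow> real) \<Rightarrow> real ^ ('d option) ^ 'v"
    where "A = (\<lambda>x. \<chi> u j. case j of None \<Rightarrow> 1 | Some i \<Rightarrow> x (u, i))"
  have UNIV_opt: "(UNIV :: 'd option set) = insert None (range Some)" by (auto simp: UNIV_option_conv)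
  have A_mult: "(A x *v z) $ u = z $ None + (\<Sum>i\<in>UNIV. x (u, i) * z $ Some i)" for x z u
    by (simp add: matrix_vector_mult_def A_def UNIV_opt sum.reindex)
  have "card (UNIV :: 'd option set) \<le> card (UNIV :: 'v set)" using card by (simp add: card_UNIV_option)
  then obtain p :: "'d option \<Rightarrow> 'v" where p: "inj p"
    using inj_on_iff_card_le[of "UNIV :: 'd option set" "UNIV :: 'v set"] by auto
  define x0 where "x0 = (\<lambda>(u, i :: 'd). if u = p (Some i) then 1 else (0::real))"
  have "z = 0" if "A x0 *v z = 0" for z
  proof -
    have x0p: "x0 (p j, i) = (if j = Some i then 1 else 0)" for j i
      using p by (simp add: x0_def inj_eq)
    have N: "z $ None = 0"
      using arg_cong[OF that, of "\<lambda>v. v $ p None"] by (simp add: A_mult x0p)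
    have "z $ Some i = 0" for i
      using arg_cong[OF that, of "\<lambda>v. v $ p (Some i)"] N
      by (simp add: A_mult x0p if_distrib[of "\<lambda>y. y * _"] cong: if_cong)
    then have "z $ j = 0" for j using N by (cases j) auto
    then show "z = 0" by (simp add: vec_eq_iff)
  qed
  then have "{z. A x0 *v z = 0} \<subseteq> {0}" by auto
  then have d0: "dim {z. A x0 *v z = 0} = 0" by (simp add: dim_eq_0)
  have rA: "ratpoly (\<lambda>x. A x $ u $ j)" for u j
    by (cases j) (auto simp: A_def intro: ratpoly_1 ratpoly_var)
  have "dim {z. A (\<lambda>(u, i). \<rho> $ u $ i) *v z = 0} = 0"
    using generic_kernel_dim_minimal[OF gen rA, of x0] d0 by linarith
  then have ker: "z = 0" if "A (\<lambda>(u, i). \<rho> $ u $ i) *v z = 0" for z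
    using that by (auto simp: dim_eq_0)
  define z :: "real ^ ('d option)" where "z = (\<chi> j. case j of None \<Rightarrow> - c | Some i \<Rightarrow> a i)"
  have "(A (\<lambda>(u, i). \<rho> $ u $ i) *v z) $ u = 0" for u
    using arg_cong[OF eq, of "\<lambda>v. v $ u"] by (simp add: A_mult z_def coord_vec_def mult.commute)
  then have "z = 0" by (intro ker) (simp add: vec_eq_iff)
  then have "z $ None = 0" "z $ Some i = 0" by simp_all
  then show "a i = 0" "c = 0" by (simp_all add: z_def)
qed

lemma stress_kernel_dim_ge:
  fixes \<rho> :: "real ^ 'd::finite ^ 'v::finite"
  assumes gen: "generic \<rho>" and card: "CARD('v) \<ge> CARD('d) + 1"
    and \<Omega>: "equilibrium_stress_matrix E \<rho> \<Omega>"
  shows "CARD('d) + 1 \<le> stress_kernel_dim \<Omega>"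
proof -
  let ?K = "{x. \<Omega> *v x = 0}"
  define F :: "real ^ ('d option) \<Rightarrow> real ^ 'v"
    where "F = (\<lambda>z. (\<chi> u. z $ None) + (\<Sum>i\<in>UNIV. z $ Some i *\<^sub>R coord_vec \<rho> i))"
  have linF: "linear F"
    by (rule linearI) (simp_all add: F_def vec_eq_iff algebra_simps sum.distrib sum_distrib_left)
  have "inj F"
    unfolding linear_injective_0[OF linF]
  proof (intro allI impI)
    fix z assume "F z = 0"
    then have "(\<Sum>i\<in>UNIV. z $ Some i *\<^sub>R coord_vec \<rho> i) = (\<chi> u. - z $ None)"
      by (simp add: F_def vec_eq_iff eq_neg_iff_add_eq_0 add.commute)
    from generic_affinely_independent[OF gen card this]
    have "z $ j = 0" for j by (cases j) auto
    then show "z = 0" by (simp add: vec_eq_iff)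
  qed
  have one: "\<Omega> *v (\<chi> u. c) = 0" for c
  proof -
    have "(\<Sum>w\<in>UNIV. \<Omega> $ u $ w * c) = 0" for u
      using \<Omega> by (simp add: equilibrium_stress_matrix_def flip: sum_distrib_right)
    then show ?thesis by (simp add: vec_eq_iff matrix_vector_mult_def)
  qed
  have col: "\<Omega> *v coord_vec \<rho> i = 0" for i
  proof -
    have "(\<Sum>w\<in>UNIV. \<Omega> $ u $ w *\<^sub>R \<rho> $ w) $ i = 0" for u
      using \<Omega> by (simp add: equilibrium_stress_matrix_def)
    then show ?thesis by (simp add: vec_eq_iff matrix_vector_mult_def coord_vec_def)
  qed
  have "range F \<subseteq> ?K"
    by (auto simp: F_def matrix_vector_right_distrib one matrix_vector_mult_scaleR
        linear_sum[OF matrix_vector_mul_linear] col)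
  then have "dim (range F) \<le> dim ?K" by (rule dim_subset)
  moreover have "dim (range F) = CARD('d) + 1"
    using dim_image_eq[OF linF, of UNIV] \<open>inj F\<close> by (simp add: card_UNIV_option)
  ultimately show ?thesis by (simp add: stress_kernel_dim_def)
qed

text \<open>\<open>\<rho>\<close> and \<open>\<Omega>\<close> show that the minimum is attained. It
  is at least \<open>d + 1\<close> by \<open>stress_kernel_dim_ge\<close>, so if it differs from
  \<open>d + 1\<close> it is at least \<open>d + 2\<close>.\<close>

lemma nonminimal_stress_kernel_dim_ge:
  fixes \<rho> :: "real ^ 'd::finite ^ 'v::finite"
  assumes gen: "generic \<rho>" and card: "CARD('v) \<ge> CARD('d) + 1"
    and nonmin: "\<not> minimal_stress_kernel E TYPE('d)"
    and \<Omega>: "equilibrium_stress_matrix E \<rho> \<Omega>"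
  shows "CARD('d) + 2 \<le> stress_kernel_dim \<Omega>"
proof -
  let ?P = "\<lambda>k. \<exists>(\<rho> :: real ^ 'd ^ 'v) \<Omega>.
        generic \<rho> \<and> equilibrium_stress_matrix E \<rho> \<Omega> \<and> k = stress_kernel_dim \<Omega>"
  have k: "k_min E TYPE('d) = (LEAST k. ?P k)" by (simp add: k_min_def)
  have P: "?P (stress_kernel_dim \<Omega>)" using gen \<Omega> by blast
  then have "?P (LEAST k. ?P k)" by (rule LeastI)
  then obtain \<sigma> :: "real ^ 'd ^ 'v" and \<Omega>' where
    "generic \<sigma>" "equilibrium_stress_matrix E \<sigma> \<Omega>'" "k_min E TYPE('d) = stress_kernel_dim \<Omega>'"
    unfolding k by blast
  then have "CARD('d) + 1 \<le> k_min E TYPE('d)"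
    using stress_kernel_dim_ge[OF _ card] by metis
  moreover have "k_min E TYPE('d) \<noteq> CARD('d) + 1" using nonmin by (simp add: minimal_stress_kernel_def)
  moreover have "k_min E TYPE('d) \<le> stress_kernel_dim \<Omega>" unfolding k using P by (rule Least_le)
  ultimately show ?thesis by simp
qed

text \<open>Edge forms do not see translations, so a basis of \<open>K\<close> modulo constants is
  wanted, of size \<open>n = dim K - 1\<close>. It starts with the coordinates of
  \<open>\<rho>\<close>, which makes \<open>\<rho>\<close> the matrix \<open>Idm\<close>.\<close>

lemma contact_locus_basis:
  fixes \<rho> :: "real ^ 'd::finite ^ 'v::finite" and K :: "(real ^ 'v) set"
  assumes gen: "generic \<rho>" and card: "CARD('v) \<ge> CARD('d) + 1"
    and K: "subspace K" "(\<chi> u. 1) \<in> K" "\<And>i. coord_vec \<rho> i \<in> K" and dimK: "CARD('d) + 2 \<le> dim K"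
    and \<delta>: "bij_betw \<delta> {..<CARD('d)} (UNIV :: 'd set)"
  shows "\<exists>(w :: nat \<Rightarrow> real ^ 'v) n. CARD('d) < n \<and>
    (\<forall>j<CARD('d). w j = coord_vec \<rho> (\<delta> j)) \<and>
    (\<forall>a c. (\<Sum>i<n. a i *\<^sub>R w i) = (\<chi> u. c) \<longrightarrow> (\<forall>i<n. a i = 0)) \<and>
    K \<subseteq> span (insert (\<chi> u. 1) (w ` {..<n})) \<and> w ` {..<n} \<subseteq> K"
proof -
  let ?d = "CARD('d)"
  define one :: "real ^ 'v" where "one = (\<chi> u. 1)"
  have onec: "(\<chi> u. c) = c *\<^sub>R one" for c by (simp add: one_def vec_eq_iff)
  define B where "B = insert one (range (coord_vec \<rho>))"
  have aff: "a i = 0" "c = 0" if "(\<Sum>i\<in>UNIV. a i *\<^sub>R coord_vec \<rho> i) = c *\<^sub>R one" for a c i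
    using generic_affinely_independent[OF gen card, of a c] that by (simp_all add: onec)
  have inj: "inj (coord_vec \<rho>)"
  proof (rule injI, rule ccontr)
    fix i j assume eq: "coord_vec \<rho> i = coord_vec \<rho> j" and ne: "i \<noteq> j"
    have "(\<Sum>l\<in>UNIV. ((if l = i then 1 else 0) - (if l = j then 1 else 0)) *\<^sub>R coord_vec \<rho> l) = 0 *\<^sub>R one"
      using eq by (simp add: scaleR_diff_left sum_subtractf if_distrib[of "\<lambda>x. x *\<^sub>R _"] cong: if_cong)
    from aff(1)[OF this, of i] ne show False by simp
  qed
  have one_notin: "one \<notin> range (coord_vec \<rho>)"
  proof
    assume "one \<in> range (coord_vec \<rho>)"
    then obtain j where "coord_vec \<rho> j = one" by auto
    then have "(\<Sum>l\<in>UNIV. (if l = j then 1 else 0) *\<^sub>R coord_vec \<rho> l) = 1 *\<^sub>R one"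
      by (simp add: if_distrib[of "\<lambda>x. x *\<^sub>R _"] cong: if_cong)
    from aff(2)[OF this] show False by simp
  qed
  have cardB: "card B = ?d + 1" and finB: "finite B"
    using one_notin inj by (simp_all add: B_def card_image)
  have indB: "independent B"
  proof (rule independent_if_scalars_zero[OF finB])
    fix g x assume 0: "(\<Sum>x\<in>B. g x *\<^sub>R x) = 0" and x: "x \<in> B"
    have "(\<Sum>x\<in>B. g x *\<^sub>R x) = g one *\<^sub>R one + (\<Sum>i\<in>UNIV. g (coord_vec \<rho> i) *\<^sub>R coord_vec \<rho> i)"
      unfolding B_def using one_notin by (simp add: sum.reindex[OF inj])
    then have "(\<Sum>i\<in>UNIV. g (coord_vec \<rho> i) *\<^sub>R coord_vec \<rho> i) = (- g one) *\<^sub>R one"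
      using 0 by (simp add: eq_neg_iff_add_eq_0 add.commute)
    from aff(1)[OF this] aff(2)[OF this] show "g x = 0" using x by (auto simp: B_def)
  qed
  have "B \<subseteq> K" using K by (auto simp: B_def one_def)
  then obtain C where C: "B \<subseteq> C" "C \<subseteq> K" "independent C" "K \<subseteq> span C"
    using maximal_independent_subset_extend[OF _ indB] by blast
  have finC: "finite C" using C(3) by (rule independent_imp_finite)
  have cardC: "card C = dim K" using basis_card_eq_dim[OF C(2) C(4) C(3)] .
  define n where "n = dim K - 1"
  have dn: "?d < n" using dimK by (simp add: n_def)
  have "card (C - B) = n - ?d" using C(1) finB cardB cardC by (simp add: card_Diff_subset n_def)
  then obtain h where h: "bij_betw h {..<n - ?d} (C - B)"
    using finC by (metis bij_betw_iff_card card_lessThan finite_Diff finite_lessThan)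
  define w where "w = (\<lambda>i. if i < ?d then coord_vec \<rho> (\<delta> i) else h (i - ?d))"
  have b1: "bij_betw w {..<?d} (range (coord_vec \<rho>))"
  proof -
    have "bij_betw (coord_vec \<rho> \<circ> \<delta>) {..<?d} (range (coord_vec \<rho>))"
      using \<delta> inj by (intro bij_betw_trans) (auto simp: bij_betw_def)
    then show ?thesis by (rule bij_betw_cong[THEN iffD1, rotated]) (simp add: w_def)
  qed
  have b2: "bij_betw w {?d..<n} (C - B)"
  proof -
    have "bij_betw (\<lambda>i. i - ?d) {?d..<n} {..<n - ?d}"
      by (rule bij_betw_byWitness[of _ "\<lambda>i. i + ?d"]) auto
    from bij_betw_trans[OF this h] show ?thesis
      by (rule bij_betw_cong[THEN iffD1, rotated]) (simp add: w_def)
  qed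
  have "bij_betw w ({..<?d} \<union> {?d..<n}) (range (coord_vec \<rho>) \<union> (C - B))"
    using b1 b2 by (rule bij_betw_combine) (auto simp: B_def)
  moreover have "{..<?d} \<union> {?d..<n} = {..<n}" using dn by auto
  moreover have "range (coord_vec \<rho>) \<union> (C - B) = C - {one}" using C(1) one_notin by (auto simp: B_def)
  ultimately have bw: "bij_betw w {..<n} (C - {one})" by simp
  have oneC: "one \<in> C" using C(1) by (auto simp: B_def)
  have ind: "a i = 0" if eq: "(\<Sum>i<n. a i *\<^sub>R w i) = (\<chi> u. c)" and i: "i < n" for a c i
  proof -
    define g where "g = (\<lambda>x. if x = one then - c else a (the_inv_into {..<n} w x))"
    have gw: "g (w i) = a i" if "i < n" for i
      using bw that by (auto simp: g_def bij_betw_def the_inv_into_f_f)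
    have "(\<Sum>x\<in>C. g x *\<^sub>R x) = g one *\<^sub>R one + (\<Sum>x\<in>C - {one}. g x *\<^sub>R x)"
      using finC oneC by (rule sum.remove)
    also have "(\<Sum>x\<in>C - {one}. g x *\<^sub>R x) = (\<Sum>i<n. g (w i) *\<^sub>R w i)"
      by (rule sum.reindex_bij_betw[OF bw, symmetric])
    also have "\<dots> = c *\<^sub>R one" using eq by (simp add: gw onec)
    finally have "(\<Sum>x\<in>C. g x *\<^sub>R x) = 0" by (simp add: g_def)
    moreover have "w i \<in> C" using bw i by (auto simp: bij_betw_def)
    ultimately have "g (w i) = 0" by (rule independentD[OF C(3) finC order_refl])
    then show ?thesis using gw[OF i] by simp
  qed
  have "C = insert one (w ` {..<n})" using bw oneC by (auto simp: bij_betw_def)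
  then have "K \<subseteq> span (insert (\<chi> u. 1) (w ` {..<n}))" using C(4) by (simp add: one_def)
  moreover have "w ` {..<n} \<subseteq> K" using bw C(2) by (auto simp: bij_betw_def)
  moreover have "\<forall>j<?d. w j = coord_vec \<rho> (\<delta> j)" by (simp add: w_def)
  moreover have "\<forall>a c. (\<Sum>i<n. a i *\<^sub>R w i) = (\<chi> u. c) \<longrightarrow> (\<forall>i<n. a i = 0)"
    by (intro allI impI) (rule ind)
  ultimately show ?thesis
    by (intro exI[of _ w] exI[of _ n] conjI dn)
qed

text \<open>The component \<open>\<eta>\<close> of an edge form orthogonal to \<open>span Z\<close>
  satisfies the hypothesis of \<open>contact_locus_flat\<close>, by summation by parts. So
  \<open>\<eta>\<close> is orthogonal to all squares from the kernel, by polarization to all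
  products, and finally to itself.\<close>

lemma contact_locus_span:
  fixes \<rho> :: "real ^ 'd::finite ^ 'v::finite"
  assumes gen: "generic \<rho>"
    and \<omega>: "equil_matrix E \<rho> *v \<omega> = 0"
    and min: "\<And>\<omega>'. equil_matrix E \<rho> *v \<omega>' = 0 \<Longrightarrow> dim {x. laplacian E \<omega> *v x = 0} \<le> dim {x. laplacian E \<omega>' *v x = 0}"
    and W: "W \<subseteq> {x. laplacian E \<omega> *v x = 0}" "{x. laplacian E \<omega> *v x = 0} \<subseteq> span (insert (\<chi> u. 1) W)"
    and Z: "\<And>x i. x \<in> W \<Longrightarrow> edge_form E x (coord_vec \<rho> i) \<in> span Z"
    and xy: "x \<in> W" "y \<in> W"
  shows "edge_form E x y \<in> span Z"
proof -
  let ?K = "{x. laplacian E \<omega> *v x = 0}"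
  obtain p \<eta> where p: "p \<in> span Z" and \<eta>: "\<And>z. z \<in> span Z \<Longrightarrow> orthogonal \<eta> z"
    and pq: "edge_form E x y = p + \<eta>"
    using orthogonal_subspace_decomp_exists[of Z "edge_form E x y"] by metis
  have orth: "x \<bullet> (laplacian E \<eta> *v coord_vec \<rho> i) = 0" if "x \<in> ?K" for x i
  proof -
    have "x \<in> span (insert (\<chi> u. 1) W)" using that W by blast
    then show ?thesis
    proof (induction rule: span_induct_alt)
      case base
      then show ?case by simp
    next
      case (step c x' y')
      have "\<eta> \<bullet> edge_form E x' (coord_vec \<rho> i) = 0"
        using step(1) \<eta>[OF Z[of x' i]] by (auto simp: edge_form_const orthogonal_def)
      then show ?case using step(2) by (simp add: edge_form_inner inner_add_left)
    qed
  qed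
  have diag: "\<eta> \<bullet> edge_form E x x = 0" if "laplacian E \<omega> *v x = 0" for x
    unfolding edge_form_inner by (rule contact_locus_flat[OF gen \<omega> min orth that]) simp_all
  have K: "laplacian E \<omega> *v x = 0" "laplacian E \<omega> *v y = 0" using W(1) xy by auto
  then have "laplacian E \<omega> *v (x + y) = 0" by (simp add: matrix_vector_right_distrib)
  then have "\<eta> \<bullet> edge_form E (x + y) (x + y) = 0" by (rule diag)
  moreover have "\<eta> \<bullet> edge_form E (x + y) (x + y)
      = \<eta> \<bullet> edge_form E x x + \<eta> \<bullet> edge_form E x y + (\<eta> \<bullet> edge_form E x y + \<eta> \<bullet> edge_form E y y)"
    by (simp only: edge_form_simps inner_add_right edge_form_commute[of E y x])
  ultimately have "\<eta> \<bullet> edge_form E x y = 0" using diag[OF K(1)] diag[OF K(2)] by simp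
  moreover have "\<eta> \<bullet> p = 0" using \<eta>[OF p] by (simp add: orthogonal_def)
  ultimately have "\<eta> \<bullet> \<eta> = 0" by (simp add: pq inner_add_right)
  then show ?thesis using p pq by simp
qed

theorem theorem1p14:
  fixes E :: "'v::finite set set" and \<rho> :: "real ^ 'd::finite ^ 'v"
  assumes "graph E"
    and "CARD('v) \<ge> CARD('d) + 2"
    and "\<not> minimal_stress_kernel E TYPE('d)"
    and "generic \<rho>"
  shows "\<not> globally_rigid E \<rho>"
proof
  assume glob: "globally_rigid E \<rho>"
  note gen = assms(4)
  have card: "CARD('v) \<ge> CARD('d) + 1" using assms(2) by simp
  obtain s :: "real ^ ('v \<times> 'd)" where s: "framework_of_vec s = \<rho>" using framework_of_vec_surj by blast
  have inf_rigid: "rig_matrix F s *v h = 0" if "rig_matrix E s *v h = 0" for F h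
    using globally_rigid_imp_infinitesimally_rigid[of s E h F] gen glob assms(1) that by (simp add: s)
  obtain \<omega> where \<omega>: "equil_matrix E \<rho> *v \<omega> = 0"
    and min: "\<And>\<omega>'. equil_matrix E \<rho> *v \<omega>' = 0 \<Longrightarrow> dim {x. laplacian E \<omega> *v x = 0} \<le> dim {x. laplacian E \<omega>' *v x = 0}"
    using ex_has_least_nat[of "\<lambda>\<omega>. equil_matrix E \<rho> *v \<omega> = 0" 0 "\<lambda>\<omega>. dim {x. laplacian E \<omega> *v x = 0}"] by auto
  let ?K = "{x. laplacian E \<omega> *v x = 0}"
  let ?d = "CARD('d)"
  have dimK: "?d + 2 \<le> dim ?K"
    using nonminimal_stress_kernel_dim_ge[OF gen card assms(3) equilibrium_stress_laplacian[OF \<omega>]]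
    by (simp add: stress_kernel_dim_def)
  obtain \<delta> where \<delta>: "bij_betw \<delta> {..<?d} (UNIV :: 'd set)"
    by (metis bij_betw_iff_card card_lessThan finite finite_lessThan)
  have "coord_vec \<rho> i \<in> ?K" for i using \<omega> by (simp add: equil_matrix_eq_0_iff)
  moreover have "(\<chi> u. 1) \<in> ?K" by (simp add: vec_eq_iff laplacian_mult)
  ultimately have "\<exists>(w :: nat \<Rightarrow> real ^ 'v) n. ?d < n \<and>
    (\<forall>j<?d. w j = coord_vec \<rho> (\<delta> j)) \<and>
    (\<forall>a c. (\<Sum>i<n. a i *\<^sub>R w i) = (\<chi> u. c) \<longrightarrow> (\<forall>i<n. a i = 0)) \<and>
    ?K \<subseteq> span (insert (\<chi> u. 1) (w ` {..<n})) \<and> w ` {..<n} \<subseteq> ?K"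
    by (intro contact_locus_basis[OF gen card subspace_kernel_matrix _ _ dimK \<delta>])
  then obtain w :: "nat \<Rightarrow> real ^ 'v" and n where dn: "?d < n"
    and w\<rho>_all: "\<forall>j<?d. w j = coord_vec \<rho> (\<delta> j)"
    and ind_all: "\<forall>a c. (\<Sum>i<n. a i *\<^sub>R w i) = (\<chi> u. c) \<longrightarrow> (\<forall>i<n. a i = 0)"
    and Kspan: "?K \<subseteq> span (insert (\<chi> u. 1) (w ` {..<n}))" and wK: "w ` {..<n} \<subseteq> ?K"
    by (elim exE conjE)
  have w\<rho>: "w j = coord_vec \<rho> (\<delta> j)" if "j < ?d" for j using w\<rho>_all that by simp
  have ind: "a i = 0" if "(\<Sum>i<n. a i *\<^sub>R w i) = (\<chi> u. c)" "i < n" for a c i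
    using ind_all that by blast
  have rig_sum: "rig_matrix F s *v h = (\<Sum>j<?d. edge_form F (w j) (coord_vec (framework_of_vec h) (\<delta> j)))" for F h
  proof -
    have "rig_matrix F s *v h = (\<Sum>j<?d. edge_form F (coord_vec \<rho> (\<delta> j)) (coord_vec (framework_of_vec h) (\<delta> j)))"
      unfolding rig_matrix_edge_form s by (rule sum.reindex_bij_betw[OF \<delta>, symmetric])
    then show ?thesis by (simp add: w\<rho>)
  qed
  have lift: "\<exists>h :: real ^ ('v \<times> 'd). \<forall>j<?d. coord_vec (framework_of_vec h) (\<delta> j) = g j" for g
  proof -
    define h :: "real ^ ('v \<times> 'd)" where "h = (\<chi> k. g (the_inv_into {..<?d} \<delta> (snd k)) $ fst k)"
    have "coord_vec (framework_of_vec h) (\<delta> j) = g j" if "j < ?d" for j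
      using \<delta> that by (simp add: coord_vec_def framework_of_vec_def h_def vec_eq_iff bij_betw_def the_inv_into_f_f)
    then show ?thesis by blast
  qed
  have d0: "0 < ?d" by simp
  \<comment> \<open>Moving the vertices by \<open>x\<close> in a single coordinate direction
    preserves edge lengths to first order, so by infinitesimal rigidity it preserves all distances.
    Coordinates of distinct vertices differ by genericity, hence \<open>x\<close> is
    constant.\<close>
  have edge_const: "x $ u = x $ v" if x: "\<And>u w. {u, w} \<in> E \<Longrightarrow> x $ u = x $ w" for x :: "real ^ 'v" and u v
  proof (cases "u = v")
    case False
    obtain h :: "real ^ ('v \<times> 'd)" where h: "\<And>j. j < ?d \<Longrightarrow> coord_vec (framework_of_vec h) (\<delta> j) = (if j = 0 then x else 0)"
      using lift[of "\<lambda>j. if j = 0 then x else 0"] by blast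
    have z: "edge_form F y 0 = 0" for F and y :: "real ^ 'v" by (simp add: edge_form_def vec_eq_iff)
    have rh: "rig_matrix F s *v h = edge_form F (w 0) x" for F
    proof -
      have "rig_matrix F s *v h = (\<Sum>j<?d. if j = 0 then edge_form F (w 0) x else 0)"
        unfolding rig_sum by (intro sum.cong refl) (simp add: h z)
      then show ?thesis using d0 by simp
    qed
    have "edge_form E (w 0) x = 0" using x by (simp add: edge_form_def vec_eq_iff)
    then have "edge_form UNIV (w 0) x = 0" using inf_rigid[of h UNIV] by (simp add: rh)
    then have "edge_form UNIV (w 0) x $ (u, v) = 0" by simp
    then have *: "(\<rho> $ u $ \<delta> 0 - \<rho> $ v $ \<delta> 0) * (x $ u - x $ v) = 0"
      by (simp add: edge_form_def w\<rho> coord_vec_def)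
    have "\<rho> $ u $ \<delta> 0 - \<rho> $ v $ \<delta> 0 \<noteq> 0"
    proof
      assume "\<rho> $ u $ \<delta> 0 - \<rho> $ v $ \<delta> 0 = 0"
      then show False
        using generic_ratpoly_eq_0[OF gen ratpoly_diff[OF ratpoly_var ratpoly_var],
            of "(u, \<delta> 0)" "(v, \<delta> 0)" "\<lambda>k. if k = (u, \<delta> 0) then 1 else 0"] False by simp
    qed
    then show ?thesis using * by simp
  qed simp
  have coeff: "C i j + C j i = 0"
    if "(\<Sum>i<n. \<Sum>j<n. C i j *\<^sub>R edge_form UNIV (w i) (w j)) = 0" "i < n" "j < n" for C i j
  proof (rule edge_form_UNIV_independent[where n = n and w = w and C = C])
    show "a i = 0" if "(\<Sum>i<n. a i *\<^sub>R w i) = (\<chi> u. c)" "i < n" for a c i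
      using ind_all that by blast
  qed (fact that)+
  define \<phi> :: "real ^ ('v \<times> 'v) \<Rightarrow> real" where "\<phi> = (\<lambda>y. \<Sum>k\<in>UNIV. y $ k)"
  let ?I = "{(i, j). j < ?d \<and> j \<le> i \<and> i < n}"
  interpret T: trapezoid "edge_form E" w n ?d \<phi>
  proof (rule trapezoid.intro)
    show "1 \<le> ?d" "?d < n" using dn d0 by linarith+
    show "bilinear (edge_form E)" by (rule bilinear_edge_form)
    show "edge_form E x y = edge_form E y x" for x y by (rule edge_form_commute)
    show "a i = 0" if "(\<Sum>i<n. a i *\<^sub>R w i) = 0" "i < n" for a i
      using ind[of a 0] that by (simp add: zero_vec_def)
    show "linear \<phi>"
      by (rule linearI) (simp_all add: \<phi>_def sum.distrib sum_distrib_left)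
  next
    fix x assume x: "x \<in> span (w ` {..<n})" "x \<noteq> 0"
    have nn: "edge_form E x x $ k \<ge> 0" for k by (simp add: edge_form_def)
    \<comment> \<open>If the total squared length vanishes, \<open>x\<close> is constant along
      edges, hence constant, and the \<open>w i\<close> are independent modulo constants.\<close>
    have "\<phi> (edge_form E x x) \<noteq> 0"
    proof
      assume "\<phi> (edge_form E x x) = 0"
      then have "\<forall>k\<in>UNIV. edge_form E x x $ k = 0"
        unfolding \<phi>_def by (subst (asm) sum_nonneg_eq_0_iff) (use nn in simp_all)
      then have 0: "edge_form E x x $ k = 0" for k by blast
      have "x $ u = x $ v" if "{u, v} \<in> E" for u v
        using 0[of "(u, v)"] that by (simp add: edge_form_def)
      then have c: "x = (\<chi> u. x $ undefined)" using edge_const[of x] by (simp add: vec_eq_iff)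
      have "\<exists>a. x = (\<Sum>i<n. a i *\<^sub>R w i)"
        using x(1)
      proof (induction rule: span_induct_alt)
        case base
        then show ?case by (intro exI[of _ "\<lambda>_. 0"]) simp
      next
        case (step c x y)
        then obtain i a where i: "i < n" "x = w i" and a: "y = (\<Sum>i<n. a i *\<^sub>R w i)" by auto
        have "c *\<^sub>R x + y = (\<Sum>j<n. ((if j = i then c else 0) + a j) *\<^sub>R w j)"
          using i a by (simp add: scaleR_add_left sum.distrib if_distrib[of "\<lambda>x. x *\<^sub>R _"] cong: if_cong)
        then show ?case by (intro exI[of _ "\<lambda>j. (if j = i then c else 0) + a j"])
      qed
      then obtain a where a: "x = (\<Sum>i<n. a i *\<^sub>R w i)" by blast
      then have "(\<Sum>i<n. a i *\<^sub>R w i) = (\<chi> u. x $ undefined)" using c by metis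
      then have "a i = 0" if "i < n" for i using ind that by blast
      then show False using a x(2) by simp
    qed
    then show "\<phi> (edge_form E x x) > 0"
      using sum_nonneg[of UNIV "\<lambda>k. edge_form E x x $ k"] nn by (simp add: \<phi>_def less_le)
  next
    fix c i j
    assume 0: "(\<Sum>(i, j)\<in>?I. c (i, j) *\<^sub>R edge_form E (w i) (w j)) = 0"
      and ij: "j < ?d" "j \<le> i" "i < n"
    \<comment> \<open>A linear relation is an infinitesimal motion \<open>h\<close> with these
      coefficients. Infinitesimal rigidity extends it to all pairs, so the symmetric part of
      \<open>C\<close> vanishes, and a lower trapezoidal \<open>C\<close> with this property is
      zero.\<close>
    define C where "C = (\<lambda>i j. if (i, j) \<in> ?I then c (i, j) else 0)"
    have sumC: "(\<Sum>i<n. \<Sum>j<n. C i j *\<^sub>R edge_form F (w i) (w j)) = (\<Sum>j<?d. edge_form F (w j) (\<Sum>i<n. C i j *\<^sub>R w i))" for F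
    proof -
      have "(\<Sum>i<n. \<Sum>j<n. C i j *\<^sub>R edge_form F (w i) (w j)) = (\<Sum>j<n. \<Sum>i<n. C i j *\<^sub>R edge_form F (w i) (w j))"
        by (rule sum.swap)
      also have "\<dots> = (\<Sum>j<?d. \<Sum>i<n. C i j *\<^sub>R edge_form F (w i) (w j))"
        using dn by (intro sum.mono_neutral_right) (auto simp: C_def)
      finally show ?thesis by (simp add: edge_form_simps edge_form_commute[of F "w _" "w _"])
    qed
    have "(\<Sum>i<n. \<Sum>j<n. C i j *\<^sub>R edge_form E (w i) (w j))
        = (\<Sum>(i, j)\<in>{..<n} \<times> {..<n}. C i j *\<^sub>R edge_form E (w i) (w j))"
      by (rule sum.cartesian_product)
    also have "\<dots> = (\<Sum>(i, j)\<in>?I. C i j *\<^sub>R edge_form E (w i) (w j))"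
      using dn by (intro sum.mono_neutral_right) (auto simp: C_def split: if_splits)
    also have "\<dots> = (\<Sum>(i, j)\<in>?I. c (i, j) *\<^sub>R edge_form E (w i) (w j))"
      by (intro sum.cong) (auto simp: C_def)
    finally have E0: "(\<Sum>i<n. \<Sum>j<n. C i j *\<^sub>R edge_form E (w i) (w j)) = 0" using 0 by simp
    obtain h :: "real ^ ('v \<times> 'd)" where h: "\<And>j. j < ?d \<Longrightarrow> coord_vec (framework_of_vec h) (\<delta> j) = (\<Sum>i<n. C i j *\<^sub>R w i)"
      using lift[of "\<lambda>j. \<Sum>i<n. C i j *\<^sub>R w i"] by blast
    have rh: "rig_matrix F s *v h = (\<Sum>i<n. \<Sum>j<n. C i j *\<^sub>R edge_form F (w i) (w j))" for F
      unfolding rig_sum sumC by (simp add: h)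
    then have "(\<Sum>i<n. \<Sum>j<n. C i j *\<^sub>R edge_form UNIV (w i) (w j)) = 0"
      using inf_rigid[of h UNIV] E0 by simp
    then have "C i j + C j i = 0" using coeff ij by simp
    then show "c (i, j) = 0" using ij by (cases "i = j") (auto simp: C_def)
  next
    fix i i' assume i: "i < n" "i' < n"
    let ?Z = "(\<lambda>(i, j). edge_form E (w i) (w j)) ` ?I"
    show "edge_form E (w i) (w i') \<in> span ?Z"
    proof (rule contact_locus_span[OF gen \<omega> min _ Kspan])
      show "w ` {..<n} \<subseteq> ?K" by (rule wK)
      fix x k assume "x \<in> w ` {..<n}"
      then obtain l where l: "l < n" "x = w l" by auto
      obtain j where j: "j < ?d" "k = \<delta> j" using \<delta> by (metis UNIV_I bij_betwE bij_betw_def imageE lessThan_iff)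
      have "edge_form E (w l) (w j) \<in> ?Z"
      proof (cases "j \<le> l")
        case True
        then show ?thesis using l j by (intro image_eqI[of _ _ "(l, j)"]) auto
      next
        case False
        then show ?thesis
          using l j dn by (intro image_eqI[of _ _ "(j, l)"]) (auto simp: edge_form_commute[of E "w l"])
      qed
      then show "edge_form E x (coord_vec \<rho> k) \<in> span ?Z" using l j w\<rho>[OF j(1)] by (simp add: span_base)
    qed (use i in auto)
  qed
  interpret trapezoid_unique "edge_form E" w n ?d \<phi>
  proof
    fix V i i' assume V: "T.supp V" "T.f V = T.b" and i: "i < n" "i' < n"
    obtain t :: "real ^ ('v \<times> 'd)" where t: "\<And>j. j < ?d \<Longrightarrow> coord_vec (framework_of_vec t) (\<delta> j) = T.col V j"
      using lift[of "T.col V"] by blast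
    have rt: "rig_matrix F t *v t = (\<Sum>j<?d. edge_form F (T.col V j) (T.col V j))" for F
    proof -
      have "rig_matrix F t *v t = (\<Sum>j<?d. edge_form F (coord_vec (framework_of_vec t) (\<delta> j)) (coord_vec (framework_of_vec t) (\<delta> j)))"
        unfolding rig_matrix_edge_form by (rule sum.reindex_bij_betw[OF \<delta>, symmetric])
      then show ?thesis by (simp add: t)
    qed
    have rs: "rig_matrix F s *v s = (\<Sum>j<?d. edge_form F (w j) (w j))" for F
      unfolding rig_sum by (simp add: s w\<rho>)
    have "rig_matrix E t *v t = rig_matrix E s *v s"
      using V(2) by (simp add: rt rs T.f_def T.b_def T.col_Idm)
    then have "length_sq E (framework_of_vec t) = length_sq E (framework_of_vec s)" by (rule length_sq_cong[OF assms(1)])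
    then have "congruent_frameworks (framework_of_vec s) (framework_of_vec t)" using glob by (simp add: globally_rigid_def s)
    then have eqU: "rig_matrix UNIV s *v s = rig_matrix UNIV t *v t" by (rule congruent_lengths)
    \<comment> \<open>The difference of the products of \<open>V\<close> and of \<open>Idm\<close>
      with their transposes. It is symmetric, and equality of all distances makes it vanish.\<close>
    define C where "C = (\<lambda>i i'. (\<Sum>j<?d. V i j * V i' j) - (if i = i' \<and> i < ?d then 1 else 0))"
    have "(\<Sum>i<n. \<Sum>i'<n. C i i' *\<^sub>R edge_form UNIV (w i) (w i')) = rig_matrix UNIV t *v t - rig_matrix UNIV s *v s"
    proof -
      have 1: "(\<Sum>i<n. \<Sum>i'<n. (\<Sum>j<?d. V i j * V i' j) *\<^sub>R edge_form UNIV (w i) (w i')) = rig_matrix UNIV t *v t"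
      proof -
        have "edge_form UNIV (T.col V j) (T.col V j) = (\<Sum>i<n. \<Sum>i'<n. (V i j * V i' j) *\<^sub>R edge_form UNIV (w i) (w i'))" for j
          unfolding T.col_def edge_form_simps(5) by (simp only: edge_form_simps scaleR_sum_right scaleR_scaleR mult.commute)
        then have "rig_matrix UNIV t *v t = (\<Sum>j<?d. \<Sum>i<n. \<Sum>i'<n. (V i j * V i' j) *\<^sub>R edge_form UNIV (w i) (w i'))"
          by (simp add: rt)
        also have "\<dots> = (\<Sum>i<n. \<Sum>j<?d. \<Sum>i'<n. (V i j * V i' j) *\<^sub>R edge_form UNIV (w i) (w i'))"
          by (rule sum.swap)
        also have "\<dots> = (\<Sum>i<n. \<Sum>i'<n. \<Sum>j<?d. (V i j * V i' j) *\<^sub>R edge_form UNIV (w i) (w i'))"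
          by (rule sum.cong[OF refl]) (rule sum.swap)
        finally show ?thesis by (simp add: scaleR_sum_left)
      qed
      have 2: "(\<Sum>i<n. \<Sum>i'<n. (if i = i' \<and> i < ?d then 1 else 0) *\<^sub>R edge_form UNIV (w i) (w i')) = rig_matrix UNIV s *v s"
      proof -
        have "(\<Sum>i'<n. (if i = i' \<and> i < ?d then 1 else 0) *\<^sub>R edge_form UNIV (w i) (w i'))
            = (if i < ?d then edge_form UNIV (w i) (w i) else 0)" if "i < n" for i
          using that by (cases "i < ?d") (simp_all add: if_distrib[of "\<lambda>x. x *\<^sub>R _"] cong: if_cong)
        then have "(\<Sum>i<n. \<Sum>i'<n. (if i = i' \<and> i < ?d then 1 else 0) *\<^sub>R edge_form UNIV (w i) (w i'))
            = (\<Sum>i<n. if i < ?d then edge_form UNIV (w i) (w i) else 0)" by simp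
        also have "\<dots> = (\<Sum>i<?d. if i < ?d then edge_form UNIV (w i) (w i) else 0)"
          using dn by (intro sum.mono_neutral_right) auto
        finally show ?thesis by (simp add: rs)
      qed
      show ?thesis by (simp add: C_def scaleR_diff_left sum_subtractf 1 2)
    qed
    then have "C i i' + C i' i = 0" using eqU i by (intro coeff) simp_all
    moreover have "C i' i = C i i'" by (auto simp: C_def mult.commute)
    ultimately show "(\<Sum>j<?d. V i j * V i' j) = (if i = i' \<and> i < ?d then 1 else 0)"
      by (simp add: C_def)
  qed
  show False by (rule contradiction)
qed

end
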